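(* Let $n$ be a positive integer, let $X,Y\in M_n(\mathbb{C})$ and let $s,t\in\mathbb{C}$. Define the $2n\times 2n$ normal matrices $$N(X,s):=\begin{pmatrix} X & (X-sI_n)^* \\ (X-sI_n)^* & X\end{pmatrix},\qquad N(Y,t):=\begin{pmatrix} Y & (Y-tI_n)^* \\ (Y-tI_n)^* & Y\end{pmatrix}.$$ Then $(N(X,s),N(Y,t))\in MOC$; that is, if $a_1,\dots,a_{2n}$ and $b_1,\dots,b_{2n}$ are the eigenvalues (listed with multiplicity) of $N(X,s)$ and $N(Y,t)$ respectively, then $$\det\bigl(N(X,s)+N(Y,t)\bigr)\in \mathrm{co}\Bigl\{\prod_{i=1}^{2n}\bigl(a_i+b_{\sigma(i)}\bigr)\ \Big|\ \sigma\in S_{2n}\Bigr\}.$$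
   Context: $M_n(\mathbb{C})$ is the set of $n\times n$ complex matrices, $I_n$ the identity matrix, $^*$ the conjugate transpose, $S_m$ the symmetric group on $\{1,\dots,m\}$, and $\mathrm{co}$ denotes the convex hull in $\mathbb{C}$ (viewed as a real vector space). For normal matrices $A,B\in M_m(\mathbb{C})$ with eigenvalues $a_1,\dots,a_m$ and $b_1,\dots,b_m$ (listed with multiplicity), one writes $(A,B)\in MOC$ (the pair affirms the Marcus–de Oliveira conjecture) if $\det(A+B)\in \mathrm{co}\{\prod_{i=1}^m(a_i+b_{\sigma(i)}) \mid \sigma\in S_m\}$. *)

theory Defs
  imports
    "HOL-Analysis.Convex"
    "HOL-Combinatorics.Permutations"
    "Jordan_Normal_Form.Char_Poly"
    "Jordan_Normal_Form.Schur_Decomposition"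
begin

definition normal_mat :: "complex mat \<Rightarrow> bool" where
  "normal_mat A \<longleftrightarrow> square_mat A \<and> A * mat_adjoint A = mat_adjoint A * A"

text \<open>\<open>a 1, \<dots>, a m\<close> lists the eigenvalues of \<open>A\<close> with algebraic multiplicity; the values of
  \<open>a\<close> outside \<open>{1..m}\<close> are irrelevant. Over the complex numbers such a listing always exists
  (\<open>char_poly_factorized\<close>).\<close>

definition eigenvalue_listing :: "nat \<Rightarrow> complex mat \<Rightarrow> (nat \<Rightarrow> complex) \<Rightarrow> bool" where
  "eigenvalue_listing m A a \<longleftrightarrow>
     A \<in> carrier_mat m m \<and> char_poly A = (\<Prod>i\<in>{1..m}. [:- a i, 1:])"

text \<open>Normality of both matrices is part of membership. The hull does not depend on the chosen
  listings, so quantifying over all of them is harmless.\<close>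

definition MOC :: "(complex mat \<times> complex mat) set" where
  "MOC = {(A, B). \<exists>m. A \<in> carrier_mat m m \<and> B \<in> carrier_mat m m \<and>
     normal_mat A \<and> normal_mat B \<and>
     (\<forall>a b. eigenvalue_listing m A a \<longrightarrow> eigenvalue_listing m B b \<longrightarrow>
        det (A + B) \<in> convex hull {\<Prod>i\<in>{1..m}. a i + b (\<sigma> i) | \<sigma>. \<sigma> permutes {1..m}})}"

definition N :: "complex mat \<Rightarrow> complex \<Rightarrow> complex mat" where
  "N X s = (let Z = mat_adjoint (X - s \<cdot>\<^sub>m 1\<^sub>m (dim_row X)) in four_block_mat X Z Z X)"

end

theory Submission
  imports "HOL-Analysis.Convex_Euclidean_Space" "HOL-Analysis.Function_Topology" Defs
begin

text \<open>Conjugating by the block matrix with rows \<open>(1, 1)\<close> and \<open>(1, -1)\<close> splits \<open>N(X, s)\<close> into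
  \<open>X + X\<^sup>* - cnj s\<close> and \<open>X - X\<^sup>* + cnj s\<close>, so that the claim follows from Drury's theorem: for Hermitian
  \<open>A\<close>, \<open>B\<close> and complex \<open>c\<close>, \<open>det (A + B - c)\<close> lies in the convex hull of the products of the
  \<open>a\<^sub>i + b\<^sub>\<sigma>\<^sub>(\<^sub>i\<^sub>) - c\<close>.

  For the latter let \<open>c\<close> be non-real, and for fixed \<open>e\<close> maximize \<open>Re (e det (A + B' - c))\<close> over the unitary
  orbit of \<open>B\<close>. If a non-scalar matrix commutes with \<open>A\<close> and \<open>B'\<close>, both split into smaller blocks and
  induction applies. Otherwise put \<open>S = A + B'\<close> and \<open>w = e det (S - c)\<close>. The first variation says that \<open>B'\<close>
  commutes with \<open>g(S)\<close>, where \<open>g(x) = Re (w / (x - c))\<close>, so \<open>g(S)\<close> is scalar and \<open>S\<close> has exactly two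
  eigenvalues \<open>x\<close> and \<open>y\<close>. Writing \<open>D\<close> for the velocity of \<open>B'\<close>, the second variation only involves the
  diagonal blocks of \<open>D\<close> with respect to the eigenspaces of \<open>S\<close>, with the coefficients
  \<open>Re (w / (x - c)\<^sup>2)\<close> and \<open>Re (w / (y - c)\<^sup>2)\<close>, which have opposite signs. By irreducibility these blocks
  can be prescribed freely up to the trace, and in dimension at least three some choice gives an increase.
  Real \<open>c\<close> follow by continuity.\<close>

section \<open>Unitary diagonalization\<close>

text \<open>A non-real \<open>c\<close> is never an eigenvalue of a Hermitian matrix, so all
  quotients \<open>w / (x - c)\<close> make sense. Moreover, for distinct real \<open>x\<close> the
  numbers \<open>x - c\<close> are not real multiples of each other; this is what limits the
  spectrum of \<open>S\<close> to two points and forces the opposite signs. Let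
  \<open>Q x = Re (w / (x - c)^2)\<close>. If \<open>D\<close> has diagonal \<open>\<delta>\<close>
  on the block of \<open>x\<close> and is zero elsewhere in that block, the block contributes
  \<open>Q x * (T^2 - \<Sum> \<delta>^2)\<close> to the second variation, with \<open>T\<close> its
  trace. Two blocks of size one contribute nothing, which is why dimension two is treated by hand.
  From dimension three on, either the block with \<open>Q x < 0\<close> has size at least two and a
  traceless choice gains, or the other block has size at least two and spreading the trace evenly
  over it gains. The argument does not identify the maximizer; it only shows that the maximizing
  pair splits. The induction therefore carries a bound in every direction \<open>e\<close>, a
  property that is multiplicative over blocks.\<close>

lemma adjoint_dim [simp]:
  "dim_row (mat_adjoint A) = dim_col A" "dim_col (mat_adjoint A) = dim_row A"
  unfolding mat_adjoint_def by auto

lemma adjoint_carrier [simp]: "A \<in> carrier_mat n m \<Longrightarrow> mat_adjoint A \<in> carrier_mat m n"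
  unfolding mat_adjoint_def by auto

lemma adjoint_index [simp]:
  "i < dim_col A \<Longrightarrow> j < dim_row A \<Longrightarrow> mat_adjoint A $$ (i,j) = conjugate (A $$ (j,i))"
  unfolding mat_adjoint_def by (auto simp: mat_of_rows_def)

lemma adjoint_adjoint [simp]: "mat_adjoint (mat_adjoint A) = A"
  by (rule eq_matI) auto

lemma adjoint_mult:
  fixes A B :: "complex mat"
  assumes "A \<in> carrier_mat n m" "B \<in> carrier_mat m k"
  shows "mat_adjoint (A * B) = mat_adjoint B * mat_adjoint A"
  using assms by (intro eq_matI) (auto simp: scalar_prod_def mult.commute)

lemma adjoint_add:
  fixes A B :: "complex mat"
  assumes "A \<in> carrier_mat n m" "B \<in> carrier_mat n m"
  shows "mat_adjoint (A + B) = mat_adjoint A + mat_adjoint B"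
  using assms by (intro eq_matI) auto

lemma adjoint_minus:
  fixes A B :: "complex mat"
  assumes "A \<in> carrier_mat n m" "B \<in> carrier_mat n m"
  shows "mat_adjoint (A - B) = mat_adjoint A - mat_adjoint B"
  using assms by (intro eq_matI) auto

lemma adjoint_one [simp]: "mat_adjoint (1\<^sub>m n) = (1\<^sub>m n :: complex mat)"
  by (intro eq_matI) auto

lemma adjoint_four_block:
  fixes A B C D :: "complex mat"
  assumes "A \<in> carrier_mat n1 m1" "B \<in> carrier_mat n1 m2" "C \<in> carrier_mat n2 m1" "D \<in> carrier_mat n2 m2"
  shows "mat_adjoint (four_block_mat A B C D) =
    four_block_mat (mat_adjoint A) (mat_adjoint C) (mat_adjoint B) (mat_adjoint D)"
  using assms by (intro eq_matI) auto

lemma adjoint_mat_diag: "mat_adjoint (mat_diag n f) = mat_diag n (\<lambda>i. cnj (f i))"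
  by (intro eq_matI) (auto simp: mat_diag_def)

section \<open>Unitary matrices and conjugation by them\<close>

definition unitary_mat :: "nat \<Rightarrow> complex mat \<Rightarrow> bool" where
  "unitary_mat n U \<longleftrightarrow> U \<in> carrier_mat n n \<and> mat_adjoint U * U = 1\<^sub>m n"

lemma unitary_mat_carrier: "unitary_mat n U \<Longrightarrow> U \<in> carrier_mat n n"
  by (simp add: unitary_mat_def)

lemma unitary_mat_left: "unitary_mat n U \<Longrightarrow> mat_adjoint U * U = 1\<^sub>m n"
  by (simp add: unitary_mat_def)

lemma unitary_mat_right: "unitary_mat n U \<Longrightarrow> U * mat_adjoint U = 1\<^sub>m n"
  using mat_mult_left_right_inverse[of "mat_adjoint U" n U] by (simp add: unitary_mat_def)

lemma unitary_mat_mult: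
  assumes "unitary_mat n U" "unitary_mat n V"
  shows "unitary_mat n (U * V)"
proof -
  note [simp] = unitary_mat_carrier[OF assms(1)] unitary_mat_carrier[OF assms(2)]
  have "mat_adjoint (U * V) * (U * V) = mat_adjoint V * ((mat_adjoint U * U) * V)"
    by (simp add: adjoint_mult[of _ n n _ n] mult_carrier_mat[of _ n n _ n] assoc_mult_mat[of _ n n _ n _ n])
  then show ?thesis
    using assms by (simp add: unitary_mat_def mult_carrier_mat[of _ n n] left_mult_one_mat[of _ n n])
qed

lemma unitary_mat_adjoint: "unitary_mat n U \<Longrightarrow> unitary_mat n (mat_adjoint U)"
  using unitary_mat_right[of n U] by (simp add: unitary_mat_def)

lemma unitary_mat_one: "unitary_mat n (1\<^sub>m n)"
  by (simp add: unitary_mat_def)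

lemma adjoint_conj:
  fixes U A :: "complex mat"
  assumes "U \<in> carrier_mat n n" "A \<in> carrier_mat n n"
  shows "mat_adjoint (U * A * mat_adjoint U) = U * mat_adjoint A * mat_adjoint U"
  using assms by (simp add: adjoint_mult[of _ n n _ n] mult_carrier_mat[of _ n n _ n] assoc_mult_mat[of _ n n _ n _ n])

lemma unitary_conj_cancel:
  assumes U: "unitary_mat n U" and A: "A \<in> carrier_mat n n"
  shows "U * (mat_adjoint U * A * U) * mat_adjoint U = A"
    and "mat_adjoint U * (U * A * mat_adjoint U) * U = A"
proof -
  note [simp] = unitary_mat_carrier[OF U] A
  have "U * (mat_adjoint U * A * U) * mat_adjoint U = (U * mat_adjoint U) * A * (U * mat_adjoint U)"
    by (simp add: mult_carrier_mat[of _ n n _ n] assoc_mult_mat[of _ n n _ n _ n])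
  then show "U * (mat_adjoint U * A * U) * mat_adjoint U = A"
    using unitary_mat_right[OF U] A by simp
  have "mat_adjoint U * (U * A * mat_adjoint U) * U = (mat_adjoint U * U) * A * (mat_adjoint U * U)"
    by (simp add: mult_carrier_mat[of _ n n _ n] assoc_mult_mat[of _ n n _ n _ n])
  then show "mat_adjoint U * (U * A * mat_adjoint U) * U = A"
    using unitary_mat_left[OF U] A by simp
qed

lemma unitary_conj_similar:
  assumes U: "unitary_mat n U" and A: "A \<in> carrier_mat n n"
  shows "similar_mat (U * A * mat_adjoint U) A"
proof -
  have "similar_mat_wit (U * A * mat_adjoint U) A U (mat_adjoint U)"
    by (rule similar_mat_witI[of _ _ n])
      (use assms unitary_mat_left[OF U] unitary_mat_right[OF U] unitary_mat_carrier[OF U] in auto)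
  then show ?thesis unfolding similar_mat_def by blast
qed

lemma unitary_conj_mult:
  assumes U: "unitary_mat n U" and A: "A \<in> carrier_mat n n" and B: "B \<in> carrier_mat n n"
  shows "(U * A * mat_adjoint U) * (U * B * mat_adjoint U) = U * (A * B) * mat_adjoint U"
proof -
  note [simp] = unitary_mat_carrier[OF U] A B
  have "(U * A * mat_adjoint U) * (U * B * mat_adjoint U) = U * A * (mat_adjoint U * U) * (B * mat_adjoint U)"
    by (simp add: mult_carrier_mat[of _ n n _ n] assoc_mult_mat[of _ n n _ n _ n])
  also have "\<dots> = U * (A * B) * mat_adjoint U"
    using unitary_mat_left[OF U]
    by (simp add: mult_carrier_mat[of _ n n _ n] assoc_mult_mat[of _ n n _ n _ n] left_mult_one_mat[of _ n n])
  finally show ?thesis .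
qed

lemma unitary_conj_add:
  assumes "U \<in> carrier_mat n n" "A \<in> carrier_mat n n" "B \<in> carrier_mat n n"
  shows "U * (A + B) * mat_adjoint U = U * A * mat_adjoint U + U * B * mat_adjoint U"
  using assms by (simp add: mult_add_distrib_mat[of _ n n _ n] add_mult_distrib_mat[of _ n n _ _ n] mult_carrier_mat[of _ n n _ n])

lemma unitary_conj_smult_one:
  assumes U: "unitary_mat n U"
  shows "U * (c \<cdot>\<^sub>m 1\<^sub>m n) * mat_adjoint U = c \<cdot>\<^sub>m 1\<^sub>m n"
  using unitary_mat_carrier[OF U] unitary_mat_right[OF U]
  by (simp add: mult_smult_distrib[of _ n n _ n] mult_smult_assoc_mat[of _ n n _ n])

text \<open>Gram-Schmidt applied to a basis that starts with \<open>v\<close> gives orthogonal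
  columns \<open>ws\<close>; dividing column \<open>j\<close> by its norm \<open>nr j\<close> makes
  the matrix unitary. This rescaling is the source of the factor \<open>r\<close>, which is harmless
  for an eigenvector.\<close>

lemma unitary_mat_exists_first_col:
  fixes v :: "complex vec"
  assumes v: "v \<in> carrier_vec n" and v0: "v \<noteq> 0\<^sub>v n"
  obtains W r where "unitary_mat n W" "col W 0 = r \<cdot>\<^sub>v v" "(r::complex) \<noteq> 0"
proof -
  interpret cof_vec_space n "TYPE(complex)" .
  have n: "n > 0"
    using v v0 by (cases n) auto
  define b where "b = basis_completion v"
  define ws where "ws = gram_schmidt n b"
  from basis_completion[OF v v0, folded b_def]
  have dist_b: "distinct b" and indep: "\<not> lin_dep (set b)" and b: "set b \<subseteq> carrier_vec n"
    and hdb: "hd b = v" and len_b: "length b = n" by auto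
  from hdb len_b n obtain vs where bv: "b = v # vs" by (cases b) auto
  from gram_schmidt_result[OF b dist_b indep refl, folded ws_def]
  have ws: "set ws \<subseteq> carrier_vec n" "corthogonal ws" "length ws = n"
    by (auto simp: len_b)
  from gram_schmidt_hd[OF v, of vs, folded bv] have "hd ws = v" unfolding ws_def .
  then have ws0: "ws ! 0 = v" using n ws(3) by (cases ws) auto
  define nr where "nr j = complex_of_real (sqrt (Re (ws ! j \<bullet>c ws ! j)))" for j
  have wsj: "ws ! j \<in> carrier_vec n" if "j < n" for j
    using ws that by auto
  have nr2: "nr j * nr j = ws ! j \<bullet>c ws ! j" "nr j \<noteq> 0" "cnj (nr j) = nr j" if j: "j < n" for j
  proof -
    have "ws ! j \<bullet>c ws ! j \<ge> 0" using conjugate_square_ge_0_vec by blast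
    moreover have "ws ! j \<bullet>c ws ! j \<noteq> 0"
      using corthogonalD[OF ws(2)] j ws(3) by auto
    ultimately have *: "Re (ws ! j \<bullet>c ws ! j) > 0" "Im (ws ! j \<bullet>c ws ! j) = 0"
      by (auto simp: less_eq_complex_def complex_eq_iff)
    then show "nr j * nr j = ws ! j \<bullet>c ws ! j"
      unfolding nr_def by (simp add: complex_eq_iff flip: of_real_mult)
    show "nr j \<noteq> 0" using * by (simp add: nr_def)
    show "cnj (nr j) = nr j" by (simp add: nr_def)
  qed
  define W where "W = mat n n (\<lambda>(i,j). (ws ! j) $ i / nr j)"
  have "mat_adjoint W * W = 1\<^sub>m n"
  proof (rule eq_matI)
    fix i j assume "i < dim_row (1\<^sub>m n)" "j < dim_col (1\<^sub>m n)"
    then have i: "i < n" and j: "j < n" by auto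
    have "(mat_adjoint W * W) $$ (i,j) = (\<Sum>k<n. cnj ((ws ! i) $ k) * (ws ! j) $ k / (nr i * nr j))"
      using i j nr2(3)[OF i] by (simp add: W_def scalar_prod_def lessThan_atLeast0)
    also have "\<dots> = (ws ! j \<bullet>c ws ! i) / (nr i * nr j)"
      using wsj[OF i] wsj[OF j] i j
      by (simp add: scalar_prod_def sum_divide_distrib lessThan_atLeast0 mult.commute)
    also have "\<dots> = 1\<^sub>m n $$ (i,j)"
      using corthogonalD[OF ws(2), of j i] i j ws(3) nr2[OF i] by auto
    finally show "(mat_adjoint W * W) $$ (i,j) = 1\<^sub>m n $$ (i,j)" .
  qed (auto simp: W_def)
  then have "unitary_mat n W" by (auto simp: unitary_mat_def W_def)
  moreover have "col W 0 = (1 / nr 0) \<cdot>\<^sub>v v"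
    using n v ws0 by (intro eq_vecI) (auto simp: W_def)
  ultimately show ?thesis using that nr2(2)[OF n] by force
qed

section \<open>Block diagonal products and the spectral theorem\<close>

lemma mult_block_diag:
  fixes A B C D :: "complex mat"
  assumes "A \<in> carrier_mat k k" "C \<in> carrier_mat k k" "B \<in> carrier_mat m m" "D \<in> carrier_mat m m"
  shows "four_block_mat A (0\<^sub>m k m) (0\<^sub>m m k) B * four_block_mat C (0\<^sub>m k m) (0\<^sub>m m k) D =
    four_block_mat (A * C) (0\<^sub>m k m) (0\<^sub>m m k) (B * D)"
proof -
  have "A * C + 0\<^sub>m k k = A * C" "0\<^sub>m m m + B * D = B * D"
    using assms by (auto simp: left_add_zero_mat[of _ m m] right_add_zero_mat[of _ k k])
  then show ?thesis using assms
    by (subst mult_four_block_mat[of _ k k _ m _ m _ _ k _ m]) auto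
qed

lemma mat_diag_Cons_four_block:
  "mat_diag (Suc m) (\<lambda>i. (e # es) ! i) =
   four_block_mat (mat 1 1 (\<lambda>_. e)) (0\<^sub>m 1 m) (0\<^sub>m m 1) (mat_diag m (\<lambda>i. es ! i))"
  by (rule eq_matI) (auto simp: mat_diag_def nth_Cons')

text \<open>Deflation: a multiple of an eigenvector for the head of \<open>es\<close> becomes the
  first column of a unitary \<open>W\<close>, and \<open>mat_adjoint W * A * W\<close>, being
  Hermitian, splits off a block of size one. The order of \<open>es\<close> is prescribed, so that
  equal eigenvalues can later be grouped at will.\<close>

theorem hermitian_spectral:
  fixes A :: "complex mat"
  assumes "A \<in> carrier_mat n n" "mat_adjoint A = A" "char_poly A = (\<Prod>e\<leftarrow>es. [:- e, 1:])"
  shows "length es = n \<and> (\<forall>e\<in>set es. Im e = 0) \<and>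
    (\<exists>U. unitary_mat n U \<and> A = U * mat_diag n (\<lambda>i. es ! i) * mat_adjoint U)"
  using assms
proof (induction es arbitrary: n A)
  case Nil
  with degree_monic_char_poly[of A n] have "n = 0" by auto
  with Nil show ?case
    by (auto intro!: exI[of _ "1\<^sub>m 0"] simp: unitary_mat_def)
next
  case (Cons e es n A)
  note A = Cons.prems(1) and herm = Cons.prems(2)
  have cp: "char_poly A = [: -e, 1 :] * (\<Prod>e \<leftarrow> es. [:- e, 1:])" using Cons.prems(3) by auto
  have mon: "monic (\<Prod>e\<leftarrow> es. [:- e, 1:])" by (rule monic_prod_list, auto)
  have deg: "degree (char_poly A) = Suc (degree (\<Prod>e\<leftarrow> es. [:- e, 1:]))" unfolding cp
    by (subst degree_mult_eq, insert mon, auto)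
  with degree_monic_char_poly[OF A] obtain m where n: "n = Suc m" by (cases n) auto
  have "eigenvalue A e"
    unfolding eigenvalue_root_char_poly[OF A] cp by simp
  then obtain v where "eigenvector A v e" unfolding eigenvalue_def by auto
  then have v: "v \<in> carrier_vec n" "v \<noteq> 0\<^sub>v n" "A *\<^sub>v v = e \<cdot>\<^sub>v v"
    using A by (auto simp: eigenvector_def)
  from unitary_mat_exists_first_col[OF v(1,2)] obtain W r
    where W: "unitary_mat n W" and col: "col W 0 = r \<cdot>\<^sub>v v" and r: "r \<noteq> 0" by auto
  note WC = unitary_mat_carrier[OF W]
  define A' where "A' = mat_adjoint W * A * W"
  have A'C: "A' \<in> carrier_mat n n" using WC A by (simp add: A'_def mult_carrier_mat[of _ n n _ n])
  have herm': "mat_adjoint A' = A'"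
    using adjoint_conj[of "mat_adjoint W" n A] WC A herm unfolding A'_def by simp
  have col0: "A' $$ (i, 0) = (if i = 0 then e else 0)" if i: "i < n" for i
  proof -
    have "col A' 0 = mat_adjoint W *\<^sub>v (A *\<^sub>v col W 0)"
    proof -
      have "A' = mat_adjoint W * (A * W)" using WC A by (simp add: A'_def assoc_mult_mat[of _ n n _ n _ n])
      then show ?thesis using WC A n by (simp add: col_mult2[of _ n n _ n])
    qed
    also have "A *\<^sub>v col W 0 = e \<cdot>\<^sub>v col W 0"
      using A v by (simp add: col mult_mat_vec[of _ n n] smult_smult_assoc mult.commute)
    also have "mat_adjoint W *\<^sub>v (e \<cdot>\<^sub>v col W 0) = e \<cdot>\<^sub>v col (mat_adjoint W * W) 0"
      using WC n by (subst mult_mat_vec[of _ n n]) (auto simp: col_mult2[of _ n n _ n] intro!: carrier_vecI)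
    also have "\<dots> = e \<cdot>\<^sub>v col (1\<^sub>m n) 0" using unitary_mat_left[OF W] by simp
    finally have "col A' 0 $ i = (e \<cdot>\<^sub>v col (1\<^sub>m n) 0) $ i" by simp
    then show ?thesis using i n A'C by (auto split: if_splits)
  qed
  \<comment> \<open>Hermitian symmetry carries the zeros of the first column over to the first row;
    the corner entry, computed in both ways, is \<open>e\<close> and \<open>cnj e\<close>, so that
    \<open>e\<close> is real.\<close>
  have row0: "A' $$ (0, i) = (if i = 0 then cnj e else 0)" if i: "i < n" for i
  proof -
    have "A' $$ (0, i) = mat_adjoint A' $$ (0, i)" by (simp add: herm')
    also have "\<dots> = cnj (A' $$ (i, 0))" using A'C i n by simp
    finally show ?thesis using col0[OF i] by simp
  qed
  have e_real: "Im e = 0"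
    using col0[of 0] row0[of 0] n by (auto simp: complex_eq_iff)
  define A3 where "A3 = mat m m (\<lambda>(i,j). A' $$ (Suc i, Suc j))"
  have A3C: "A3 \<in> carrier_mat m m" by (simp add: A3_def)
  define E where "E = mat 1 1 (\<lambda>_. e)"
  have EC: "E \<in> carrier_mat 1 1" by (simp add: E_def)
  have block: "A' = four_block_mat E (0\<^sub>m 1 m) (0\<^sub>m m 1) A3"
  proof (rule eq_matI)
    fix i j
    assume "i < dim_row (four_block_mat E (0\<^sub>m 1 m) (0\<^sub>m m 1) A3)"
      "j < dim_col (four_block_mat E (0\<^sub>m 1 m) (0\<^sub>m m 1) A3)"
    then have "i < n" "j < n" using n by (auto simp: E_def A3_def)
    then show "A' $$ (i, j) = four_block_mat E (0\<^sub>m 1 m) (0\<^sub>m m 1) A3 $$ (i, j)"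
      using col0[of i] row0[of j] n by (cases i; cases j) (auto simp: E_def A3_def)
  qed (use A'C n in \<open>auto simp: E_def A3_def\<close>)
  have herm3: "mat_adjoint A3 = A3"
  proof (rule eq_matI)
    fix i j assume "i < dim_row A3" "j < dim_col A3"
    then have ij: "i < m" "j < m" by (auto simp: A3_def)
    have "mat_adjoint A' $$ (Suc i, Suc j) = cnj (A' $$ (Suc j, Suc i))"
      using A'C ij n by simp
    then show "mat_adjoint A3 $$ (i, j) = A3 $$ (i, j)"
      using ij by (simp add: herm' A3_def)
  qed (auto simp: A3_def)
  have "char_poly A = char_poly A'"
  proof -
    have "A = W * A' * mat_adjoint W" using unitary_conj_cancel(1)[OF W A] by (simp add: A'_def)
    then show ?thesis using unitary_conj_similar[OF W A'C] char_poly_similar by metis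
  qed
  also have "\<dots> = char_poly E * char_poly A3"
    unfolding block by (rule char_poly_four_block_zeros_col[OF EC _ A3C]) auto
  also have "char_poly E = [: -e, 1 :]"
    by (simp add: E_def char_poly_defs det_def sign_def)
  finally have "char_poly A3 = (\<Prod>e\<leftarrow>es. [:- e, 1:])"
    using cp by (metis mult_cancel_left pCons_eq_0_iff zero_neq_one)
  from Cons.IH[OF A3C herm3 this] obtain U where IH: "length es = m" "\<forall>e\<in>set es. Im e = 0"
    and U: "unitary_mat m U" and A3: "A3 = U * mat_diag m (\<lambda>i. es ! i) * mat_adjoint U" by auto
  define V where "V = four_block_mat (1\<^sub>m 1) (0\<^sub>m 1 m) (0\<^sub>m m 1) U"
  note UC = unitary_mat_carrier[OF U]
  have adjV: "mat_adjoint V = four_block_mat (1\<^sub>m 1) (0\<^sub>m 1 m) (0\<^sub>m m 1) (mat_adjoint U)"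
    unfolding V_def using UC by (subst adjoint_four_block[of _ 1 1 _ m _ m]) (auto intro!: cong_four_block_mat)
  have "unitary_mat n V"
    unfolding unitary_mat_def adjV
    unfolding V_def using UC unitary_mat_left[OF U] n
    by (subst mult_block_diag) auto
  have "V * mat_diag n (\<lambda>i. (e # es) ! i) * mat_adjoint V = A'"
  proof -
    have "V * mat_diag n (\<lambda>i. (e # es) ! i) =
      four_block_mat E (0\<^sub>m 1 m) (0\<^sub>m m 1) (U * mat_diag m (\<lambda>i. es ! i))"
      unfolding V_def n mat_diag_Cons_four_block E_def[symmetric] using UC EC
      by (subst mult_block_diag) auto
    then show ?thesis
      unfolding adjV block A3 using UC EC
      by (simp only:, subst mult_block_diag) (auto simp: mult_carrier_mat[of _ m m _ m])
  qed
  then have "A = W * (V * mat_diag n (\<lambda>i. (e # es) ! i) * mat_adjoint V) * mat_adjoint W"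
    using unitary_conj_cancel(1)[OF W A] by (simp add: A'_def)
  also have "\<dots> = (W * V) * mat_diag n (\<lambda>i. (e # es) ! i) * mat_adjoint (W * V)"
    using WC unitary_mat_carrier[OF \<open>unitary_mat n V\<close>]
    by (simp add: adjoint_mult[of _ n n _ n] mult_carrier_mat[of _ n n _ n] assoc_mult_mat[of _ n n _ n _ n])
  finally show ?case
    using unitary_mat_mult[OF W \<open>unitary_mat n V\<close>] IH e_real n by auto
qed

section \<open>Products over pairings of two lists\<close>

text \<open>Permutations are encoded as rearrangements of the second list: direct sums then
  correspond to concatenation, and independence of the chosen listings becomes invariance under
  \<open>mset\<close>. Since \<open>map2\<close> truncates, the intended reading presumes lists of
  equal length.\<close>

definition pairing_prods :: "complex list \<Rightarrow> complex list \<Rightarrow> complex set" where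
  "pairing_prods as bs = {prod_list (map2 (+) as ys) | ys. mset ys = mset bs}"

lemma finite_pairing_prods: "finite (pairing_prods as bs)"
proof -
  have "{ys. mset ys = mset bs} \<subseteq> {ys. set ys \<subseteq> set bs \<and> length ys = length bs}"
    by (auto dest: mset_eq_setD mset_eq_length)
  then have "finite {ys. mset ys = mset bs}"
    by (rule finite_subset) (auto intro: finite_lists_length_eq)
  moreover have "pairing_prods as bs = (\<lambda>ys. prod_list (map2 (+) as ys)) ` {ys. mset ys = mset bs}"
    by (auto simp: pairing_prods_def)
  ultimately show ?thesis by simp
qed

lemma pairing_prods_nonempty: "pairing_prods as bs \<noteq> {}"
  by (auto simp: pairing_prods_def)

text \<open>Each entry of \<open>as\<close> keeps its partner in \<open>ys\<close> while
  \<open>as\<close> is rearranged into \<open>as'\<close>; the multiset of pairs, hence that of the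
  sums, is unchanged.\<close>

lemma pairing_prods_mono_mset:
  assumes as: "mset as = mset as'" and bs: "mset bs = mset bs'" and len: "length as = length bs"
  shows "pairing_prods as bs \<subseteq> pairing_prods as' bs'"
proof
  fix z assume "z \<in> pairing_prods as bs"
  then obtain ys where ys: "mset ys = mset bs" and z: "z = prod_list (map2 (+) as ys)"
    by (auto simp: pairing_prods_def)
  have "length as = length ys" using len ys by (metis mset_eq_length)
  from ex_mset_zip_left[OF this as[symmetric]] obtain ys'
    where ys': "length ys' = length as'" "mset (zip as' ys') = mset (zip as ys)" by auto
  have "mset ys' = mset (map snd (zip as' ys'))" using ys'(1) by simp
  also have "\<dots> = image_mset snd (mset (zip as ys))" unfolding mset_map ys'(2) ..
  also have "\<dots> = mset (map snd (zip as ys))" by (simp only: mset_map)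
  also have "\<dots> = mset bs'" using ys bs \<open>length as = length ys\<close> by simp
  finally have "mset ys' = mset bs'" .
  moreover have "mset (map2 (+) as' ys') = mset (map2 (+) as ys)"
    by (simp only: mset_map ys'(2))
  then have "prod_list (map2 (+) as' ys') = z"
    unfolding z by (simp only: prod_mset_prod_list[symmetric])
  ultimately show "z \<in> pairing_prods as' bs'"
    unfolding pairing_prods_def by blast
qed

lemma pairing_prods_mset:
  assumes "mset as = mset as'" "mset bs = mset bs'" "length as = length bs"
  shows "pairing_prods as bs = pairing_prods as' bs'"
proof
  have "length as' = length bs'" using assms by (metis mset_eq_length)
  then show "pairing_prods as' bs' \<subseteq> pairing_prods as bs"
    using pairing_prods_mono_mset[of as' as bs' bs] assms by simp
qed (rule pairing_prods_mono_mset[OF assms])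

lemma pairing_prods_append:
  assumes "p \<in> pairing_prods as bs" "q \<in> pairing_prods as' bs'"
    "length as = length bs" "length as' = length bs'"
  shows "p * q \<in> pairing_prods (as @ as') (bs @ bs')"
proof -
  from assms obtain ys ys' where ys: "mset ys = mset bs" "p = prod_list (map2 (+) as ys)"
    "mset ys' = mset bs'" "q = prod_list (map2 (+) as' ys')"
    by (auto simp: pairing_prods_def)
  then have "p * q = prod_list (map2 (+) (as @ as') (ys @ ys'))"
    using assms by (simp add: mset_eq_length[OF ys(1)])
  moreover have "mset (ys @ ys') = mset (bs @ bs')" using ys by simp
  ultimately show ?thesis unfolding pairing_prods_def by blast
qed

text \<open>The translations by \<open>d\<close> and \<open>- d\<close> cancel in each sum, and each
  sum contributes one factor \<open>k\<close>. Taking \<open>k = \<i>\<close> passes from Hermitian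
  to skew-Hermitian spectra, and \<open>d\<close> distributes a common shift over the two
  lists.\<close>

lemma pairing_prods_smult:
  assumes "p \<in> pairing_prods as bs" "length as = length bs"
  shows "k ^ length as * p \<in> pairing_prods (map (\<lambda>a. k * a + d) as) (map (\<lambda>b. k * b - d) bs)"
proof -
  from assms obtain ys where ys: "mset ys = mset bs" "p = prod_list (map2 (+) as ys)"
    by (auto simp: pairing_prods_def)
  have "length as = length ys" using assms mset_eq_length[OF ys(1)] by simp
  then have "k ^ length as * p = prod_list (map2 (+) (map (\<lambda>a. k * a + d) as) (map (\<lambda>b. k * b - d) ys))"
    unfolding ys(2) by (induction as ys rule: list_induct2) (auto simp: algebra_simps)
  moreover have "mset (map (\<lambda>b. k * b - d) ys) = mset (map (\<lambda>b. k * b - d) bs)"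
    using ys(1) by simp
  ultimately show ?thesis unfolding pairing_prods_def by blast
qed

lemma pairing_prods_permutes:
  "pairing_prods (map a [1..<Suc m]) (map b [1..<Suc m])
    \<subseteq> {\<Prod>i\<in>{1..m}. a i + b (\<sigma> i) | \<sigma>. \<sigma> permutes {1..m}}"
proof
  fix z assume "z \<in> pairing_prods (map a [1..<Suc m]) (map b [1..<Suc m])"
  then obtain ys where ys: "mset ys = mset (map b [1..<Suc m])"
    and z: "z = prod_list (map2 (+) (map a [1..<Suc m]) ys)"
    by (auto simp: pairing_prods_def simp del: upt_Suc)
  obtain p where p: "p permutes {..<m}" and ysp: "permute_list p (map b [1..<Suc m]) = ys"
    using mset_eq_permutation[OF ys] by (auto simp del: upt_Suc)
  \<comment> \<open>\<open>p\<close> acts on list positions below \<open>m\<close>, whereas the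
    product is indexed by \<open>{1..m}\<close>: \<open>\<sigma>\<close> is \<open>p\<close> moved
    up by one, with 0 kept as a fixed point.\<close>
  define \<sigma> where "\<sigma> i = (if i = 0 then 0 else Suc (p (i - 1)))" for i
  have "bij_betw (\<lambda>i. Suc (p (i - 1))) {1..m} {1..m}"
  proof -
    have "bij_betw (\<lambda>i. i - 1) {1..m} {..<m}"
      by (rule bij_betw_byWitness[of _ Suc]) auto
    from bij_betw_trans[OF this permutes_imp_bij[OF p]]
    have "bij_betw (p \<circ> (\<lambda>i. i - 1)) {1..m} {..<m}" .
    moreover have "bij_betw Suc {..<m} {1..m}"
      by (rule bij_betw_byWitness[of _ "\<lambda>i. i - 1"]) auto
    ultimately have "bij_betw (Suc \<circ> (p \<circ> (\<lambda>i. i - 1))) {1..m} {1..m}"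
      by (rule bij_betw_trans)
    then show ?thesis by (simp only: o_def)
  qed
  then have "bij_betw \<sigma> {1..m} {1..m}"
    by (rule bij_betw_cong[THEN iffD1, rotated]) (auto simp: \<sigma>_def)
  then have \<sigma>: "\<sigma> permutes {1..m}"
    by (rule bij_imp_permutes) (use permutes_not_in[OF p] in \<open>force simp: \<sigma>_def\<close>)
  have "length ys = m" using ysp by (auto simp del: upt_Suc)
  have ysn: "ys ! i = b (Suc (p i))" if "i < m" for i
  proof -
    have "p i < m" using permutes_in_image[OF p, of i] that by simp
    then show ?thesis
      unfolding ysp[symmetric] using p that by (subst permute_list_nth) (auto simp del: upt_Suc)
  qed
  have "z = (\<Prod>i<m. a (Suc i) + b (\<sigma> (Suc i)))"
    unfolding z prod.list_conv_set_nth using ysn \<open>length ys = m\<close>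
    by (auto simp: lessThan_atLeast0 \<sigma>_def simp del: upt_Suc intro!: prod.cong)
  also have "\<dots> = (\<Prod>i\<in>{1..m}. a i + b (\<sigma> i))"
    by (simp add: prod.atLeast1_atMost_eq)
  finally show "z \<in> {\<Prod>i\<in>{1..m}. a i + b (\<sigma> i) | \<sigma>. \<sigma> permutes {1..m}}"
    using \<sigma> by blast
qed

text \<open>Membership in the convex hull, expressed through support functions; this form is stable under products.\<close>

definition dominated :: "complex \<Rightarrow> complex set \<Rightarrow> bool" where
  "dominated z Q \<longleftrightarrow> (\<forall>e. \<exists>q\<in>Q. Re (e * z) \<le> Re (e * q))"

lemma dominated_mem: "z \<in> Q \<Longrightarrow> dominated z Q"
  by (auto simp: dominated_def)

lemma dominated_mono: "dominated z Q \<Longrightarrow> Q \<subseteq> Q' \<Longrightarrow> dominated z Q'"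
  unfolding dominated_def by blast

lemma dominated_image_mult:
  assumes "dominated z Q" "\<And>q. q \<in> Q \<Longrightarrow> k * q \<in> Q'"
  shows "dominated (k * z) Q'"
  unfolding dominated_def
proof
  fix e
  from assms(1) obtain q where "q \<in> Q" "Re (e * k * z) \<le> Re (e * k * q)"
    unfolding dominated_def by blast
  then show "\<exists>q\<in>Q'. Re (e * (k * z)) \<le> Re (e * q)"
    using assms(2) by (auto simp: mult.assoc intro!: bexI[of _ "k * q"])
qed

text \<open>The factors are replaced one after the other: \<open>z\<close> is bounded in direction
  \<open>e * w\<close>, then \<open>w\<close> in direction \<open>e * q\<close> with the
  \<open>q\<close> just found.\<close>

lemma dominated_mult:
  assumes "dominated z Q" "dominated w R" "\<And>q r. q \<in> Q \<Longrightarrow> r \<in> R \<Longrightarrow> q * r \<in> T"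
  shows "dominated (z * w) T"
  unfolding dominated_def
proof
  fix e
  from assms(1) obtain q where q: "q \<in> Q" "Re ((e * w) * z) \<le> Re ((e * w) * q)"
    unfolding dominated_def by blast
  from assms(2) obtain r where r: "r \<in> R" "Re ((e * q) * w) \<le> Re ((e * q) * r)"
    unfolding dominated_def by blast
  have "Re (e * (z * w)) = Re ((e * w) * z)" by (simp add: ac_simps)
  also note q(2)
  also have "Re ((e * w) * q) = Re ((e * q) * w)" by (simp only: ac_simps)
  also note r(2)
  also have "Re ((e * q) * r) = Re (e * (q * r))" by (simp only: ac_simps)
  finally show "\<exists>q\<in>T. Re (e * (z * w)) \<le> Re (e * q)" using assms(3) q(1) r(1) by blast
qed

lemma dominated_imp_convex_hull:
  assumes "finite Q" "dominated z Q"
  shows "z \<in> convex hull Q"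
proof (rule ccontr)
  assume "z \<notin> convex hull Q"
  moreover have "closed (convex hull Q)"
    using assms(1) by (simp add: finite_imp_compact compact_convex_hull compact_imp_closed)
  ultimately obtain a b where ab: "inner a z < b" "\<forall>x\<in>convex hull Q. b < inner a x"
    using separating_hyperplane_closed_point[of "convex hull Q" z] by auto
  \<comment> \<open>\<open>Re (cnj a * x)\<close> is the inner product of \<open>a\<close> and
    \<open>x\<close>; the sign is reversed because the hyperplane has \<open>z\<close> on its lower
    side.\<close>
  obtain q where q: "q \<in> Q" "Re (- cnj a * z) \<le> Re (- cnj a * q)"
    using assms(2) unfolding dominated_def by blast
  have "inner a q > b" using ab(2) hull_inc[OF q(1)] by blast
  then show False using ab(1) q(2) by (simp add: inner_complex_def)
qed

lemma mset_eq_of_linear_factors: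
  fixes as bs :: "complex list"
  assumes "(\<Prod>a\<leftarrow>as. [:- a, 1:]) = (\<Prod>b\<leftarrow>bs. [:- b, 1:])"
  shows "mset as = mset bs"
proof -
  have "proots (\<Prod>a\<leftarrow>cs. [:- a, 1:]) = mset cs" for cs :: "complex list"
  proof (induction cs)
    case (Cons c cs)
    have "monic (\<Prod>a\<leftarrow>cs. [:- a, 1:])" by (rule monic_prod_list) auto
    then have "(\<Prod>a\<leftarrow>cs. [:- a, 1:]) \<noteq> 0" by auto
    then show ?case using Cons by (simp add: proots_mult del: mult_pCons_left)
  qed auto
  then show ?thesis using assms by metis
qed

section \<open>Second variation of the determinant on a unitary orbit\<close>

text \<open>This is the Leibniz expansion of a diagonal matrix whose row \<open>k\<close> is
  replaced by \<open>x\<close>: a nonzero term fixes every index other than \<open>k\<close>, hence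
  \<open>k\<close> as well.\<close>

lemma sum_permutes_one_free_row:
  fixes x :: "nat \<Rightarrow> complex"
  assumes k: "k < n"
  shows "(\<Sum>\<pi> | \<pi> permutes {0..<n}. signof \<pi> *
      (x (\<pi> k) * (\<Prod>i\<in>{0..<n} - {k}. if i = \<pi> i then d i else 0))) =
    x k * (\<Prod>i\<in>{0..<n} - {k}. d i)" (is "(\<Sum>\<pi> | \<pi> permutes ?I. ?f \<pi>) = _")
proof -
  have "(\<Sum>\<pi> | \<pi> permutes ?I. ?f \<pi>) = (\<Sum>\<pi>\<in>{id}. ?f \<pi>)"
  proof (rule sum.mono_neutral_right)
    show "\<forall>\<pi>\<in>{\<pi>. \<pi> permutes ?I} - {id}. ?f \<pi> = 0"
    proof
      fix \<pi> assume \<pi>: "\<pi> \<in> {\<pi>. \<pi> permutes ?I} - {id}"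
      have "\<exists>i\<in>?I - {k}. \<pi> i \<noteq> i"
      proof (rule ccontr)
        assume "\<not> ?thesis"
        then have "\<pi> permutes {k}" using \<pi> by - (rule permutes_superset[of \<pi> ?I], blast+)
        then show False using \<pi> by (simp add: permutes_sing)
      qed
      then obtain i where "i \<in> ?I - {k}" "i \<noteq> \<pi> i" by metis
      then have "(\<Prod>i\<in>?I - {k}. if i = \<pi> i then d i else 0) = 0"
        by (intro prod_zero bexI[of _ i]) simp_all
      then show "?f \<pi> = 0" by (simp only: mult_zero_right)
    qed
  qed (simp_all add: permutes_id finite_permutations)
  then show ?thesis by simp
qed

text \<open>With two free rows only the identity and the transposition of \<open>k\<close> and
  \<open>l\<close> survive, which leaves a two by two minor times the remaining diagonal
  entries.\<close>

lemma sum_permutes_two_free_rows: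
  fixes x y :: "nat \<Rightarrow> complex"
  assumes k: "k < n" and l: "l < n" and kl: "k \<noteq> l"
  shows "(\<Sum>\<pi> | \<pi> permutes {0..<n}. signof \<pi> *
      (x (\<pi> k) * y (\<pi> l) * (\<Prod>i\<in>{0..<n} - {k} - {l}. if i = \<pi> i then d i else 0))) =
    (x k * y l - x l * y k) * (\<Prod>i\<in>{0..<n} - {k} - {l}. d i)" (is "(\<Sum>\<pi> | \<pi> permutes ?I. ?f \<pi>) = _")
proof -
  let ?t = "Transposition.transpose k l"
  have t: "?t \<noteq> id" using kl by (auto dest: fun_cong[of _ _ k])
  have "(\<Sum>\<pi> | \<pi> permutes ?I. ?f \<pi>) = (\<Sum>\<pi>\<in>{id, ?t}. ?f \<pi>)"
  proof (rule sum.mono_neutral_right)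
    show "\<forall>\<pi>\<in>{\<pi>. \<pi> permutes ?I} - {id, ?t}. ?f \<pi> = 0"
    proof
      fix \<pi> assume \<pi>: "\<pi> \<in> {\<pi>. \<pi> permutes ?I} - {id, ?t}"
      have "\<exists>i\<in>?I - {k} - {l}. \<pi> i \<noteq> i"
      proof (rule ccontr)
        assume "\<not> ?thesis"
        then have "\<pi> permutes {k, l}" using \<pi> by - (rule permutes_superset[of \<pi> ?I], blast+)
        then show False using \<pi> by (simp add: permutes_doubleton_iff)
      qed
      then obtain i where "i \<in> ?I - {k} - {l}" "i \<noteq> \<pi> i" by metis
      then have "(\<Prod>i\<in>?I - {k} - {l}. if i = \<pi> i then d i else 0) = 0"
        by (intro prod_zero bexI[of _ i]) simp_all
      then show "?f \<pi> = 0" by (simp only: mult_zero_right)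
    qed
  qed (simp_all add: permutes_id finite_permutations permutes_swap_id k l)
  also have "\<dots> = ?f id + ?f ?t" using t by simp
  also have "?f id = x k * y l * (\<Prod>i\<in>?I - {k} - {l}. d i)" by simp
  also have "?f ?t = - (x l * y k * (\<Prod>i\<in>?I - {k} - {l}. d i))"
  proof -
    have "(\<Prod>i\<in>?I - {k} - {l}. if i = ?t i then d i else 0) = (\<Prod>i\<in>?I - {k} - {l}. d i)"
      by (rule prod.cong) (auto simp: Transposition.transpose_def)
    then show ?thesis using kl by (simp add: sign_swap_id)
  qed
  finally show ?thesis by (simp add: algebra_simps)
qed

text \<open>The Leibniz sum is differentiated twice, row by row. At 0 all undifferentiated rows are
  those of a diagonal matrix, so the first derivative involves one free row and the second one
  either one or two. The double sum runs over ordered pairs, since each pair of rows is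
  differentiated in both orders.\<close>

lemma det_second_order:
  fixes m m' m'' :: "nat \<Rightarrow> nat \<Rightarrow> complex \<Rightarrow> complex"
  assumes m: "\<And>i j z. (m i j has_field_derivative m' i j z) (at z)"
    and m': "\<And>i j z. (m' i j has_field_derivative m'' i j z) (at z)"
    and m0: "\<And>i j. i < n \<Longrightarrow> j < n \<Longrightarrow> m i j 0 = (if i = j then d i else 0)"
    and d: "\<And>i. i < n \<Longrightarrow> d i \<noteq> 0"
  obtains F' F'' where
    "\<And>z. ((\<lambda>z. det (mat n n (\<lambda>(i,j). m i j z))) has_field_derivative F' z) (at z)"
    "\<And>z. (F' has_field_derivative F'' z) (at z)"
    "F' 0 = (\<Prod>i<n. d i) * (\<Sum>k<n. m' k k 0 / d k)"
    "F'' 0 = (\<Prod>i<n. d i) * ((\<Sum>k<n. m'' k k 0 / d k) +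
       (\<Sum>k<n. \<Sum>l\<in>{..<n} - {k}. (m' k k 0 * m' l l 0 - m' k l 0 * m' l k 0) / (d k * d l)))"
proof -
  let ?I = "{0..<n}" and ?P = "{\<pi>. \<pi> permutes {0..<n}}"
  define F' where "F' z = (\<Sum>\<pi>\<in>?P. signof \<pi> * (\<Sum>k\<in>?I. m' k (\<pi> k) z * (\<Prod>i\<in>?I - {k}. m i (\<pi> i) z)))" for z
  define F'' where "F'' z = (\<Sum>\<pi>\<in>?P. signof \<pi> * (\<Sum>k\<in>?I. m'' k (\<pi> k) z * (\<Prod>i\<in>?I - {k}. m i (\<pi> i) z)
     + m' k (\<pi> k) z * (\<Sum>l\<in>?I - {k}. m' l (\<pi> l) z * (\<Prod>i\<in>?I - {k} - {l}. m i (\<pi> i) z))))" for z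
  have pl: "\<pi> i < n" if "\<pi> permutes ?I" "i < n" for \<pi> i
    using permutes_in_image[OF that(1), of i] that(2) by simp
  have det: "det (mat n n (\<lambda>(i,j). m i j z)) = (\<Sum>\<pi>\<in>?P. signof \<pi> * (\<Prod>i\<in>?I. m i (\<pi> i) z))" for z
    unfolding det_def by (auto intro!: sum.cong prod.cong simp: pl)
  have 1: "((\<lambda>z. det (mat n n (\<lambda>(i,j). m i j z))) has_field_derivative F' z) (at z)" for z
    unfolding det F'_def
    by (intro DERIV_sum DERIV_cmult has_field_derivative_prod m)
  have 2: "(F' has_field_derivative F'' z) (at z)" for z
    unfolding F'_def[abs_def] F''_def
  proof (intro DERIV_sum DERIV_cmult)
    fix \<pi> k
    show "((\<lambda>z. m' k (\<pi> k) z * (\<Prod>i\<in>?I - {k}. m i (\<pi> i) z)) has_field_derivative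
        m'' k (\<pi> k) z * (\<Prod>i\<in>?I - {k}. m i (\<pi> i) z)
     + m' k (\<pi> k) z * (\<Sum>l\<in>?I - {k}. m' l (\<pi> l) z * (\<Prod>i\<in>?I - {k} - {l}. m i (\<pi> i) z))) (at z)"
      by (rule DERIV_cong[OF DERIV_mult[OF m' has_field_derivative_prod[OF m]]]) (simp add: ac_simps)
  qed
  have diag: "(\<Prod>i\<in>J. m i (\<pi> i) 0) = (\<Prod>i\<in>J. if i = \<pi> i then d i else 0)"
    if "\<pi> \<in> ?P" "J \<subseteq> ?I" for \<pi> J
    using that by (intro prod.cong) (auto simp: m0 pl subset_iff)
  have prod1: "(\<Prod>i\<in>?I - {k}. d i) = (\<Prod>i<n. d i) / d k" if "k < n" for k
    using that d by (simp add: prod_diff1 lessThan_atLeast0)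
  have prod2: "(\<Prod>i\<in>?I - {k} - {l}. d i) = (\<Prod>i<n. d i) / (d k * d l)" if "k < n" "l < n" "l \<noteq> k" for k l
    using that d by (simp add: prod_diff1 lessThan_atLeast0)
  have S1: "(\<Sum>\<pi>\<in>?P. signof \<pi> * (x k (\<pi> k) * (\<Prod>i\<in>?I - {k}. m i (\<pi> i) 0))) = (\<Prod>i<n. d i) * (x k k / d k)"
    if k: "k < n" for x :: "nat \<Rightarrow> nat \<Rightarrow> complex" and k
  proof -
    have "(\<Sum>\<pi>\<in>?P. signof \<pi> * (x k (\<pi> k) * (\<Prod>i\<in>?I - {k}. m i (\<pi> i) 0))) =
      (\<Sum>\<pi>\<in>?P. signof \<pi> * (x k (\<pi> k) * (\<Prod>i\<in>?I - {k}. if i = \<pi> i then d i else 0)))"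
      by (intro sum.cong refl) (simp add: diag)
    then show ?thesis using sum_permutes_one_free_row[OF k, of "x k" d] prod1[OF k] by simp
  qed
  have S2: "(\<Sum>\<pi>\<in>?P. signof \<pi> * (m' k (\<pi> k) 0 * (m' l (\<pi> l) 0 * (\<Prod>i\<in>?I - {k} - {l}. m i (\<pi> i) 0)))) =
    (\<Prod>i<n. d i) * ((m' k k 0 * m' l l 0 - m' k l 0 * m' l k 0) / (d k * d l))"
    if k: "k < n" and l: "l < n" and kl: "l \<noteq> k" for k l
  proof -
    have "(\<Sum>\<pi>\<in>?P. signof \<pi> * (m' k (\<pi> k) 0 * (m' l (\<pi> l) 0 * (\<Prod>i\<in>?I - {k} - {l}. m i (\<pi> i) 0)))) =
      (\<Sum>\<pi>\<in>?P. signof \<pi> * (m' k (\<pi> k) 0 * m' l (\<pi> l) 0 * (\<Prod>i\<in>?I - {k} - {l}. if i = \<pi> i then d i else 0)))"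
      by (intro sum.cong refl) (subst diag, simp, blast, simp only: mult.assoc)
    then show ?thesis
      using sum_permutes_two_free_rows[OF k l kl[symmetric], of "\<lambda>j. m' k j 0" "\<lambda>j. m' l j 0" d] prod2[OF k l kl]
      by simp
  qed
  have 3: "F' 0 = (\<Prod>i<n. d i) * (\<Sum>k<n. m' k k 0 / d k)"
  proof -
    have "F' 0 = (\<Sum>k\<in>?I. \<Sum>\<pi>\<in>?P. signof \<pi> * (m' k (\<pi> k) 0 * (\<Prod>i\<in>?I - {k}. m i (\<pi> i) 0)))"
      unfolding F'_def sum_distrib_left by (rule sum.swap)
    also have "\<dots> = (\<Sum>k\<in>?I. (\<Prod>i<n. d i) * (m' k k 0 / d k))"
      by (intro sum.cong refl) (use S1[of _ "\<lambda>k j. m' k j 0"] in auto)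
    finally show ?thesis by (simp add: sum_distrib_left lessThan_atLeast0)
  qed
  have 4: "F'' 0 = (\<Prod>i<n. d i) * ((\<Sum>k<n. m'' k k 0 / d k) +
       (\<Sum>k<n. \<Sum>l\<in>{..<n} - {k}. (m' k k 0 * m' l l 0 - m' k l 0 * m' l k 0) / (d k * d l)))"
  proof -
    have "F'' 0 = (\<Sum>k\<in>?I. \<Sum>\<pi>\<in>?P. signof \<pi> * (m'' k (\<pi> k) 0 * (\<Prod>i\<in>?I - {k}. m i (\<pi> i) 0)
     + m' k (\<pi> k) 0 * (\<Sum>l\<in>?I - {k}. m' l (\<pi> l) 0 * (\<Prod>i\<in>?I - {k} - {l}. m i (\<pi> i) 0))))"
      unfolding F''_def by (subst sum_distrib_left, rule sum.swap)
    also have "\<dots> = (\<Sum>k\<in>?I. (\<Sum>\<pi>\<in>?P. signof \<pi> * (m'' k (\<pi> k) 0 * (\<Prod>i\<in>?I - {k}. m i (\<pi> i) 0))) +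
       (\<Sum>l\<in>?I - {k}. \<Sum>\<pi>\<in>?P. signof \<pi> * (m' k (\<pi> k) 0 * (m' l (\<pi> l) 0 * (\<Prod>i\<in>?I - {k} - {l}. m i (\<pi> i) 0)))))"
      by (simp only: distrib_left sum.distrib sum_distrib_left)
         (rule arg_cong2[where f = "(+)"], rule refl, rule sum.cong, rule refl, rule sum.swap)
    also have "\<dots> = (\<Sum>k\<in>?I. (\<Prod>i<n. d i) * (m'' k k 0 / d k) +
       (\<Sum>l\<in>?I - {k}. (\<Prod>i<n. d i) * ((m' k k 0 * m' l l 0 - m' k l 0 * m' l k 0) / (d k * d l))))"
      by (intro sum.cong arg_cong2[where f = "(+)"] refl)
        (use S1[of _ "\<lambda>k j. m'' k j 0"] S2 in auto)
    finally show ?thesis by (simp add: sum_distrib_left sum.distrib lessThan_atLeast0 distrib_left)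
  qed
  show ?thesis using that[OF 1 2 3 4] .
qed

text \<open>Maximality is assumed along the real axis only, where the curves in use stay in the
  unitary orbit. If the second derivative were positive, the first one would be positive just to the
  right of 0, and the mean value theorem would produce a larger value.\<close>

lemma second_derivative_test:
  fixes F F' F'' :: "complex \<Rightarrow> complex"
  assumes F: "\<And>z. (F has_field_derivative F' z) (at z)" "\<And>z. (F' has_field_derivative F'' z) (at z)"
    and max: "\<And>t::real. Re (e * F (of_real t)) \<le> Re (e * F 0)"
  shows "Re (e * F' 0) = 0" "Re (e * F'' 0) \<le> 0"
proof -
  have real: "((\<lambda>t. Re (e * G (of_real t))) has_real_derivative Re (e * G' (of_real t))) (at t)"
    if "\<And>z. (G has_field_derivative G' z) (at z)" for G G' :: "complex \<Rightarrow> complex" and t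
  proof -
    have "((\<lambda>z. e * G z) has_field_derivative e * G' (of_real t)) (at (of_real t))"
      by (intro DERIV_cmult that)
    from has_vector_derivative_real_field[OF this]
    have "((\<lambda>t. e * G (of_real t)) has_vector_derivative e * G' (of_real t)) (at t)" by (simp add: o_def)
    from bounded_linear.has_vector_derivative[OF bounded_linear_Re this]
    show ?thesis by (simp add: has_real_derivative_iff_has_vector_derivative)
  qed
  note r1 = real[OF F(1)] and r2 = real[OF F(2)]
  show 0: "Re (e * F' 0) = 0"
    using DERIV_local_max[OF r1[of 0], of 1] max by simp
  show "Re (e * F'' 0) \<le> 0"
  proof (rule ccontr)
    assume "\<not> ?thesis"
    then have "Re (e * F'' (of_real 0)) > 0" by simp
    from DERIV_pos_inc_right[OF r2 this] obtain s where s: "s > 0"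
      "\<And>h. 0 < h \<Longrightarrow> h < s \<Longrightarrow> Re (e * F' (of_real h)) > 0" using 0 by auto
    have "\<exists>h>0. h < s/2 \<and> Re (e * F (of_real (s/2))) - Re (e * F (of_real 0)) = (s/2 - 0) * Re (e * F' (of_real h))"
      using MVT2[of 0 "s/2" "\<lambda>t. Re (e * F (of_real t))" "\<lambda>t. Re (e * F' (of_real t))"] r1 s(1) by auto
    then obtain h where h: "h > 0" "h < s/2"
      "Re (e * F (of_real (s/2))) - Re (e * F (of_real 0)) = s/2 * Re (e * F' (of_real h))" by auto
    have "Re (e * F' (of_real h)) > 0" using s h by auto
    then have "s/2 * Re (e * F' (of_real h)) > 0" using s(1) by simp
    then show False using h(3) max[of "s/2"] by simp
  qed
qed

section \<open>Curves in the unitary orbit\<close>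

lemma triple_product_index:
  fixes A M :: "complex mat"
  assumes "A \<in> carrier_mat n n" "M \<in> carrier_mat n n" "i < n" "j < n"
  shows "(A * M * mat_adjoint A) $$ (i,j) = (\<Sum>a<n. \<Sum>k<n. A $$ (i,a) * M $$ (a,k) * cnj (A $$ (j,k)))"
proof -
  have "(A * M * mat_adjoint A) $$ (i,j) = (\<Sum>k<n. \<Sum>a<n. A $$ (i,a) * M $$ (a,k) * cnj (A $$ (j,k)))"
    using assms by (simp add: scalar_prod_def lessThan_atLeast0 sum_distrib_right)
  then show ?thesis by (subst sum.swap) simp
qed

lemma cnj_exp: "cnj (exp z) = exp (cnj z)"
  by (simp add: complex_eq_iff Re_exp Im_exp)

text \<open>The curve is \<open>exp (\<i> z H) B exp (- \<i> z H)\<close>, written out through an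
  eigenbasis of \<open>H\<close> so that its entries are finite sums of exponentials. Its velocity
  at 0 is \<open>\<i>\<close> times the commutator of \<open>H\<close> and \<open>B\<close>. Its
  second derivative there is minus the double commutator \<open>[H, [H, B]]\<close>, which is
  Hermitian of trace zero; hence the last two properties.\<close>

lemma unitary_orbit_curve:
  fixes H B :: "complex mat"
  assumes H: "H \<in> carrier_mat n n" "mat_adjoint H = H"
    and B: "B \<in> carrier_mat n n" and hermB: "mat_adjoint B = B"
  obtains b b' b'' :: "nat \<Rightarrow> nat \<Rightarrow> complex \<Rightarrow> complex" where
    "\<And>i j z. (b i j has_field_derivative b' i j z) (at z)"
    "\<And>i j z. (b' i j has_field_derivative b'' i j z) (at z)"
    "\<And>t::real. \<exists>V. unitary_mat n V \<and> mat n n (\<lambda>(i,j). b i j (of_real t)) = V * B * mat_adjoint V"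
    "\<And>i j. i < n \<Longrightarrow> j < n \<Longrightarrow> b i j 0 = B $$ (i,j)"
    "\<And>i j. i < n \<Longrightarrow> j < n \<Longrightarrow> b' i j 0 = \<i> * (H * B - B * H) $$ (i,j)"
    "(\<Sum>i<n. b'' i i 0) = 0"
    "\<And>i. i < n \<Longrightarrow> cnj (b'' i i 0) = b'' i i 0"
proof -
  obtain es where es: "char_poly H = (\<Prod>e\<leftarrow>es. [:- e, 1:])"
    using char_poly_factorized[OF H(1)] by auto
  from hermitian_spectral[OF H es] obtain W where W: "unitary_mat n W" and len: "length es = n"
    and real: "\<forall>e\<in>set es. Im e = 0" and HW: "H = W * mat_diag n (\<lambda>i. es ! i) * mat_adjoint W" by auto
  note WC = unitary_mat_carrier[OF W]
  define h where "h i = es ! i" for i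
  have h: "cnj (h i) = h i" if "i < n" for i
    using real len that by (auto simp: h_def complex_eq_iff)
  define C where "C = mat_adjoint W * B * W"
  have C: "C \<in> carrier_mat n n" using WC B by (simp add: C_def mult_carrier_mat[of _ n n _ n])
  have BW: "B = W * C * mat_adjoint W" using unitary_conj_cancel(1)[OF W B] by (simp add: C_def)
  define g where "g i j a k = W $$ (i,a) * C $$ (a,k) * cnj (W $$ (j,k))" for i j a k
  define b where "b i j z = (\<Sum>a<n. \<Sum>k<n. exp (\<i> * (h a - h k) * z) * g i j a k)" for i j z
  define b' where "b' i j z = (\<Sum>a<n. \<Sum>k<n. exp (\<i> * (h a - h k) * z) * (\<i> * (h a - h k)) * g i j a k)" for i j z
  define b'' where "b'' i j z = (\<Sum>a<n. \<Sum>k<n. exp (\<i> * (h a - h k) * z) * (\<i> * (h a - h k)) * (\<i> * (h a - h k)) * g i j a k)" for i j z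
  have 1: "(b i j has_field_derivative b' i j z) (at z)" for i j z
    unfolding b_def[abs_def] b'_def
    by (intro DERIV_sum) (auto intro!: derivative_eq_intros simp: algebra_simps)
  have 2: "(b' i j has_field_derivative b'' i j z) (at z)" for i j z
    unfolding b'_def[abs_def] b''_def
    by (intro DERIV_sum) (auto intro!: derivative_eq_intros simp: algebra_simps)
  have 3: "\<exists>V. unitary_mat n V \<and> mat n n (\<lambda>(i,j). b i j (of_real t)) = V * B * mat_adjoint V" for t :: real
  proof -
    define E where "E = mat_diag n (\<lambda>a. exp (\<i> * h a * of_real t))"
    have EC: "E \<in> carrier_mat n n" by (simp add: E_def)
    have adjE: "mat_adjoint E = mat_diag n (\<lambda>a. exp (- (\<i> * h a * of_real t)))"
      unfolding E_def adjoint_mat_diag by (auto simp: mat_diag_def cnj_exp h intro!: cong_mat)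
    have E: "unitary_mat n E"
      unfolding unitary_mat_def adjE unfolding E_def by (simp flip: exp_add)
    define V where "V = W * E * mat_adjoint W"
    have V: "unitary_mat n V" unfolding V_def
      by (intro unitary_mat_mult W E unitary_mat_adjoint)
    have adjV: "mat_adjoint V = W * mat_adjoint E * mat_adjoint W"
      unfolding V_def by (rule adjoint_conj[OF WC EC])
    have "V * B * mat_adjoint V = (W * E * mat_adjoint W) * (W * C * mat_adjoint W) * (W * mat_adjoint E * mat_adjoint W)"
      by (simp only: adjV BW[symmetric] V_def[symmetric])
    also have "\<dots> = W * (E * C * mat_adjoint E) * mat_adjoint W"
      using WC EC C
      by (simp add: unitary_conj_mult[OF W] mult_carrier_mat[of _ n n _ n])
    also have "\<dots> = mat n n (\<lambda>(i,j). b i j (of_real t))"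
    proof (rule eq_matI)
      fix i j assume "i < dim_row (mat n n (\<lambda>(i,j). b i j (of_real t)))" "j < dim_col (mat n n (\<lambda>(i,j). b i j (of_real t)))"
      then have ij: "i < n" "j < n" by auto
      have "E * C * mat_adjoint E = mat n n (\<lambda>(a,k). exp (\<i> * (h a - h k) * of_real t) * C $$ (a,k))"
        unfolding adjE unfolding E_def using C
        by (subst mat_diag_mult_left[of _ n n], simp, subst mat_diag_mult_right[of _ n n])
           (auto intro!: cong_mat simp: algebra_simps exp_diff exp_minus divide_inverse)
      then show "(W * (E * C * mat_adjoint E) * mat_adjoint W) $$ (i, j) = mat n n (\<lambda>(i,j). b i j (of_real t)) $$ (i,j)"
        using ij by (simp add: triple_product_index[OF WC mat_carrier] b_def g_def ac_simps del: index_mult_mat)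
    qed (use WC in auto)
    finally show ?thesis using V by metis
  qed
  have 4: "b i j 0 = B $$ (i,j)" if "i < n" "j < n" for i j
    unfolding BW using that by (simp add: triple_product_index[OF WC C] b_def g_def del: index_mult_mat)
  have 5: "b' i j 0 = \<i> * (H * B - B * H) $$ (i,j)" if ij: "i < n" "j < n" for i j
  proof -
    let ?D = "mat_diag n (\<lambda>i. es ! i)"
    have HB: "H * B = W * (?D * C) * mat_adjoint W" "B * H = W * (C * ?D) * mat_adjoint W"
      unfolding HW BW using WC C by (simp_all add: unitary_conj_mult[OF W])
    have DC: "?D * C = mat n n (\<lambda>(a,k). h a * C $$ (a,k))" "C * ?D = mat n n (\<lambda>(a,k). C $$ (a,k) * h k)"
      using C by (simp_all add: mat_diag_mult_left[of _ n n] mat_diag_mult_right[of _ n n] h_def)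
    have "(H * B - B * H) $$ (i,j) = (H * B) $$ (i,j) - (B * H) $$ (i,j)"
      using H B ij by simp
    then show ?thesis
      unfolding HB DC using ij
      by (simp add: triple_product_index[OF WC mat_carrier] b'_def g_def sum_distrib_left algebra_simps
          del: index_mult_mat flip: sum_subtractf)
  qed
  have 6: "(\<Sum>i<n. b'' i i 0) = 0"
  proof -
    have WW: "(\<Sum>i<n. W $$ (i,a) * cnj (W $$ (i,k))) = (if a = k then 1 else 0)" if "a < n" "k < n" for a k
    proof -
      have "(\<Sum>i<n. W $$ (i,a) * cnj (W $$ (i,k))) = (mat_adjoint W * W) $$ (k,a)"
        using that WC by (simp add: scalar_prod_def lessThan_atLeast0 mult.commute)
      then show ?thesis using that by (auto simp: unitary_mat_left[OF W])
    qed
    \<comment> \<open>The inner sum over \<open>i\<close> is the inner product of two columns of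
      \<open>W\<close>: it vanishes for \<open>a \<noteq> k\<close>, while for \<open>a = k\<close>
      the factor \<open>h a - h k\<close> does.\<close>
    have "(\<Sum>i<n. b'' i i 0) = (\<Sum>a<n. \<Sum>k<n. \<Sum>i<n. - ((h a - h k) * (h a - h k) * C $$ (a,k)) * (W $$ (i,a) * cnj (W $$ (i,k))))"
      unfolding b''_def g_def
      by (subst sum.swap, rule sum.cong, rule refl, subst sum.swap) (auto intro!: sum.cong simp: algebra_simps)
    also have "\<dots> = 0"
      unfolding sum_distrib_left[symmetric] by (intro sum.neutral) (simp add: WW)
    finally show ?thesis .
  qed
  have hermC: "cnj (C $$ (a,k)) = C $$ (k,a)" if "a < n" "k < n" for a k
  proof -
    have "mat_adjoint C = C"
      using adjoint_conj[of "mat_adjoint W" n B] WC B hermB by (simp add: C_def)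
    then have "C $$ (k,a) = mat_adjoint C $$ (k,a)" by simp
    then show ?thesis using C that by simp
  qed
  have 7: "cnj (b'' i i 0) = b'' i i 0" if "i < n" for i
  proof -
    have "cnj (b'' i i 0) = (\<Sum>a<n. \<Sum>k<n. \<i> * (h k - h a) * (\<i> * (h k - h a)) * g i i k a)"
      unfolding b''_def g_def by (simp add: h hermC algebra_simps)
    also have "\<dots> = b'' i i 0"
      unfolding b''_def by (subst sum.swap) simp
    finally show ?thesis .
  qed
  show ?thesis using that[OF 1 2 3 4 5 6 7] .
qed

text \<open>The Fredholm alternative for finite systems over a field, by Gaussian elimination: the
  unknown \<open>j\<close> is eliminated with a pivot equation \<open>i0\<close> and recovered from
  that equation afterwards.\<close>

lemma linear_system_solvable:
  fixes a :: "'i \<Rightarrow> 'j \<Rightarrow> 'k::field" and y :: "'i \<Rightarrow> 'k"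
  assumes "finite I" "finite J"
    and "\<And>z. (\<And>j. j \<in> J \<Longrightarrow> (\<Sum>i\<in>I. z i * a i j) = 0) \<Longrightarrow> (\<Sum>i\<in>I. z i * y i) = 0"
  shows "\<exists>x. \<forall>i\<in>I. (\<Sum>j\<in>J. a i j * x j) = y i"
  using assms(2,3)
proof (induction J arbitrary: a y rule: finite_induct)
  case empty
  have "y i = 0" if "i \<in> I" for i
    using empty[of "\<lambda>k. if k = i then 1 else 0"] that assms(1) by (simp add: if_distrib[of "\<lambda>u. u * _"] cong: if_cong)
  then show ?case by auto
next
  case (insert j J)
  show ?case
  proof (cases "\<forall>i\<in>I. a i j = 0")
    case True
    have "(\<Sum>i\<in>I. z i * y i) = 0" if "\<And>k. k \<in> J \<Longrightarrow> (\<Sum>i\<in>I. z i * a i k) = 0" for z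
      by (rule insert.prems) (use that True in auto)
    from insert.IH[OF this] obtain x where "\<forall>i\<in>I. (\<Sum>j\<in>J. a i j * x j) = y i" by auto
    then show ?thesis using insert.hyps True by auto
  next
    case False
    then obtain i0 where i0: "i0 \<in> I" "a i0 j \<noteq> 0" by auto
    define r where "r i = a i j / a i0 j" for i
    have r: "a i j = r i * a i0 j" for i using i0 by (simp add: r_def)
    have "\<exists>x. \<forall>i\<in>I. (\<Sum>k\<in>J. (a i k - r i * a i0 k) * x k) = y i - r i * y i0"
    proof (rule insert.IH)
      fix z assume z: "\<And>k. k \<in> J \<Longrightarrow> (\<Sum>i\<in>I. z i * (a i k - r i * a i0 k)) = 0"
      define s where "s = (\<Sum>i\<in>I. z i * r i)"
      \<comment> \<open>A combination \<open>z\<close> of the reduced equations becomes a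
        combination \<open>w\<close> of the original ones once the subtracted multiples of equation
        \<open>i0\<close> are charged to that equation; column \<open>j\<close> is then annihilated
        automatically.\<close>
      define w where "w i = z i - (if i = i0 then s else 0)" for i
      have w: "(\<Sum>i\<in>I. w i * v i) = (\<Sum>i\<in>I. z i * (v i - r i * v i0))" for v
      proof -
        have "(\<Sum>i\<in>I. w i * v i) = (\<Sum>i\<in>I. z i * v i) - (\<Sum>i\<in>I. if i = i0 then s * v i else 0)"
          unfolding w_def sum_subtractf[symmetric] by (intro sum.cong) (auto simp: algebra_simps)
        also have "(\<Sum>i\<in>I. if i = i0 then s * v i else 0) = s * v i0" using assms(1) i0 by simp
        finally show ?thesis
          by (simp add: s_def sum_distrib_right sum_subtractf right_diff_distrib mult.assoc)
      qed
      have "(\<Sum>i\<in>I. w i * y i) = 0"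
      proof (rule insert.prems)
        fix k assume "k \<in> insert j J"
        then show "(\<Sum>i\<in>I. w i * a i k) = 0"
        proof
          assume "k = j"
          then show ?thesis unfolding w by (intro sum.neutral) (simp add: r[symmetric])
        qed (simp only: w z)
      qed
      then show "(\<Sum>i\<in>I. z i * (y i - r i * y i0)) = 0" by (simp only: w)
    qed
    then obtain x where x: "\<And>i. i \<in> I \<Longrightarrow> (\<Sum>k\<in>J. (a i k - r i * a i0 k) * x k) = y i - r i * y i0" by blast
    define q where "q = (\<Sum>k\<in>J. a i0 k * x k)"
    define x' where "x' k = (if k = j then (y i0 - q) / a i0 j else x k)" for k
    have "(\<Sum>k\<in>insert j J. a i k * x' k) = y i" if "i \<in> I" for i
    proof -
      have "(\<Sum>k\<in>insert j J. a i k * x' k) = a i j * ((y i0 - q) / a i0 j) + (\<Sum>k\<in>J. a i k * x k)"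
        using insert.hyps by (auto simp: x'_def intro!: sum.cong)
      also have "a i j * ((y i0 - q) / a i0 j) = r i * y i0 - r i * q" using i0 by (simp add: r_def field_simps)
      also have "(\<Sum>k\<in>J. a i k * x k) = y i - r i * y i0 + r i * q"
        using x[OF that] by (simp add: q_def left_diff_distrib sum_subtractf sum_distrib_left algebra_simps)
      finally show ?thesis by simp
    qed
    then show ?thesis by blast
  qed
qed

section \<open>Maximizers on the orbit\<close>

text \<open>For Hermitian \<open>A\<close> and \<open>B\<close> this is Schur's form of
  irreducibility: there is no proper nontrivial common invariant subspace. The commutant form
  matches the dual of the commutator equations.\<close>

definition irreducible_pair :: "nat \<Rightarrow> complex mat \<Rightarrow> complex mat \<Rightarrow> bool" where
  "irreducible_pair n A B \<longleftrightarrow>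
    (\<forall>Z\<in>carrier_mat n n. Z * A = A * Z \<longrightarrow> Z * B = B * Z \<longrightarrow> (\<exists>\<zeta>. Z = \<zeta> \<cdot>\<^sub>m 1\<^sub>m n))"

lemma irreducible_pairD:
  assumes "irreducible_pair n A B" "Z \<in> carrier_mat n n" "Z * A = A * Z" "Z * B = B * Z"
  obtains \<zeta> where "Z = \<zeta> \<cdot>\<^sub>m 1\<^sub>m n"
  using assms unfolding irreducible_pair_def by blast

lemma sum_Times_eq_nested: "(\<Sum>p\<in>A \<times> B. f p) = (\<Sum>i\<in>A. \<Sum>j\<in>B. f (i,j))"
  by (simp add: sum.cartesian_product)

text \<open>The transposed system says that the coefficient matrix commutes with both matrices of the pair, so by
  irreducibility \<open>trace = 0\<close> is the only solvability condition.\<close>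

lemma block_commutator:
  fixes lam :: "nat \<Rightarrow> real" and \<delta> :: "nat \<Rightarrow> complex"
  assumes B: "B \<in> carrier_mat n n"
    and irr: "irreducible_pair n (mat_diag n (\<lambda>i. complex_of_real (lam i))) B"
    and \<delta>: "(\<Sum>i<n. \<delta> i) = 0"
  obtains K where "K \<in> carrier_mat n n"
    "\<And>i j. i < n \<Longrightarrow> j < n \<Longrightarrow> lam i = lam j \<Longrightarrow> (K * B - B * K) $$ (i,j) = (if i = j then \<delta> i else 0)"
proof -
  let ?I = "{..<n} \<times> {..<n}"
  define E where "E i j \<longleftrightarrow> lam i = lam j" for i j
  \<comment> \<open>The unknowns are the entries of \<open>K\<close>, the equations are the entries
    of \<open>K B - B K\<close> inside the blocks. Outside the blocks both sides are 0, so that all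
    index pairs can be kept.\<close>
  define a where "a = (\<lambda>(i,j) (r,s). if E i j then
    (if r = i then B $$ (s,j) else 0) - (if s = j then B $$ (i,r) else 0) else 0)"
  define y where "y = (\<lambda>(i,j). if i = j then \<delta> i else 0)"
  have "\<exists>x. \<forall>p\<in>?I. (\<Sum>q\<in>?I. a p q * x q) = y p"
  proof (rule linear_system_solvable)
    fix z assume z: "\<And>q. q \<in> ?I \<Longrightarrow> (\<Sum>p\<in>?I. z p * a p q) = 0"
    \<comment> \<open>The transposition turns the pairing with \<open>z\<close> into a trace:
      \<open>Z (K B - B K)\<close> has the same trace as \<open>K (B Z - Z B)\<close>, so a
      functional that annihilates every \<open>K\<close> commutes with \<open>B\<close>. The zeros
      outside the blocks make \<open>Z\<close> commute with the diagonal matrix.\<close>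
    define Z where "Z = mat n n (\<lambda>(j,i). if E i j then z (i,j) else 0)"
    have ZC: "Z \<in> carrier_mat n n" by (simp add: Z_def)
    have ZB: "Z * B = B * Z"
    proof (rule eq_matI)
      fix s r assume "s < dim_row (B * Z)" "r < dim_col (B * Z)"
      then have sr: "s < n" "r < n" using B by (auto simp: Z_def)
      have "0 = (\<Sum>i<n. \<Sum>j<n. z (i,j) * a (i,j) (r,s))"
        using z[of "(r,s)"] sr by (simp add: sum_Times_eq_nested)
      also have "\<dots> = (\<Sum>i<n. \<Sum>j<n. (if i = r then Z $$ (j,r) * B $$ (s,j) else 0)
          - (if j = s then Z $$ (s,i) * B $$ (i,r) else 0))"
        using sr by (intro sum.cong refl) (simp add: a_def Z_def right_diff_distrib)
      also have "\<dots> = (\<Sum>i<n. if i = r then (\<Sum>j<n. Z $$ (j,r) * B $$ (s,j)) else 0) - (\<Sum>i<n. Z $$ (s,i) * B $$ (i,r))"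
        unfolding sum_subtractf
        by (intro arg_cong2[where f = "(-)"] sum.cong refl) (use sr in \<open>auto\<close>)
      also have "\<dots> = (\<Sum>j<n. Z $$ (j,r) * B $$ (s,j)) - (\<Sum>i<n. Z $$ (s,i) * B $$ (i,r))"
        using sr by simp
      finally show "(Z * B) $$ (s,r) = (B * Z) $$ (s,r)"
        using sr B ZC by (simp add: scalar_prod_def lessThan_atLeast0 mult.commute)
    qed (use B ZC in auto)
    have ZS: "Z * mat_diag n (\<lambda>i. complex_of_real (lam i)) = mat_diag n (\<lambda>i. complex_of_real (lam i)) * Z"
      unfolding mat_diag_mult_left[OF ZC] mat_diag_mult_right[OF ZC]
      by (intro cong_mat) (auto simp: Z_def E_def)
    from irreducible_pairD[OF irr ZC ZS ZB] obtain \<zeta> where \<zeta>: "Z = \<zeta> \<cdot>\<^sub>m 1\<^sub>m n" .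
    have zii: "z (i,i) = \<zeta>" if "i < n" for i
    proof -
      have "z (i,i) = Z $$ (i,i)" using that by (simp add: Z_def E_def)
      then show ?thesis using that by (simp add: \<zeta>)
    qed
    have "(\<Sum>p\<in>?I. z p * y p) = (\<Sum>i<n. \<Sum>j<n. if i = j then z (i,i) * \<delta> i else 0)"
      unfolding sum_Times_eq_nested by (intro sum.cong refl) (simp add: y_def)
    also have "\<dots> = (\<Sum>i<n. \<zeta> * \<delta> i)" by (intro sum.cong) (auto simp: zii)
    also have "\<dots> = \<zeta> * (\<Sum>i<n. \<delta> i)" by (rule sum_distrib_left[symmetric])
    finally show "(\<Sum>p\<in>?I. z p * y p) = 0" using \<delta> by simp
  qed auto
  then obtain x where x: "\<And>p. p \<in> ?I \<Longrightarrow> (\<Sum>q\<in>?I. a p q * x q) = y p" by blast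
  define K where "K = mat n n x"
  have KC: "K \<in> carrier_mat n n" by (simp add: K_def)
  show ?thesis
  proof (rule that[OF KC])
    fix i j assume ij: "i < n" "j < n" "lam i = lam j"
    then have "E i j" by (simp add: E_def)
    have "(K * B - B * K) $$ (i,j) = (\<Sum>s<n. K $$ (i,s) * B $$ (s,j)) - (\<Sum>r<n. B $$ (i,r) * K $$ (r,j))"
      using ij B KC by (simp add: scalar_prod_def lessThan_atLeast0)
    also have "\<dots> = (\<Sum>r<n. if r = i then (\<Sum>s<n. K $$ (i,s) * B $$ (s,j)) else 0) - (\<Sum>r<n. B $$ (i,r) * K $$ (r,j))"
      using ij by simp
    also have "\<dots> = (\<Sum>r<n. \<Sum>s<n. (if r = i then K $$ (i,s) * B $$ (s,j) else 0)
          - (if s = j then B $$ (i,r) * K $$ (r,j) else 0))"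
      unfolding sum_subtractf
      by (intro arg_cong2[where f = "(-)"] sum.cong refl) (use ij in \<open>auto\<close>)
    also have "\<dots> = (\<Sum>r<n. \<Sum>s<n. a (i,j) (r,s) * x (r,s))"
      using ij(1,2) \<open>E i j\<close> by (intro sum.cong refl) (simp add: a_def K_def left_diff_distrib)
    also have "\<dots> = y (i,j)"
      using x[of "(i,j)"] ij by (simp add: sum_Times_eq_nested)
    finally show "(K * B - B * K) $$ (i,j) = (if i = j then \<delta> i else 0)"
      by (simp add: y_def)
  qed
qed

text \<open>As \<open>B\<close> is Hermitian and the prescribed diagonal is real, the adjoint of a
  solution \<open>K\<close> is again a solution; the average of both is a Hermitian one.\<close>

lemma block_commutator_hermitian:
  fixes lam \<delta> :: "nat \<Rightarrow> real"
  assumes B: "B \<in> carrier_mat n n" "mat_adjoint B = B"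
    and irr: "irreducible_pair n (mat_diag n (\<lambda>i. complex_of_real (lam i))) B"
    and \<delta>: "(\<Sum>i<n. \<delta> i) = 0"
  obtains H where "H \<in> carrier_mat n n" "mat_adjoint H = H"
    "\<And>i j. i < n \<Longrightarrow> j < n \<Longrightarrow> lam i = lam j \<Longrightarrow>
      \<i> * (H * B - B * H) $$ (i,j) = (if i = j then complex_of_real (\<delta> i) else 0)"
proof -
  have "(\<Sum>i<n. - \<i> * complex_of_real (\<delta> i)) = - \<i> * complex_of_real (\<Sum>i<n. \<delta> i)"
    by (simp only: sum_distrib_left of_real_sum)
  then have "(\<Sum>i<n. - \<i> * complex_of_real (\<delta> i)) = 0"
    using \<delta> by simp
  from block_commutator[OF B(1) irr this] obtain K where K: "K \<in> carrier_mat n n"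
    and KB: "\<And>i j. i < n \<Longrightarrow> j < n \<Longrightarrow> lam i = lam j \<Longrightarrow>
      (K * B - B * K) $$ (i,j) = (if i = j then - \<i> * complex_of_real (\<delta> i) else 0)" by auto
  define L where "L = mat_adjoint K"
  have L: "L \<in> carrier_mat n n" using K by (simp add: L_def)
  have LB: "(L * B - B * L) $$ (i,j) = (if i = j then - \<i> * complex_of_real (\<delta> i) else 0)"
    if "i < n" "j < n" "lam i = lam j" for i j
  proof -
    have "mat_adjoint (K * B - B * K) = B * L - L * B"
      using K B by (simp add: adjoint_minus[of _ n n] adjoint_mult[of _ n n _ n] L_def mult_carrier_mat[of _ n n _ n])
    then have "(B * L - L * B) $$ (i,j) = cnj ((K * B - B * K) $$ (j,i))"
      using K B that by (metis adjoint_index conjugate_complex_def carrier_matD index_minus_mat(2,3) index_mult_mat(2,3))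
    then have "(B * L) $$ (i,j) - (L * B) $$ (i,j) = cnj (if j = i then - \<i> * complex_of_real (\<delta> j) else 0)"
      using KB[of j i] that B L by simp
    then show ?thesis using that B L by (auto simp: algebra_simps)
  qed
  define H where "H = mat n n (\<lambda>(i,j). (K $$ (i,j) + L $$ (i,j)) / 2)"
  have HC: "H \<in> carrier_mat n n" by (simp add: H_def)
  have "mat_adjoint H = H"
    by (rule eq_matI) (use K in \<open>auto simp: H_def L_def\<close>)
  moreover have "\<i> * (H * B - B * H) $$ (i,j) = (if i = j then complex_of_real (\<delta> i) else 0)"
    if ij: "i < n" "j < n" "lam i = lam j" for i j
  proof -
    have "(H * B - B * H) $$ (i,j) = ((K * B - B * K) $$ (i,j) + (L * B - B * L) $$ (i,j)) / 2"
      using K L B HC ij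
      by (simp add: scalar_prod_def H_def sum.distrib add_divide_distrib diff_divide_distrib
          sum_divide_distrib algebra_simps)
    then show ?thesis unfolding KB[OF ij] LB[OF ij] by simp
  qed
  ultimately show ?thesis using that HC by blast
qed

text \<open>\<open>\<beta>\<close> is the diagonal of the second derivative of the orbit curve.\<close>

lemma maximum_variation:
  fixes n :: nat and lam :: "nat \<Rightarrow> real" and e c :: complex
  defines "S \<equiv> mat_diag n (\<lambda>i. complex_of_real (lam i))"
  defines "w \<equiv> e * (\<Prod>i<n. of_real (lam i) - c)"
  assumes B: "B \<in> carrier_mat n n" "mat_adjoint B = B"
    and H: "H \<in> carrier_mat n n" "mat_adjoint H = H"
    and c: "Im c \<noteq> 0"
    and max: "\<And>V. unitary_mat n V \<Longrightarrow>
      Re (e * det (S - B + V * B * mat_adjoint V - c \<cdot>\<^sub>m 1\<^sub>m n)) \<le> Re (e * det (S - c \<cdot>\<^sub>m 1\<^sub>m n))"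
    and D: "\<And>i j. i < n \<Longrightarrow> j < n \<Longrightarrow> D i j = \<i> * (H * B - B * H) $$ (i,j)"
  obtains \<beta> where "(\<Sum>i<n. \<beta> i :: real) = 0"
    "Re (w * (\<Sum>k<n. D k k / (of_real (lam k) - c))) = 0"
    "Re (w * ((\<Sum>k<n. of_real (\<beta> k) / (of_real (lam k) - c)) +
       (\<Sum>k<n. \<Sum>l\<in>{..<n} - {k}. (D k k * D l l - D k l * D l k) / ((of_real (lam k) - c) * (of_real (lam l) - c))))) \<le> 0"
proof -
  obtain b b' b'' where
    b: "\<And>i j z. (b i j has_field_derivative b' i j z) (at z)"
    "\<And>i j z. (b' i j has_field_derivative b'' i j z) (at z)"
    and bV: "\<And>t::real. \<exists>V. unitary_mat n V \<and> mat n n (\<lambda>(i,j). b i j (of_real t)) = V * B * mat_adjoint V"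
    and b0: "\<And>i j. i < n \<Longrightarrow> j < n \<Longrightarrow> b i j 0 = B $$ (i,j)"
    and b1: "\<And>i j. i < n \<Longrightarrow> j < n \<Longrightarrow> b' i j 0 = \<i> * (H * B - B * H) $$ (i,j)"
    and b2: "(\<Sum>i<n. b'' i i 0) = 0" and b2r: "\<And>i. i < n \<Longrightarrow> cnj (b'' i i 0) = b'' i i 0"
    by (rule unitary_orbit_curve[OF H B]) (rule that)
  define d where "d i = of_real (lam i) - c" for i
  \<comment> \<open>At 0 this is the diagonal matrix \<open>S - c\<close>, as the second-order
    expansion requires; for real \<open>z\<close> it is the fixed summand \<open>S - B\<close> plus
    a unitary conjugate of \<open>B\<close>, minus \<open>c\<close>.\<close>
  define m where "m i j z = (if i = j then d i else 0) + (b i j z - B $$ (i,j))" for i j z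
  have m: "(m i j has_field_derivative b' i j z) (at z)" for i j z
    unfolding m_def[abs_def] by (auto intro!: derivative_eq_intros b)
  have m0: "m i j 0 = (if i = j then d i else 0)" if "i < n" "j < n" for i j
    using that by (simp add: m_def b0)
  have d0: "d i \<noteq> 0" for i
    using c by (auto simp: d_def complex_eq_iff)
  obtain F' F'' where F: "\<And>z. ((\<lambda>z. det (mat n n (\<lambda>(i,j). m i j z))) has_field_derivative F' z) (at z)"
    "\<And>z. (F' has_field_derivative F'' z) (at z)"
    and F1: "F' 0 = (\<Prod>i<n. d i) * (\<Sum>k<n. b' k k 0 / d k)"
    and F2: "F'' 0 = (\<Prod>i<n. d i) * ((\<Sum>k<n. b'' k k 0 / d k) +
       (\<Sum>k<n. \<Sum>l\<in>{..<n} - {k}. (b' k k 0 * b' l l 0 - b' k l 0 * b' l k 0) / (d k * d l)))"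
    by (rule det_second_order[where m = m and m' = b' and m'' = b'' and d = d and n = n, OF m b(2) m0 d0])
      (assumption+, rule that)
  have S0: "mat n n (\<lambda>(i,j). m i j 0) = S - c \<cdot>\<^sub>m 1\<^sub>m n"
    by (rule eq_matI) (auto simp: S_def mat_diag_def m0 d_def)
  have mx: "Re (e * det (mat n n (\<lambda>(i,j). m i j (of_real t)))) \<le> Re (e * det (mat n n (\<lambda>(i,j). m i j 0)))" for t :: real
  proof -
    obtain V where V: "unitary_mat n V" "mat n n (\<lambda>(i,j). b i j (of_real t)) = V * B * mat_adjoint V"
      using bV by blast
    have "mat n n (\<lambda>(i,j). m i j (of_real t)) = S - B + mat n n (\<lambda>(i,j). b i j (of_real t)) - c \<cdot>\<^sub>m 1\<^sub>m n"
      by (rule eq_matI) (use B in \<open>auto simp: S_def mat_diag_def m_def d_def\<close>)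
    then show ?thesis using max[OF V(1)] by (simp add: V(2) S0)
  qed
  note t = second_derivative_test[where F = "\<lambda>z. det (mat n n (\<lambda>(i,j). m i j z))", OF F mx]
  have b1D: "b' i j 0 = D i j" if "i < n" "j < n" for i j using that b1 D by simp
  define \<beta> where "\<beta> i = Re (b'' i i 0)" for i
  have \<beta>: "b'' i i 0 = of_real (\<beta> i)" if "i < n" for i
    using b2r[OF that] by (auto simp: \<beta>_def complex_eq_iff)
  show ?thesis
  proof (rule that[of \<beta>])
    show "(\<Sum>i<n. \<beta> i) = 0" using b2 by (simp add: \<beta>_def flip: Re_sum)
    show "Re (w * (\<Sum>k<n. D k k / (of_real (lam k) - c))) = 0"
      using t(1) unfolding F1 w_def d_def[symmetric] by (simp add: b1D mult.assoc)
    show "Re (w * ((\<Sum>k<n. of_real (\<beta> k) / (of_real (lam k) - c)) +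
       (\<Sum>k<n. \<Sum>l\<in>{..<n} - {k}. (D k k * D l l - D k l * D l k) / ((of_real (lam k) - c) * (of_real (lam l) - c))))) \<le> 0"
      using t(2) unfolding F2 w_def d_def[symmetric] by (simp add: b1D \<beta> mult.assoc)
  qed
qed

text \<open>If the quotient were a real number \<open>t\<close>, the imaginary parts in
  \<open>y - c = t (x - c)\<close> would give \<open>t = 1\<close>, hence
  \<open>x = y\<close>.\<close>

lemma quotient_Im_nonzero:
  fixes x y :: real
  assumes "x \<noteq> y" "Im c \<noteq> 0"
  shows "Im ((of_real y - c) / (of_real x - c)) \<noteq> 0"
proof
  assume "Im ((of_real y - c) / (of_real x - c)) = 0"
  then obtain t :: real where t: "(of_real y - c) / (of_real x - c) = of_real t"
    by (metis complex_is_Real_iff Reals_cases)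
  have "of_real x - c \<noteq> 0" using assms by (auto simp: complex_eq_iff)
  then have "of_real y - c = of_real t * (of_real x - c)" using t by (simp add: field_simps)
  then have "y - Re c = t * (x - Re c)" "Im c = t * Im c" by (auto simp: complex_eq_iff)
  then show False using assms by auto
qed

lemma Re_zero_iff_ii: "Re z = 0 \<Longrightarrow> z = \<i> * of_real (Im z)"
  by (auto simp: complex_eq_iff)

text \<open>For real \<open>x \<noteq> y\<close> the condition \<open>Re (w / ((x - c) (y - c))) = 0\<close> says that \<open>Re (w / (x - c)) = Re (w / (y - c))\<close>.\<close>

lemma resolvent_two_values:
  fixes x y z :: real
  assumes "w \<noteq> 0" "Im c \<noteq> 0" "x \<noteq> y" "x \<noteq> z"
    and "Re (w / ((of_real x - c) * (of_real y - c))) = 0" "Re (w / ((of_real x - c) * (of_real z - c))) = 0"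
  shows "y = z"
proof (rule ccontr)
  assume "y \<noteq> z"
  have nz: "of_real x - c \<noteq> 0" "of_real y - c \<noteq> 0" "of_real z - c \<noteq> 0"
    using assms(2) by (auto simp: complex_eq_iff)
  define r s where "r = Im (w / ((of_real x - c) * (of_real y - c)))" and "s = Im (w / ((of_real x - c) * (of_real z - c)))"
  have r: "w / ((of_real x - c) * (of_real y - c)) = \<i> * of_real r"
    and s: "w / ((of_real x - c) * (of_real z - c)) = \<i> * of_real s"
    unfolding r_def s_def by (intro Re_zero_iff_ii assms)+
  have "r \<noteq> 0" using r nz assms(1) by auto
  \<comment> \<open>The two hypotheses provide purely imaginary numbers; their quotient is real, yet
    equals a quotient that cannot be real for \<open>y \<noteq> z\<close>.\<close>
  have "(of_real z - c) / (of_real y - c) = (w / ((of_real x - c) * (of_real y - c))) / (w / ((of_real x - c) * (of_real z - c)))"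
  proof -
    have "Z / Y = (w / (X * Y)) / (w / (X * Z))" if "X \<noteq> 0" "Y \<noteq> 0" "Z \<noteq> 0" for X Y Z :: complex
      using that assms(1) by (simp add: field_simps)
    from this[OF nz] show ?thesis .
  qed
  also have "\<dots> = of_real (r / s)" unfolding r s by simp
  finally have "Im ((of_real z - c) / (of_real y - c)) = 0" by (simp only: Im_complex_of_real)
  then show False using quotient_Im_nonzero[OF \<open>y \<noteq> z\<close> assms(2)] by blast
qed

text \<open>With \<open>u = (y - c) / (x - c)\<close> and the mixed term equal to
  \<open>\<i> r\<close>, the two factors are the real parts of \<open>\<i> r u\<close> and
  \<open>\<i> r / u\<close>, that is \<open>- r Im u\<close> and \<open>r Im u / |u|^2\<close>;
  neither vanishes because \<open>u\<close> is not real.\<close>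

lemma resolvent_opposite_signs:
  fixes x y :: real
  assumes "w \<noteq> 0" "Im c \<noteq> 0" "x \<noteq> y"
    and "Re (w / ((of_real x - c) * (of_real y - c))) = 0"
  shows "Re (w / ((of_real x - c) * (of_real x - c))) * Re (w / ((of_real y - c) * (of_real y - c))) < 0"
proof -
  have nz: "of_real x - c \<noteq> 0" "of_real y - c \<noteq> 0"
    using assms(2) by (auto simp: complex_eq_iff)
  define r where "r = Im (w / ((of_real x - c) * (of_real y - c)))"
  define u where "u = (of_real y - c) / (of_real x - c)"
  have r: "w / ((of_real x - c) * (of_real y - c)) = \<i> * of_real r"
    unfolding r_def by (intro Re_zero_iff_ii assms)
  have "r \<noteq> 0" using r nz assms(1) by auto
  have u: "Im u \<noteq> 0" unfolding u_def by (rule quotient_Im_nonzero[OF assms(3,2)])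
  have "w / ((of_real x - c) * (of_real x - c)) = (w / ((of_real x - c) * (of_real y - c))) * u"
    using nz by (simp add: u_def)
  then have 1: "Re (w / ((of_real x - c) * (of_real x - c))) = - r * Im u" unfolding r by simp
  have "w / ((of_real y - c) * (of_real y - c)) = (w / ((of_real x - c) * (of_real y - c))) * inverse u"
    using nz by (simp add: u_def)
  then have 2: "Re (w / ((of_real y - c) * (of_real y - c))) = r * (Im u / ((Re u)\<^sup>2 + (Im u)\<^sup>2))"
    unfolding r by simp
  have "(Re u)\<^sup>2 + (Im u)\<^sup>2 > 0" using u by (simp add: sum_power2_gt_zero_iff)
  then have "(r * Im u)\<^sup>2 / ((Re u)\<^sup>2 + (Im u)\<^sup>2) > 0" using u \<open>r \<noteq> 0\<close> by simp
  then show ?thesis unfolding 1 2 by (simp add: power2_eq_square algebra_simps)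
qed

section \<open>First and second variation at a maximizer\<close>

lemma Re_of_real_mult: "Re (of_real r * z) = r * Re z"
  by simp

text \<open>The test direction \<open>H\<close> is supported on the entries \<open>(p,q)\<close> and
  \<open>(q,p)\<close>. The phase of \<open>u\<close> is chosen so that the diagonal of the velocity
  is \<open>- 2 r\<close> at \<open>p\<close>, \<open>2 r\<close> at \<open>q\<close> and 0
  elsewhere, with \<open>r > 0\<close> the squared modulus of \<open>B $$ (p,q)\<close>; the first
  variation is then a nonzero multiple of the difference of the two sides.\<close>

lemma resolvent_commutes_at_maximum:
  fixes n :: nat and lam :: "nat \<Rightarrow> real" and e c :: complex
  defines "S \<equiv> mat_diag n (\<lambda>i. complex_of_real (lam i))"
  defines "w \<equiv> e * (\<Prod>i<n. of_real (lam i) - c)"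
  assumes B: "B \<in> carrier_mat n n" "mat_adjoint B = B"
    and c: "Im c \<noteq> 0"
    and max: "\<And>V. unitary_mat n V \<Longrightarrow>
      Re (e * det (S - B + V * B * mat_adjoint V - c \<cdot>\<^sub>m 1\<^sub>m n)) \<le> Re (e * det (S - c \<cdot>\<^sub>m 1\<^sub>m n))"
    and pq: "p < n" "q < n" "B $$ (p,q) \<noteq> 0"
  shows "Re (w / (of_real (lam p) - c)) = Re (w / (of_real (lam q) - c))"
proof (cases "p = q")
  case False
  define u where "u = \<i> * B $$ (p,q)"
  have Bqp: "B $$ (q,p) = cnj (B $$ (p,q))"
    using B pq by (metis adjoint_index carrier_matD conjugate_complex_def)
  define H where "H = mat n n (\<lambda>(i,j). if i = p \<and> j = q then u else if i = q \<and> j = p then cnj u else 0)"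
  have HC: "H \<in> carrier_mat n n" by (simp add: H_def)
  have hermH: "mat_adjoint H = H"
    by (rule eq_matI) (use False in \<open>auto simp: H_def\<close>)
  define D where "D i j = \<i> * (H * B - B * H) $$ (i,j)" for i j
  have first: "Re (w * (\<Sum>k<n. D k k / (of_real (lam k) - c))) = 0"
    unfolding w_def by (rule maximum_variation[OF B HC hermH c max[unfolded S_def] D_def])
  have Dkk: "D k k = (if k = p then - 2 * (cmod (B $$ (p,q)))\<^sup>2 else if k = q then 2 * (cmod (B $$ (p,q)))\<^sup>2 else 0)"
    if "k < n" for k
  proof -
    have HB: "(H * B) $$ (k,k) = (if k = p then u * B $$ (q,p) else if k = q then cnj u * B $$ (p,q) else 0)"
    proof -
      have "(H * B) $$ (k,k) = (\<Sum>j<n. H $$ (k,j) * B $$ (j,k))"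
        using that HC B by (simp add: scalar_prod_def lessThan_atLeast0)
      also have "\<dots> = (\<Sum>j<n. (if j = q then (if k = p then u * B $$ (q,k) else 0) else 0) +
          (if j = p then (if k = q then cnj u * B $$ (p,k) else 0) else 0))"
        using that False by (intro sum.cong) (auto simp: H_def)
      finally show ?thesis using pq False by (simp add: sum.distrib)
    qed
    have BH: "(B * H) $$ (k,k) = (if k = p then cnj u * B $$ (p,q) else if k = q then u * B $$ (q,p) else 0)"
    proof -
      have "(B * H) $$ (k,k) = (\<Sum>j<n. B $$ (k,j) * H $$ (j,k))"
        using that HC B by (simp add: scalar_prod_def lessThan_atLeast0)
      also have "\<dots> = (\<Sum>j<n. (if j = q then (if k = p then cnj u * B $$ (k,q) else 0) else 0) +
          (if j = p then (if k = q then u * B $$ (k,p) else 0) else 0))"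
        using that False by (intro sum.cong) (auto simp: H_def)
      finally show ?thesis using pq False by (simp add: sum.distrib)
    qed
    define r where "r = complex_of_real ((cmod (B $$ (p,q)))\<^sup>2)"
    have "B $$ (p,q) * cnj (B $$ (p,q)) = r"
      unfolding r_def by (rule complex_norm_square[symmetric])
    then have r: "u * B $$ (q,p) = \<i> * r" "cnj u * B $$ (p,q) = - (\<i> * r)"
      unfolding u_def Bqp by (auto simp: ac_simps)
    have "D k k = \<i> * ((H * B) $$ (k,k) - (B * H) $$ (k,k))"
      using that HC B by (simp add: D_def)
    also have "\<dots> = (if k = p then - 2 * r else if k = q then 2 * r else 0)"
      unfolding HB BH r using False by (cases "k = p"; cases "k = q") (simp_all add: algebra_simps)
    finally show ?thesis by (simp add: r_def)
  qed
  have "(\<Sum>k<n. D k k / (of_real (lam k) - c)) =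
      (\<Sum>k<n. (if k = p then - 2 * (cmod (B $$ (p,q)))\<^sup>2 / (of_real (lam p) - c) else 0) +
        (if k = q then 2 * (cmod (B $$ (p,q)))\<^sup>2 / (of_real (lam q) - c) else 0))"
    by (intro sum.cong refl) (use False in \<open>simp add: Dkk\<close>)
  also have "\<dots> = of_real (2 * (cmod (B $$ (p,q)))\<^sup>2) * (1 / (of_real (lam q) - c) - 1 / (of_real (lam p) - c))"
    using pq by (simp add: sum.distrib algebra_simps)
  finally have "w * (\<Sum>k<n. D k k / (of_real (lam k) - c)) =
      w * (of_real (2 * (cmod (B $$ (p,q)))\<^sup>2) * (1 / (of_real (lam q) - c) - 1 / (of_real (lam p) - c)))"
    by (rule arg_cong)
  also have "\<dots> = of_real (2 * (cmod (B $$ (p,q)))\<^sup>2) * (w / (of_real (lam q) - c) - w / (of_real (lam p) - c))"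
  proof -
    have "w * (x * (1 / a - 1 / b)) = x * (w / a - w / b)" for x a b :: complex
      by (simp add: divide_inverse algebra_simps)
    then show ?thesis .
  qed
  finally have "Re (of_real (2 * (cmod (B $$ (p,q)))\<^sup>2) * (w / (of_real (lam q) - c) - w / (of_real (lam p) - c))) = 0"
    using first by (simp only:)
  then have "2 * (cmod (B $$ (p,q)))\<^sup>2 * (Re (w / (of_real (lam q) - c)) - Re (w / (of_real (lam p) - c))) = 0"
    by (simp only: Re_of_real_mult minus_complex.sel)
  then show ?thesis using pq(3) by simp
qed simp

lemma no_irreducible_maximum:
  fixes n :: nat and lam :: "nat \<Rightarrow> real" and e c :: complex
  defines "S \<equiv> mat_diag n (\<lambda>i. complex_of_real (lam i))"
  assumes B: "B \<in> carrier_mat n n" "mat_adjoint B = B"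
    and c: "Im c \<noteq> 0" and e: "e \<noteq> 0" and n: "n \<ge> 3"
    and max: "\<And>V. unitary_mat n V \<Longrightarrow>
      Re (e * det (S - B + V * B * mat_adjoint V - c \<cdot>\<^sub>m 1\<^sub>m n)) \<le> Re (e * det (S - c \<cdot>\<^sub>m 1\<^sub>m n))"
    and irr: "irreducible_pair n S B"
  shows False
proof -
  define w where "w = e * (\<Prod>i<n. of_real (lam i) - c)"
  have d0: "of_real x - c \<noteq> 0" for x :: real using c by (auto simp: complex_eq_iff)
  have w0: "w \<noteq> 0" using e d0 by (simp add: w_def)
  define g where "g i = Re (w / (of_real (lam i) - c))" for i
  have diag_S: "mat_diag n f * S = S * mat_diag n f" for f :: "nat \<Rightarrow> complex"
    by (simp add: S_def mult.commute)
  have scalar_diag: "f i = f j" if f: "mat_diag n f * B = B * mat_diag n f" and ij: "i < n" "j < n"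
    for f :: "nat \<Rightarrow> complex" and i j
  proof -
    obtain \<zeta> where "mat_diag n f = \<zeta> \<cdot>\<^sub>m 1\<^sub>m n"
      using irreducible_pairD[OF irr mat_diag_dim diag_S f] .
    then have "mat_diag n f $$ (k,k) = \<zeta>" if "k < n" for k using that by simp
    then show ?thesis using ij by (simp add: mat_diag_def)
  qed
  have g_eq: "g i = g j" if "i < n" "j < n" for i j
  proof -
    have "mat_diag n (\<lambda>i. complex_of_real (g i)) * B = B * mat_diag n (\<lambda>i. complex_of_real (g i))"
      unfolding mat_diag_mult_left[OF B(1)] mat_diag_mult_right[OF B(1)]
    proof (intro cong_mat refl, clarify)
      fix p q assume "p < n" "q < n"
      then show "complex_of_real (g p) * B $$ (p,q) = B $$ (p,q) * complex_of_real (g q)"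
        using resolvent_commutes_at_maximum[OF B c max[unfolded S_def], of p q]
        unfolding g_def w_def by (cases "B $$ (p,q) = 0") auto
    qed
    from scalar_diag[OF this that] show ?thesis by simp
  qed
  have cross: "Re (w / ((of_real (lam i) - c) * (of_real (lam j) - c))) = 0"
    if "i < n" "j < n" "lam i \<noteq> lam j" for i j
  proof -
    \<comment> \<open>The resolvent identity; since \<open>g\<close> is constant, it makes the real
      part of the mixed coefficient vanish.\<close>
    have "w / (of_real (lam i) - c) - w / (of_real (lam j) - c) =
      of_real (lam j - lam i) * (w / ((of_real (lam i) - c) * (of_real (lam j) - c)))"
      using d0 by (simp add: field_simps)
    then have "g i - g j = (lam j - lam i) * Re (w / ((of_real (lam i) - c) * (of_real (lam j) - c)))"
      unfolding g_def by (metis Re_of_real_mult minus_complex.sel(1))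
    then show ?thesis using g_eq[OF that(1,2)] that(3) by simp
  qed
  \<comment> \<open>If all \<open>lam\<close> agreed, \<open>S\<close> would be scalar, so
    \<open>B\<close> would itself lie in the commutant and be scalar too; then a diagonal matrix
    unit commutes with both, against irreducibility.\<close>
  have "\<exists>p<n. lam p \<noteq> lam 0"
  proof (rule ccontr)
    assume "\<not> ?thesis"
    then have eq: "lam i = lam 0" if "i < n" for i using that by blast
    have "S = of_real (lam 0) \<cdot>\<^sub>m 1\<^sub>m n"
    proof (rule eq_matI)
      fix i j assume "i < dim_row (of_real (lam 0) \<cdot>\<^sub>m 1\<^sub>m n :: complex mat)" "j < dim_col (of_real (lam 0) \<cdot>\<^sub>m 1\<^sub>m n :: complex mat)"
      then show "S $$ (i,j) = (of_real (lam 0) \<cdot>\<^sub>m 1\<^sub>m n) $$ (i,j)"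
        by (cases "i = j") (simp_all add: S_def mat_diag_def eq[of j])
    qed (simp_all add: S_def mat_diag_def)
    then have "B * S = S * B" using B by (simp add: mult_smult_distrib[of _ n n _ n] mult_smult_assoc_mat[of _ n n _ n])
    from irreducible_pairD[OF irr B(1) this refl] obtain \<zeta> where \<zeta>: "B = \<zeta> \<cdot>\<^sub>m 1\<^sub>m n" .
    let ?f = "\<lambda>i::nat. if i = 0 then 1 else 0 :: complex"
    have "mat_diag n ?f * B = B * mat_diag n ?f"
      unfolding \<zeta> by (simp add: mult_smult_distrib[of _ n n _ n] mult_smult_assoc_mat[of _ n n _ n]
          right_mult_one_mat[OF mat_diag_dim] left_mult_one_mat[OF mat_diag_dim])
    from scalar_diag[OF this, of 0 1] n show False by simp
  qed
  then obtain p1 q1 where pq1: "p1 < n" "q1 < n" "lam p1 \<noteq> lam q1" using n by (metis less_le_trans zero_less_numeral)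
  define Q where "Q x = Re (w / ((of_real x - c) * (of_real x - c)))" for x :: real
  have "Q (lam p1) * Q (lam q1) < 0"
    unfolding Q_def by (rule resolvent_opposite_signs[OF w0 c pq1(3) cross[OF pq1]])
  then obtain p q where pq: "p < n" "q < n" "lam p \<noteq> lam q" and Qp: "Q (lam p) < 0" and Qq: "Q (lam q) > 0"
    using pq1 by (metis mult_less_0_iff)
  have two: "lam i = lam p \<or> lam i = lam q" if i: "i < n" for i
  proof (rule ccontr)
    assume *: "\<not> ?thesis"
    have "lam q = lam i"
      by (rule resolvent_two_values[OF w0 c _ _ cross cross]) (use pq i * in auto)
    with * show False by simp
  qed
  \<comment> \<open>The sum is the second variation in a direction whose velocity has diagonal
    \<open>\<delta>\<close> and vanishes elsewhere inside the blocks.\<close>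
  have no_ascent: "(\<Sum>k<n. \<delta> k * Q (lam k) * ((\<Sum>l\<in>{l. l < n \<and> lam l = lam k}. \<delta> l) - \<delta> k)) \<le> 0"
    if \<delta>: "(\<Sum>i<n. \<delta> i) = 0" for \<delta> :: "nat \<Rightarrow> real"
  proof -
    from block_commutator_hermitian[OF B irr[unfolded S_def] \<delta>] obtain H
      where H: "H \<in> carrier_mat n n" "mat_adjoint H = H"
      and HB: "\<And>i j. i < n \<Longrightarrow> j < n \<Longrightarrow> lam i = lam j \<Longrightarrow>
        \<i> * (H * B - B * H) $$ (i,j) = (if i = j then complex_of_real (\<delta> i) else 0)" by metis
    define D where "D i j = \<i> * (H * B - B * H) $$ (i,j)" for i j
    have Dherm: "D j i = cnj (D i j)" if "i < n" "j < n" for i j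
    proof -
      have "mat_adjoint (H * B - B * H) = B * H - H * B"
        using H B by (simp add: adjoint_minus[of _ n n] adjoint_mult[of _ n n _ n] mult_carrier_mat[of _ n n _ n])
      then have "cnj ((H * B - B * H) $$ (i,j)) = (B * H - H * B) $$ (j,i)"
        using H B that by (metis adjoint_index conjugate_complex_def carrier_matD index_minus_mat(2,3) index_mult_mat(2,3))
      also have "\<dots> = - (H * B - B * H) $$ (j,i)" using H B that by simp
      finally show ?thesis by (simp add: D_def del: index_minus_mat)
    qed
    have Dd: "D i i = of_real (\<delta> i)" if "i < n" for i using HB[of i i] that by (simp add: D_def)
    have Do: "D i j = 0" if "i < n" "j < n" "lam i = lam j" "i \<noteq> j" for i j using HB[of i j] that by (simp add: D_def)
    obtain \<beta> where \<beta>: "(\<Sum>i<n. \<beta> i :: real) = 0"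
      and second: "Re (e * (\<Prod>i<n. of_real (lam i) - c) * ((\<Sum>k<n. of_real (\<beta> k) / (of_real (lam k) - c)) +
       (\<Sum>k<n. \<Sum>l\<in>{..<n} - {k}. (D k k * D l l - D k l * D l k) / ((of_real (lam k) - c) * (of_real (lam l) - c))))) \<le> 0"
      by (rule maximum_variation[OF B H c max[unfolded S_def] D_def]) (assumption, rule that)
    note second = second[folded w_def]
    have "Re (w * (\<Sum>k<n. of_real (\<beta> k) / (of_real (lam k) - c))) = (\<Sum>k<n. Re (of_real (\<beta> k) * (w / (of_real (lam k) - c))))"
      by (simp add: sum_distrib_left mult.commute)
    \<comment> \<open>The acceleration drops out: \<open>g\<close> is constant and the
      \<open>\<beta> k\<close> add up to zero.\<close>
    also have "\<dots> = (\<Sum>k<n. \<beta> k * g 0)"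
    proof (intro sum.cong refl)
      fix k assume "k \<in> {..<n}"
      then have "g k = g 0" by (intro g_eq) auto
      then show "Re (of_real (\<beta> k) * (w / (of_real (lam k) - c))) = \<beta> k * g 0"
        by (simp only: Re_of_real_mult g_def)
    qed
    also have "\<dots> = 0" using \<beta> by (simp only: sum_distrib_right[symmetric] mult_zero_left)
    finally have "Re (w * (\<Sum>k<n. \<Sum>l\<in>{..<n} - {k}. (D k k * D l l - D k l * D l k) / ((of_real (lam k) - c) * (of_real (lam l) - c)))) \<le> 0"
      using second by (simp only: distrib_left plus_complex.sel)
    also have "Re (w * (\<Sum>k<n. \<Sum>l\<in>{..<n} - {k}. (D k k * D l l - D k l * D l k) / ((of_real (lam k) - c) * (of_real (lam l) - c)))) =
       (\<Sum>k<n. \<Sum>l\<in>{..<n} - {k}. Re ((D k k * D l l - D k l * D l k) * (w / ((of_real (lam k) - c) * (of_real (lam l) - c)))))"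
      by (simp add: sum_distrib_left mult.commute)
    also have "\<dots> = (\<Sum>k<n. \<Sum>l\<in>{..<n} - {k}. if lam l = lam k then \<delta> k * Q (lam k) * \<delta> l else 0)"
    proof (intro sum.cong refl)
      fix k l assume "k \<in> {..<n}" "l \<in> {..<n} - {k}"
      then have kl: "k < n" "l < n" "l \<noteq> k" by auto
      \<comment> \<open>The unknown moduli of off-diagonal entries of \<open>D\<close> never count:
        inside a block these entries vanish by the choice of \<open>H\<close>, and between the
        blocks the coefficient is zero by \<open>cross\<close>.\<close>
      have "D k k * D l l - D k l * D l k = of_real (\<delta> k * \<delta> l - (cmod (D k l))\<^sup>2)"
        using Dd kl Dherm[of k l] by (simp add: complex_norm_square del: of_real_power)
      then have "Re ((D k k * D l l - D k l * D l k) * (w / ((of_real (lam k) - c) * (of_real (lam l) - c)))) =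
        (\<delta> k * \<delta> l - (cmod (D k l))\<^sup>2) * Re (w / ((of_real (lam k) - c) * (of_real (lam l) - c)))"
        by (simp only: Re_of_real_mult)
      also have "\<dots> = (if lam l = lam k then \<delta> k * Q (lam k) * \<delta> l else 0)"
        using cross[of k l] Do[of k l] kl by (auto simp: Q_def)
      finally show "Re ((D k k * D l l - D k l * D l k) * (w / ((of_real (lam k) - c) * (of_real (lam l) - c)))) =
        (if lam l = lam k then \<delta> k * Q (lam k) * \<delta> l else 0)" .
    qed
    also have "\<dots> = (\<Sum>k<n. \<delta> k * Q (lam k) * ((\<Sum>l\<in>{l. l < n \<and> lam l = lam k}. \<delta> l) - \<delta> k))"
    proof (intro sum.cong refl)
      fix k assume k: "k \<in> {..<n}"
      have "(\<Sum>l\<in>{..<n} - {k}. if lam l = lam k then \<delta> k * Q (lam k) * \<delta> l else 0) =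
        (\<Sum>l\<in>{l. l < n \<and> lam l = lam k} - {k}. \<delta> k * Q (lam k) * \<delta> l)"
        by (rule sum.mono_neutral_cong_right) auto
      also have "\<dots> = \<delta> k * Q (lam k) * (\<Sum>l\<in>{l. l < n \<and> lam l = lam k} - {k}. \<delta> l)"
        by (simp add: sum_distrib_left)
      also have "(\<Sum>l\<in>{l. l < n \<and> lam l = lam k} - {k}. \<delta> l) = (\<Sum>l\<in>{l. l < n \<and> lam l = lam k}. \<delta> l) - \<delta> k"
        using k by (subst sum_diff1) auto
      finally show "(\<Sum>l\<in>{..<n} - {k}. if lam l = lam k then \<delta> k * Q (lam k) * \<delta> l else 0) =
        \<delta> k * Q (lam k) * ((\<Sum>l\<in>{l. l < n \<and> lam l = lam k}. \<delta> l) - \<delta> k)" .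
    qed
    finally show ?thesis .
  qed
  show False
  proof (cases "\<exists>r<n. r \<noteq> p \<and> lam r = lam p")
    case True
    then obtain r where r: "r < n" "r \<noteq> p" "lam r = lam p" by auto
    \<comment> \<open>The block with the negative coefficient has a second index \<open>r\<close>;
      opposite values at \<open>p\<close> and \<open>r\<close> have trace zero, and the sum of their
      squares is multiplied by \<open>- Q (lam p) > 0\<close>.\<close>
    define \<delta> where "\<delta> i = (if i = p then 1 else 0) - (if i = r then 1 else 0 :: real)" for i
    have blk: "(\<Sum>l\<in>{l. l < n \<and> lam l = lam k}. \<delta> l) = 0" for k
      using r pq by (cases "lam k = lam p") (auto simp: \<delta>_def sum_subtractf)
    have "(\<Sum>k<n. \<delta> k * Q (lam k) * ((\<Sum>l\<in>{l. l < n \<and> lam l = lam k}. \<delta> l) - \<delta> k)) =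
      (\<Sum>k<n. (if k = p then - Q (lam p) else 0) + (if k = r then - Q (lam p) else 0))"
      unfolding blk using r by (intro sum.cong) (auto simp: \<delta>_def)
    also have "\<dots> = - 2 * Q (lam p)" using r pq by (simp add: sum.distrib)
    finally show False using no_ascent[of \<delta>] Qp r pq by (simp add: \<delta>_def sum_subtractf)
  next
    case False
    \<comment> \<open>The block of \<open>p\<close> is a single index and contributes nothing. The
      compensating trace -1 is spread evenly over the other \<open>n - 1\<close> indices;
      \<open>n \<ge> 3\<close> gives \<open>s < 1\<close> and thus a positive contribution.\<close>
    define s where "s = 1 / real (n - 1)"
    have s: "0 < s" "s < 1" "real (n - 1) * s = 1" using n by (auto simp: s_def)
    define \<delta> where "\<delta> i = (if i = p then 1 else - s)" for i
    have Y: "lam k = lam q \<longleftrightarrow> k \<noteq> p" if "k < n" for k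
      using two[OF that] False that pq by auto
    have sumY: "(\<Sum>l\<in>{..<n} - {p}. \<delta> l) = -1"
    proof -
      have "(\<Sum>l\<in>{..<n} - {p}. \<delta> l) = (\<Sum>l\<in>{..<n} - {p}. - s)" by (intro sum.cong) (auto simp: \<delta>_def)
      then show ?thesis using pq s(3) by simp
    qed
    have sum0: "(\<Sum>i<n. \<delta> i) = 0"
      using sumY pq by (simp add: sum.remove[of _ p] \<delta>_def)
    have summand: "\<delta> k * Q (lam k) * ((\<Sum>l\<in>{l. l < n \<and> lam l = lam k}. \<delta> l) - \<delta> k) =
      (if k = p then 0 else s * Q (lam q) * (1 - s))" if k: "k < n" for k
    proof (cases "k = p")
      case True
      have "{l. l < n \<and> lam l = lam p} = {p}" using False pq by auto
      then show ?thesis using True by simp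
    next
      case kp: False
      then have lk: "lam k = lam q" using Y[OF k] by simp
      have "{l. l < n \<and> lam l = lam q} = {l\<in>{..<n}. l \<noteq> p}" using Y by auto
      also have "\<dots> = {..<n} - {p}" by auto
      finally show ?thesis using kp sumY by (simp add: lk \<delta>_def algebra_simps)
    qed
    have "0 < s * Q (lam q) * (1 - s)" using s Qq by simp
    then have "0 < (\<Sum>k<n. if k = p then 0 else s * Q (lam q) * (1 - s))"
      using pq by (intro sum_pos2[of _ q]) auto
    also have "\<dots> = (\<Sum>k<n. \<delta> k * Q (lam k) * ((\<Sum>l\<in>{l. l < n \<and> lam l = lam k}. \<delta> l) - \<delta> k))"
      by (intro sum.cong) (auto simp: summand)
    finally show False using no_ascent[OF sum0] by simp
  qed
qed

section \<open>Determinants of sums of Hermitian matrices\<close>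

lemma unitary_conj_minus:
  fixes U A B :: "complex mat"
  assumes "U \<in> carrier_mat n n" "A \<in> carrier_mat n n" "B \<in> carrier_mat n n"
  shows "U * (A - B) * mat_adjoint U = U * A * mat_adjoint U - U * B * mat_adjoint U"
  using assms
  by (simp add: mult_minus_distrib_mat[of _ n n _ n] minus_mult_distrib_mat[of _ n n _ _ n] mult_carrier_mat[of _ n n _ n])

lemma det_unitary_conj:
  assumes "unitary_mat n U" "A \<in> carrier_mat n n"
  shows "det (U * A * mat_adjoint U) = det A"
  by (rule det_similar[OF unitary_conj_similar[OF assms]])

lemma det_sum_unitary_conj:
  assumes U: "unitary_mat n U" and A: "A \<in> carrier_mat n n" and B: "B \<in> carrier_mat n n"
  shows "det (U * A * mat_adjoint U + U * B * mat_adjoint U - c \<cdot>\<^sub>m 1\<^sub>m n) = det (A + B - c \<cdot>\<^sub>m 1\<^sub>m n)"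
proof -
  note UC = unitary_mat_carrier[OF U]
  have "U * (A + B - c \<cdot>\<^sub>m 1\<^sub>m n) * mat_adjoint U = U * A * mat_adjoint U + U * B * mat_adjoint U - c \<cdot>\<^sub>m 1\<^sub>m n"
    using A B UC by (simp add: unitary_conj_minus unitary_conj_add unitary_conj_smult_one[OF U])
  then show ?thesis
    using det_unitary_conj[OF U, of "A + B - c \<cdot>\<^sub>m 1\<^sub>m n"] minus_carrier_mat[of "c \<cdot>\<^sub>m 1\<^sub>m n" n n "A + B"] by simp
qed

lemma char_poly_unitary_conj:
  assumes "unitary_mat n U" "A \<in> carrier_mat n n"
  shows "char_poly (U * A * mat_adjoint U) = char_poly A"
  by (rule char_poly_similar[OF unitary_conj_similar[OF assms]])

section \<open>Compactness of the unitary matrices and existence of a maximizer\<close>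

lemma unitary_entry_le_1:
  assumes U: "unitary_mat n U" and ij: "i < n" "j < n"
  shows "cmod (U $$ (i,j)) \<le> 1"
proof -
  note UC = unitary_mat_carrier[OF U]
  have "(\<Sum>k<n. cnj (U $$ (k,j)) * U $$ (k,j)) = (mat_adjoint U * U) $$ (j,j)"
    using UC ij by (simp add: scalar_prod_def lessThan_atLeast0)
  also have "\<dots> = 1" using ij by (simp add: unitary_mat_left[OF U])
  finally have "complex_of_real (\<Sum>k<n. (cmod (U $$ (k,j)))\<^sup>2) = of_real 1"
    by (simp add: complex_norm_square mult.commute del: of_real_power)
  then have "(\<Sum>k<n. (cmod (U $$ (k,j)))\<^sup>2) = 1" by (simp only: of_real_eq_iff)
  moreover have "(cmod (U $$ (i,j)))\<^sup>2 \<le> (\<Sum>k<n. (cmod (U $$ (k,j)))\<^sup>2)"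
    using ij by (intro member_le_sum) auto
  ultimately have "(cmod (U $$ (i,j)))\<^sup>2 \<le> 1\<^sup>2" by simp
  then show ?thesis by (rule power2_le_imp_le) simp
qed

lemma compact_functions_cball: "compact {f :: 'i \<Rightarrow> complex. \<forall>p. f p \<in> cball 0 1}"
proof -
  have "compactin (product_topology (\<lambda>_. euclidean) (UNIV :: 'i set)) (PiE UNIV (\<lambda>_. cball (0::complex) 1))"
    by (subst compactin_PiE) auto
  then have "compact (PiE UNIV (\<lambda>_. cball 0 1) :: ('i \<Rightarrow> complex) set)"
    by (simp only: euclidean_product_topology compactin_euclidean_iff)
  moreover have "PiE UNIV (\<lambda>_. cball 0 1) = {f :: 'i \<Rightarrow> complex. \<forall>p. f p \<in> cball 0 1}"
    by (auto simp: PiE_def Pi_def)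
  ultimately show ?thesis by simp
qed

lemma continuous_on_coordinate: "continuous_on S (\<lambda>f. f p :: complex)"
  by (rule continuous_on_subset[OF continuous_on_product_coordinates]) simp

text \<open>Matrices are represented by entry functions in a product of closed unit balls, which is
  compact by Tychonoff. Unitarity amounts to finitely many closed conditions, and the objective is
  continuous in the entries.\<close>

lemma unitary_maximum_exists:
  assumes A: "A \<in> carrier_mat n n" and B: "B \<in> carrier_mat n n"
  obtains V where "unitary_mat n V"
    "\<And>U. unitary_mat n U \<Longrightarrow>
      Re (e * det (A + U * B * mat_adjoint U - c \<cdot>\<^sub>m 1\<^sub>m n)) \<le>
      Re (e * det (A + V * B * mat_adjoint V - c \<cdot>\<^sub>m 1\<^sub>m n))"
proof -
  define eqn where "eqn i j = {f :: nat \<times> nat \<Rightarrow> complex. (\<Sum>k<n. cnj (f (k,i)) * f (k,j)) = (if i = j then 1 else 0)}" for i j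
  define K where "K = {f :: nat \<times> nat \<Rightarrow> complex. \<forall>p. f p \<in> cball 0 1} \<inter> (\<Inter>i<n. \<Inter>j<n. eqn i j)"
  define mt where "mt f = mat n n f" for f :: "nat \<times> nat \<Rightarrow> complex"
  define G where "G f = Re (e * det (mat n n (\<lambda>(i,j). A $$ (i,j) +
      (\<Sum>a<n. \<Sum>k<n. f (i,a) * B $$ (a,k) * cnj (f (j,k))) - (if i = j then c else 0))))" for f
  have G: "G f = Re (e * det (A + mt f * B * mat_adjoint (mt f) - c \<cdot>\<^sub>m 1\<^sub>m n))" for f
  proof -
    have "mat n n (\<lambda>(i,j). A $$ (i,j) +
      (\<Sum>a<n. \<Sum>k<n. f (i,a) * B $$ (a,k) * cnj (f (j,k))) - (if i = j then c else 0)) =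
      A + mt f * B * mat_adjoint (mt f) - c \<cdot>\<^sub>m 1\<^sub>m n" (is "?L = ?R")
    proof (rule eq_matI)
      fix i j assume "i < dim_row ?R" "j < dim_col ?R"
      then have ij: "i < n" "j < n" by (auto simp: mt_def)
      have "(mt f * B * mat_adjoint (mt f)) $$ (i,j) = (\<Sum>a<n. \<Sum>k<n. f (i,a) * B $$ (a,k) * cnj (f (j,k)))"
        using ij by (subst triple_product_index[OF _ B]) (auto simp: mt_def)
      moreover have "?R $$ (i,j) = A $$ (i,j) + (mt f * B * mat_adjoint (mt f)) $$ (i,j) - (if i = j then c else 0)"
        using ij A B by (simp add: mt_def del: index_mult_mat(1))
      ultimately show "?L $$ (i,j) = ?R $$ (i,j)" using ij by simp
    qed (auto simp: mt_def)
    then show ?thesis by (simp add: G_def)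
  qed
  have closed: "closed (eqn i j)" for i j
    unfolding eqn_def
    by (intro closed_Collect_eq continuous_intros continuous_on_coordinate)
  have "compact K"
    unfolding K_def by (intro compact_Int_closed compact_functions_cball closed_INT ballI closed)
  moreover have unit: "unitary_mat n (mt f)" if "f \<in> K" for f
    unfolding unitary_mat_def
  proof
    show "mat_adjoint (mt f) * mt f = 1\<^sub>m n"
    proof (rule eq_matI)
      fix i j assume "i < dim_row (1\<^sub>m n)" "j < dim_col (1\<^sub>m n)"
      then have ij: "i < n" "j < n" by auto
      then have "f \<in> eqn i j" using that by (auto simp: K_def)
      then show "(mat_adjoint (mt f) * mt f) $$ (i,j) = 1\<^sub>m n $$ (i,j)"
        using ij by (simp add: eqn_def mt_def scalar_prod_def lessThan_atLeast0)
    qed (auto simp: mt_def)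
  qed (simp add: mt_def)
  have in_K: "\<exists>f\<in>K. mt f = U" if U: "unitary_mat n U" for U
  proof -
    note UC = unitary_mat_carrier[OF U]
    \<comment> \<open>Entries out of range are set to 0 so that the function lies in the product of
      unit balls.\<close>
    define f where "f = (\<lambda>(i,j). if i < n \<and> j < n then U $$ (i,j) else 0)"
    have "f \<in> eqn i j" if ij: "i < n" "j < n" for i j
    proof -
      have "(\<Sum>k<n. cnj (f (k,i)) * f (k,j)) = (mat_adjoint U * U) $$ (i,j)"
        using UC ij by (simp add: f_def scalar_prod_def lessThan_atLeast0)
      then show ?thesis using ij by (simp add: eqn_def unitary_mat_left[OF U])
    qed
    moreover have "f p \<in> cball 0 1" for p
      using unitary_entry_le_1[OF U] by (auto simp: f_def split: prod.splits)
    ultimately have "f \<in> K" by (auto simp: K_def)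
    moreover have "mt f = U" using UC by (intro eq_matI) (auto simp: mt_def f_def)
    ultimately show ?thesis by blast
  qed
  then have "K \<noteq> {}" using unitary_mat_one[of n] by blast
  moreover have "continuous_on K G"
    unfolding G_def det_def'[OF mat_carrier]
    by (rule continuous_on_eq[where f = "\<lambda>f. Re (e * (\<Sum>p | p permutes {0..<n}. signof p * (\<Prod>i = 0..<n.
        A $$ (i, p i) + (\<Sum>a<n. \<Sum>k<n. f (i,a) * B $$ (a,k) * cnj (f (p i,k))) - (if i = p i then c else 0))))"])
      (intro continuous_intros continuous_on_coordinate,
       auto intro!: arg_cong[where f = Re] sum.cong prod.cong)
  ultimately obtain f where f: "f \<in> K" "\<And>g. g \<in> K \<Longrightarrow> G g \<le> G f"
    using continuous_attains_sup[of K G] by blast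
  show ?thesis
  proof (rule that[OF unit[OF f(1)]])
    fix U assume "unitary_mat n U"
    then obtain g where "g \<in> K" "mt g = U" using in_K by blast
    then show "Re (e * det (A + U * B * mat_adjoint U - c \<cdot>\<^sub>m 1\<^sub>m n)) \<le>
      Re (e * det (A + mt f * B * mat_adjoint (mt f) - c \<cdot>\<^sub>m 1\<^sub>m n))"
      using f(2)[of g] by (simp add: G)
  qed
qed

text \<open>Entry \<open>(i,j)\<close> of the commutation relation reads
  \<open>A $$ (i,j) * z j = z i * A $$ (i,j)\<close>, so an entry between different values of
  \<open>z\<close> is zero.\<close>

lemma commuting_diag_block_form:
  fixes A :: "complex mat"
  assumes A: "A \<in> carrier_mat (k + m) (k + m)"
    and comm: "A * mat_diag (k + m) z = mat_diag (k + m) z * A"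
    and z: "\<And>i j. i < k \<Longrightarrow> k \<le> j \<Longrightarrow> j < k + m \<Longrightarrow> z i \<noteq> z j"
  shows "A = four_block_mat (mat k k (\<lambda>(i,j). A $$ (i,j))) (0\<^sub>m k m) (0\<^sub>m m k)
    (mat m m (\<lambda>(i,j). A $$ (k + i, k + j)))" (is "A = ?F")
proof (rule eq_matI)
  have zero: "A $$ (i,j) = 0" if "i < k + m" "j < k + m" "z i \<noteq> z j" for i j
  proof -
    have "(A * mat_diag (k + m) z) $$ (i,j) = (mat_diag (k + m) z * A) $$ (i,j)" by (simp only: comm)
    then have "A $$ (i,j) * z j = z i * A $$ (i,j)"
      using that unfolding mat_diag_mult_left[OF A] mat_diag_mult_right[OF A] by simp
    then show ?thesis using that(3) by (auto simp: mult.commute)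
  qed
  fix i j assume "i < dim_row ?F" "j < dim_col ?F"
  then have ij: "i < k + m" "j < k + m" by auto
  show "A $$ (i,j) = ?F $$ (i,j)"
  proof (cases "i < k"; cases "j < k")
    assume "i < k" "\<not> j < k"
    then show ?thesis using ij zero[OF ij] z[of i j] by simp
  next
    assume "\<not> i < k" "j < k"
    then show ?thesis using ij zero[OF ij] z[of j i] by simp
  qed (use ij in auto)
qed (use A in auto)

lemma det_2_by_2:
  fixes A :: "complex mat"
  assumes "A \<in> carrier_mat 2 2"
  shows "det A = A $$ (0,0) * A $$ (1,1) - A $$ (0,1) * A $$ (1,0)"
proof -
  have "{p. p permutes {0..<2::nat}} = {id, Transposition.transpose 0 1}"
    using permutes_doubleton_iff[of _ 0 "1::nat"] by (auto simp: numeral_2_eq_2 atLeastLessThanSuc insert_commute)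
  moreover have "id \<noteq> Transposition.transpose 0 (1::nat)" by (auto dest: fun_cong[of _ _ 0])
  moreover have "{0..<2::nat} = {0,1}" by auto
  ultimately show ?thesis using assms by (simp add: det_def' sign_swap_id)
qed

definition sum_dominated :: "nat \<Rightarrow> complex \<Rightarrow> bool" where
  "sum_dominated n c \<longleftrightarrow> (\<forall>A B as bs. A \<in> carrier_mat n n \<longrightarrow> B \<in> carrier_mat n n \<longrightarrow>
     mat_adjoint A = A \<longrightarrow> mat_adjoint B = B \<longrightarrow>
     char_poly A = (\<Prod>a\<leftarrow>as. [:- a, 1:]) \<longrightarrow> char_poly B = (\<Prod>b\<leftarrow>bs. [:- b, 1:]) \<longrightarrow>
     dominated (det (A + B - c \<cdot>\<^sub>m 1\<^sub>m n)) (pairing_prods (map (\<lambda>a. a - c) as) bs))"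

lemma sum_dominatedD:
  assumes "sum_dominated n c" "A \<in> carrier_mat n n" "B \<in> carrier_mat n n"
    "mat_adjoint A = A" "mat_adjoint B = B"
    "char_poly A = (\<Prod>a\<leftarrow>as. [:- a, 1:])" "char_poly B = (\<Prod>b\<leftarrow>bs. [:- b, 1:])"
  shows "dominated (det (A + B - c \<cdot>\<^sub>m 1\<^sub>m n)) (pairing_prods (map (\<lambda>a. a - c) as) bs)"
  using assms unfolding sum_dominated_def by blast

lemma length_linear_factors:
  fixes A :: "complex mat"
  assumes "A \<in> carrier_mat n n" "char_poly A = (\<Prod>a\<leftarrow>as. [:- a, 1:])"
  shows "length as = n"
proof -
  obtain cs where "char_poly A = (\<Prod>a\<leftarrow>cs. [:- a, 1:])" "length cs = n"
    using char_poly_factorized[OF assms(1)] by auto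
  then show ?thesis using mset_eq_of_linear_factors[of as cs] assms(2) by (metis mset_eq_length)
qed

text \<open>The determinant is the product over the blocks, and concatenating pairings of the blocks
  gives pairings of the whole. By unique factorization \<open>as\<close> and \<open>bs\<close> are
  rearrangements of the concatenated lists.\<close>

lemma sum_dominated_block_diag:
  fixes A1 B1 A2 B2 :: "complex mat"
  assumes k: "sum_dominated k c" and m: "sum_dominated m c"
    and C: "A1 \<in> carrier_mat k k" "B1 \<in> carrier_mat k k" "A2 \<in> carrier_mat m m" "B2 \<in> carrier_mat m m"
    and A: "A = four_block_mat A1 (0\<^sub>m k m) (0\<^sub>m m k) A2" "mat_adjoint A = A" "char_poly A = (\<Prod>a\<leftarrow>as. [:- a, 1:])"
    and B: "B = four_block_mat B1 (0\<^sub>m k m) (0\<^sub>m m k) B2" "mat_adjoint B = B" "char_poly B = (\<Prod>b\<leftarrow>bs. [:- b, 1:])"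
  shows "dominated (det (A + B - c \<cdot>\<^sub>m 1\<^sub>m (k + m))) (pairing_prods (map (\<lambda>a. a - c) as) bs)"
proof -
  have herm: "mat_adjoint D1 = D1 \<and> mat_adjoint D2 = D2"
    if D: "D = four_block_mat D1 (0\<^sub>m k m) (0\<^sub>m m k) D2" "mat_adjoint D = D"
      "D1 \<in> carrier_mat k k" "D2 \<in> carrier_mat m m" for D D1 D2 :: "complex mat"
  proof -
    have idx: "cnj (D $$ (j,i)) = D $$ (i,j)" if "i < k + m" "j < k + m" for i j
    proof -
      have DC: "dim_row D = k + m" "dim_col D = k + m" unfolding D(1) using D(3,4) by simp_all
      have "D $$ (i,j) = mat_adjoint D $$ (i,j)" by (simp only: D(2))
      also have "\<dots> = cnj (D $$ (j,i))" using that DC by simp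
      finally show ?thesis ..
    qed
    show ?thesis
    proof (intro conjI eq_matI)
      fix i j assume "i < dim_row D1" "j < dim_col D1"
      then show "mat_adjoint D1 $$ (i,j) = D1 $$ (i,j)" using idx[of i j] D(3,4) unfolding D(1) by simp
    next
      fix i j assume "i < dim_row D2" "j < dim_col D2"
      then show "mat_adjoint D2 $$ (i,j) = D2 $$ (i,j)" using idx[of "k + i" "k + j"] D(3,4) unfolding D(1) by simp
    qed (use D(3,4) in auto)
  qed
  note hA = herm[OF A(1,2) C(1,3)] and hB = herm[OF B(1,2) C(2,4)]
  from char_poly_factorized[OF C(1)] obtain as1 where as1: "char_poly A1 = (\<Prod>a\<leftarrow>as1. [:- a, 1:])" "length as1 = k" by auto
  from char_poly_factorized[OF C(2)] obtain bs1 where bs1: "char_poly B1 = (\<Prod>a\<leftarrow>bs1. [:- a, 1:])" "length bs1 = k" by auto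
  from char_poly_factorized[OF C(3)] obtain as2 where as2: "char_poly A2 = (\<Prod>a\<leftarrow>as2. [:- a, 1:])" "length as2 = m" by auto
  from char_poly_factorized[OF C(4)] obtain bs2 where bs2: "char_poly B2 = (\<Prod>a\<leftarrow>bs2. [:- a, 1:])" "length bs2 = m" by auto
  have "char_poly A = char_poly A1 * char_poly A2"
    by (rule char_poly_0_block[OF A(1) _ _ C(1) _ C(3)]) (use as1 as2 in auto)
  then have "(\<Prod>a\<leftarrow>as. [:- a, 1:]) = (\<Prod>a\<leftarrow>as1 @ as2. [:- a, 1:])" using A(3) as1 as2 by simp
  then have as: "mset as = mset (as1 @ as2)" by (rule mset_eq_of_linear_factors)
  have "char_poly B = char_poly B1 * char_poly B2"
    by (rule char_poly_0_block[OF B(1) _ _ C(2) _ C(4)]) (use bs1 bs2 in auto)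
  then have "(\<Prod>a\<leftarrow>bs. [:- a, 1:]) = (\<Prod>a\<leftarrow>bs1 @ bs2. [:- a, 1:])" using B(3) bs1 bs2 by simp
  then have bs: "mset bs = mset (bs1 @ bs2)" by (rule mset_eq_of_linear_factors)
  have "A + B - c \<cdot>\<^sub>m 1\<^sub>m (k + m) =
    four_block_mat (A1 + B1 - c \<cdot>\<^sub>m 1\<^sub>m k) (0\<^sub>m k m) (0\<^sub>m m k) (A2 + B2 - c \<cdot>\<^sub>m 1\<^sub>m m)"
    unfolding A(1) B(1) using C by (intro eq_matI) auto
  then have det: "det (A + B - c \<cdot>\<^sub>m 1\<^sub>m (k + m)) = det (A1 + B1 - c \<cdot>\<^sub>m 1\<^sub>m k) * det (A2 + B2 - c \<cdot>\<^sub>m 1\<^sub>m m)"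
    by (simp only:) (rule det_four_block_mat_lower_left_zero, use C in \<open>auto intro: minus_carrier_mat\<close>)
  have pp: "pairing_prods (map (\<lambda>a. a - c) as) bs =
    pairing_prods (map (\<lambda>a. a - c) as1 @ map (\<lambda>a. a - c) as2) (bs1 @ bs2)"
  proof (rule pairing_prods_mset)
    show "length (map (\<lambda>a. a - c) as) = length bs"
      using as1(2) bs1(2) as2(2) bs2(2) mset_eq_length[OF as] mset_eq_length[OF bs] by simp
  qed (simp_all add: as bs)
  note d1 = sum_dominatedD[OF k C(1,2) conjunct1[OF hA] conjunct1[OF hB] as1(1) bs1(1)]
  note d2 = sum_dominatedD[OF m C(3,4) conjunct2[OF hA] conjunct2[OF hB] as2(1) bs2(1)]
  show ?thesis
    unfolding det pp
    by (rule dominated_mult[OF d1 d2], rule pairing_prods_append)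
      (simp_all add: as1(2) bs1(2) as2(2) bs2(2))
qed

text \<open>A non-scalar Hermitian \<open>Z\<close> has two different eigenvalues. In an eigenbasis
  of \<open>Z\<close>, whatever commutes with \<open>Z\<close> is block diagonal with respect to one
  eigenvalue against all others, and both blocks are smaller than \<open>n\<close>.\<close>

lemma sum_dominated_reducible:
  assumes IH: "\<And>m. m < n \<Longrightarrow> sum_dominated m c"
    and A: "A \<in> carrier_mat n n" "mat_adjoint A = A" "char_poly A = (\<Prod>a\<leftarrow>as. [:- a, 1:])"
    and B: "B \<in> carrier_mat n n" "mat_adjoint B = B" "char_poly B = (\<Prod>b\<leftarrow>bs. [:- b, 1:])"
    and Z: "Z \<in> carrier_mat n n" "mat_adjoint Z = Z" "Z * A = A * Z" "Z * B = B * Z"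
    and nonscalar: "\<nexists>\<zeta>. Z = \<zeta> \<cdot>\<^sub>m 1\<^sub>m n"
  shows "dominated (det (A + B - c \<cdot>\<^sub>m 1\<^sub>m n)) (pairing_prods (map (\<lambda>a. a - c) as) bs)"
proof -
  obtain zs where zs: "char_poly Z = (\<Prod>a\<leftarrow>zs. [:- a, 1:])" "length zs = n"
    using char_poly_factorized[OF Z(1)] by auto
  define z0 where "z0 = hd zs"
  \<comment> \<open>All copies of one eigenvalue are moved to the front; the spectral theorem
    realizes this order.\<close>
  define ys where "ys = filter (\<lambda>z. z = z0) zs"
  define ws where "ws = filter (\<lambda>z. z \<noteq> z0) zs"
  have "(\<Prod>a\<leftarrow>zs. [:- a, 1:]) = (\<Prod>a\<leftarrow>ys @ ws. [:- a, 1:])"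
    unfolding prod_mset_prod_list[symmetric] mset_map by (simp add: ys_def ws_def)
  then have cpZ: "char_poly Z = (\<Prod>a\<leftarrow>ys @ ws. [:- a, 1:])" using zs by simp
  from hermitian_spectral[OF Z(1,2) cpZ] obtain T where len: "length (ys @ ws) = n" and T: "unitary_mat n T"
    and ZT: "Z = T * mat_diag n (\<lambda>i. (ys @ ws) ! i) * mat_adjoint T" by auto
  note TC = unitary_mat_carrier[OF T]
  define k m where "k = length ys" and "m = length ws"
  have n: "n = k + m" using len by (simp add: k_def m_def)
  have n0: "n \<noteq> 0"
  proof
    assume "n = 0"
    then have "Z = 0 \<cdot>\<^sub>m 1\<^sub>m n" using Z(1) by (intro eq_matI) auto
    then show False using nonscalar by blast
  qed
  have ys: "ys ! i = z0" if "i < k" for i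
    using nth_mem[of i ys] that by (auto simp: k_def ys_def)
  have ws: "ws ! i \<noteq> z0" if "i < m" for i
    using nth_mem[of i ws] that by (auto simp: m_def ws_def)
  have k0: "k \<noteq> 0"
  proof -
    have "z0 \<in> set ys" using n0 zs(2) by (auto simp: ys_def z0_def)
    then show ?thesis by (auto simp: k_def)
  qed
  have m0: "m \<noteq> 0"
  proof
    assume "m = 0"
    then have "mat_diag n (\<lambda>i. (ys @ ws) ! i) = z0 \<cdot>\<^sub>m 1\<^sub>m n"
      using n ys by (intro eq_matI) (auto simp: mat_diag_def nth_append k_def)
    then have "Z = z0 \<cdot>\<^sub>m 1\<^sub>m n" unfolding ZT by (simp add: unitary_conj_smult_one[OF T])
    then show False using nonscalar by blast
  qed
  define z where "z i = (ys @ ws) ! i" for i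
  have z: "z i \<noteq> z j" if "i < k" "k \<le> j" "j < k + m" for i j
  proof -
    have "z i = z0" using ys[OF that(1)] that(1) by (simp add: z_def nth_append k_def)
    moreover have "z j = ws ! (j - k)" using that by (simp add: z_def nth_append k_def)
    moreover have "j - k < m" using that by linarith
    ultimately show ?thesis using ws[of "j - k"] by metis
  qed
  define D where "D M = mat_adjoint T * M * T" for M
  have DC: "D M \<in> carrier_mat n n" if "M \<in> carrier_mat n n" for M
    using that TC by (simp add: D_def mult_carrier_mat[of _ n n _ n])
  have TD: "T * D M * mat_adjoint T = M" if "M \<in> carrier_mat n n" for M
    unfolding D_def by (rule unitary_conj_cancel(1)[OF T that])
  have DH: "mat_adjoint (D M) = D M" if "M \<in> carrier_mat n n" "mat_adjoint M = M" for M
    using adjoint_conj[of "mat_adjoint T" n M] TC that by (simp add: D_def)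
  have Dcp: "char_poly (D M) = char_poly M" if "M \<in> carrier_mat n n" for M
    using char_poly_unitary_conj[OF T DC[OF that]] TD[OF that] by simp
  have Dcomm: "D M * mat_diag n z = mat_diag n z * D M" if M: "M \<in> carrier_mat n n" "Z * M = M * Z" for M
  proof -
    have DZ: "D Z = mat_diag n z"
      unfolding D_def ZT z_def[abs_def] by (rule unitary_conj_cancel(2)[OF T]) simp
    have mul: "D P * D Q = D (P * Q)" if "P \<in> carrier_mat n n" "Q \<in> carrier_mat n n" for P Q
      using unitary_conj_mult[OF unitary_mat_adjoint[OF T] that] by (simp add: D_def)
    show ?thesis unfolding DZ[symmetric] using mul[OF M(1) Z(1)] mul[OF Z(1) M(1)] M(2) by simp
  qed
  have block: "D M = four_block_mat (mat k k (\<lambda>(i,j). D M $$ (i,j))) (0\<^sub>m k m) (0\<^sub>m m k)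
    (mat m m (\<lambda>(i,j). D M $$ (k + i, k + j)))" if M: "M \<in> carrier_mat n n" "Z * M = M * Z" for M
    by (rule commuting_diag_block_form[where z = z])
      (use DC[OF M(1)] Dcomm[OF M] z n in auto)
  have "dominated (det (D A + D B - c \<cdot>\<^sub>m 1\<^sub>m (k + m))) (pairing_prods (map (\<lambda>a. a - c) as) bs)"
    by (rule sum_dominated_block_diag[OF IH IH _ _ _ _ block[OF A(1) Z(3)] _ _ block[OF B(1) Z(4)]])
      (use n k0 m0 A B DH Dcp in auto)
  moreover have "det (D A + D B - c \<cdot>\<^sub>m 1\<^sub>m n) = det (A + B - c \<cdot>\<^sub>m 1\<^sub>m n)"
    using det_sum_unitary_conj[OF T DC[OF A(1)] DC[OF B(1)], of c] TD A B by simp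
  ultimately show ?thesis using n by simp
qed

section \<open>Dimensions zero, one and two\<close>

lemma sum_dominated_0: "sum_dominated 0 c"
  unfolding sum_dominated_def
proof (intro allI impI)
  fix A B :: "complex mat" and as bs
  assume A: "A \<in> carrier_mat 0 0" "char_poly A = (\<Prod>a\<leftarrow>as. [:- a, 1:])"
    and B: "B \<in> carrier_mat 0 0" "char_poly B = (\<Prod>b\<leftarrow>bs. [:- b, 1:])"
  have "as = []" "bs = []"
    using length_linear_factors[OF A] length_linear_factors[OF B] by auto
  then show "dominated (det (A + B - c \<cdot>\<^sub>m 1\<^sub>m 0)) (pairing_prods (map (\<lambda>a. a - c) as) bs)"
    using det_dim_zero[of "A + B - c \<cdot>\<^sub>m 1\<^sub>m 0"] A B
    by (intro dominated_mem) (simp add: pairing_prods_def minus_carrier_mat)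
qed

lemma char_poly_1_by_1:
  assumes "A \<in> carrier_mat 1 1"
  shows "char_poly A = [:- A $$ (0,0), 1 :: complex:]"
proof -
  have "char_poly A = (\<Prod>a\<leftarrow>diag_mat A. [:- a, 1:])"
    by (rule char_poly_upper_triangular[OF assms]) (use assms in auto)
  then show ?thesis using assms by (simp add: diag_mat_def)
qed

lemma sum_dominated_1: "sum_dominated 1 c"
  unfolding sum_dominated_def
proof (intro allI impI)
  fix A B :: "complex mat" and as bs
  assume A: "A \<in> carrier_mat 1 1" "char_poly A = (\<Prod>a\<leftarrow>as. [:- a, 1:])"
    and B: "B \<in> carrier_mat 1 1" "char_poly B = (\<Prod>b\<leftarrow>bs. [:- b, 1:])"
  have "mset as = mset [A $$ (0,0)]" "mset bs = mset [B $$ (0,0)]"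
    by (rule mset_eq_of_linear_factors, use A B char_poly_1_by_1[OF A(1)] char_poly_1_by_1[OF B(1)] in simp)+
  then have "as = [A $$ (0,0)]" "bs = [B $$ (0,0)]" by (simp_all only: mset_single_iff mset.simps mset_single_iff_right)
  moreover have "det (A + B - c \<cdot>\<^sub>m 1\<^sub>m 1) = A $$ (0,0) - c + B $$ (0,0)"
    using A B by (subst det_single) auto
  ultimately show "dominated (det (A + B - c \<cdot>\<^sub>m 1\<^sub>m 1)) (pairing_prods (map (\<lambda>a. a - c) as) bs)"
    by (intro dominated_mem) (auto simp: pairing_prods_def)
qed

lemma dominated_convex_combination:
  assumes "q1 \<in> Q" "q2 \<in> Q" "0 \<le> t" "t \<le> 1"
  shows "dominated (of_real t * q1 + of_real (1 - t) * q2) Q"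
  unfolding dominated_def
proof
  fix e
  have "Re (e * (of_real t * q1 + of_real (1 - t) * q2)) = t * Re (e * q1) + (1 - t) * Re (e * q2)"
    by (simp add: algebra_simps)
  also have "\<dots> \<le> max (Re (e * q1)) (Re (e * q2))"
    by (rule convex_bound_le) (use assms in auto)
  finally show "\<exists>q\<in>Q. Re (e * (of_real t * q1 + of_real (1 - t) * q2)) \<le> Re (e * q)"
    using assms(1,2) by (auto simp: max_def split: if_splits)
qed

text \<open>In an eigenbasis of \<open>A\<close> the diagonal of \<open>B'\<close> is affine in
  \<open>t\<close>, the squared modulus of an entry of the transition matrix, and the product of the
  off-diagonal entries follows from \<open>det B' = b1 * b2\<close>. The terms quadratic in
  \<open>t\<close> cancel, which leaves a convex combination of the two pairing products.\<close>

lemma sum_dominated_2: "sum_dominated 2 c"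
  unfolding sum_dominated_def
proof (intro allI impI)
  fix A B :: "complex mat" and as bs
  assume A: "A \<in> carrier_mat 2 2" "mat_adjoint A = A" "char_poly A = (\<Prod>a\<leftarrow>as. [:- a, 1:])"
    and B: "B \<in> carrier_mat 2 2" "mat_adjoint B = B" "char_poly B = (\<Prod>b\<leftarrow>bs. [:- b, 1:])"
  from hermitian_spectral[OF A] obtain U where U: "unitary_mat 2 U" and las: "length as = 2"
    and AU: "A = U * mat_diag 2 (\<lambda>i. as ! i) * mat_adjoint U" by auto
  from hermitian_spectral[OF B] obtain W where W: "unitary_mat 2 W" and lbs: "length bs = 2"
    and BW: "B = W * mat_diag 2 (\<lambda>i. bs ! i) * mat_adjoint W" by auto
  obtain a1 a2 where as: "as = [a1, a2]" using las by (auto simp: length_Suc_conv numeral_2_eq_2)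
  obtain b1 b2 where bs: "bs = [b1, b2]" using lbs by (auto simp: length_Suc_conv numeral_2_eq_2)
  define V where "V = mat_adjoint U * W"
  have V: "unitary_mat 2 V" unfolding V_def by (intro unitary_mat_mult unitary_mat_adjoint U W)
  note VC = unitary_mat_carrier[OF V]
  let ?Da = "mat_diag 2 (\<lambda>i. as ! i)" and ?Db = "mat_diag 2 (\<lambda>i. bs ! i)"
  define B' where "B' = V * ?Db * mat_adjoint V"
  have B'C: "B' \<in> carrier_mat 2 2" using VC by (simp add: B'_def mult_carrier_mat[of _ 2 2 _ 2])
  have "B' = mat_adjoint U * B * U"
    unfolding B'_def V_def BW using unitary_mat_carrier[OF U] unitary_mat_carrier[OF W]
    by (simp add: adjoint_mult[of _ 2 2 _ 2] mult_carrier_mat[of _ 2 2 _ 2] assoc_mult_mat[of _ 2 2 _ 2 _ 2])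
  then have "B = U * B' * mat_adjoint U" using unitary_conj_cancel(1)[OF U B(1)] by simp
  then have det: "det (A + B - c \<cdot>\<^sub>m 1\<^sub>m 2) = det (?Da + B' - c \<cdot>\<^sub>m 1\<^sub>m 2)"
    unfolding AU using det_sum_unitary_conj[OF U mat_diag_dim B'C] by simp
  define t where "t = (cmod (V $$ (0,0)))\<^sup>2"
  have t: "0 \<le> t" "t \<le> 1" using unitary_entry_le_1[OF V, of 0 0] by (auto simp: t_def power_le_one)
  have sq: "V $$ (i,j) * cnj (V $$ (i,j)) = of_real ((cmod (V $$ (i,j)))\<^sup>2)" for i j
    by (rule complex_norm_square[symmetric])
  have row: "V $$ (0,0) * cnj (V $$ (0,0)) + V $$ (0,1) * cnj (V $$ (0,1)) = 1"
  proof -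
    have "(V * mat_adjoint V) $$ (0,0) = 1" by (simp add: unitary_mat_right[OF V])
    then show ?thesis using VC by (simp add: scalar_prod_def numeral_2_eq_2)
  qed
  have col: "V $$ (0,0) * cnj (V $$ (0,0)) + V $$ (1,0) * cnj (V $$ (1,0)) = 1"
    "V $$ (0,1) * cnj (V $$ (0,1)) + V $$ (1,1) * cnj (V $$ (1,1)) = 1"
  proof -
    have "(mat_adjoint V * V) $$ (0,0) = 1" "(mat_adjoint V * V) $$ (1,1) = 1" by (simp_all add: unitary_mat_left[OF V])
    then show "V $$ (0,0) * cnj (V $$ (0,0)) + V $$ (1,0) * cnj (V $$ (1,0)) = 1"
      "V $$ (0,1) * cnj (V $$ (0,1)) + V $$ (1,1) * cnj (V $$ (1,1)) = 1"
      using VC by (simp_all add: scalar_prod_def numeral_2_eq_2 mult.commute)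
  qed
  have v00: "V $$ (0,0) * cnj (V $$ (0,0)) = of_real t" by (simp only: sq t_def)
  have v: "V $$ (0,1) * cnj (V $$ (0,1)) = 1 - of_real t" "V $$ (1,0) * cnj (V $$ (1,0)) = 1 - of_real t"
    using row col v00 by (simp_all add: algebra_simps)
  have v11: "V $$ (1,1) * cnj (V $$ (1,1)) = of_real t"
    using col(2) unfolding v(1) by (simp add: algebra_simps)
  have B'ii: "B' $$ (i,i) = V $$ (i,0) * cnj (V $$ (i,0)) * b1 + V $$ (i,1) * cnj (V $$ (i,1)) * b2" if "i < 2" for i
    unfolding B'_def using that
    by (subst triple_product_index[OF VC mat_diag_dim]) (simp_all add: mat_diag_def bs numeral_2_eq_2 algebra_simps)
  have p: "B' $$ (0,0) = of_real t * b1 + of_real (1 - t) * b2" using B'ii[of 0] by (simp add: v00 v del: One_nat_def)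
  have r: "B' $$ (1,1) = of_real (1 - t) * b1 + of_real t * b2" using B'ii[of 1] by (simp add: v v11 del: One_nat_def)
  have "det B' = det ?Db" unfolding B'_def by (rule det_unitary_conj[OF V mat_diag_dim])
  then have "B' $$ (0,1) * B' $$ (1,0) = B' $$ (0,0) * B' $$ (1,1) - b1 * b2"
    using det_2_by_2[OF B'C] det_2_by_2[OF mat_diag_dim, of "\<lambda>i. bs ! i"]
    by (simp add: mat_diag_def bs) (simp add: algebra_simps)
  moreover have "det (?Da + B' - c \<cdot>\<^sub>m 1\<^sub>m 2) =
      (a1 + B' $$ (0,0) - c) * (a2 + B' $$ (1,1) - c) - B' $$ (0,1) * B' $$ (1,0)"
    using B'C by (subst det_2_by_2) (auto simp: mat_diag_def as)
  ultimately have "det (?Da + B' - c \<cdot>\<^sub>m 1\<^sub>m 2) =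
     of_real t * ((a1 - c + b1) * (a2 - c + b2)) + of_real (1 - t) * ((a1 - c + b2) * (a2 - c + b1))"
    unfolding p r by (simp add: algebra_simps)
  moreover have "(a1 - c + b1) * (a2 - c + b2) \<in> pairing_prods (map (\<lambda>a. a - c) as) bs"
    "(a1 - c + b2) * (a2 - c + b1) \<in> pairing_prods (map (\<lambda>a. a - c) as) bs"
    unfolding pairing_prods_def as bs
    by (rule CollectI, rule exI[of _ "[b1, b2]"], simp, rule CollectI, rule exI[of _ "[b2, b1]"], simp)
  ultimately show "dominated (det (A + B - c \<cdot>\<^sub>m 1\<^sub>m 2)) (pairing_prods (map (\<lambda>a. a - c) as) bs)"
    unfolding det using dominated_convex_combination[OF _ _ t] by simp
qed

text \<open>The commutant of Hermitian matrices is closed under adjoints, so with \<open>Y\<close>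
  it contains the Hermitian matrices \<open>P\<close> and \<open>Q\<close>. They cannot both be
  scalar, as \<open>Y = (P - \<i> Q) / 2\<close>.\<close>

lemma nonscalar_commuting_hermitian:
  assumes A: "A \<in> carrier_mat n n" "mat_adjoint A = A"
    and B: "B \<in> carrier_mat n n" "mat_adjoint B = B"
    and "\<not> irreducible_pair n A B"
  obtains Z where "Z \<in> carrier_mat n n" "mat_adjoint Z = Z" "Z * A = A * Z" "Z * B = B * Z" "\<nexists>\<zeta>. Z = \<zeta> \<cdot>\<^sub>m 1\<^sub>m n"
proof -
  from assms(5) obtain Y where Y: "Y \<in> carrier_mat n n" "Y * A = A * Y" "Y * B = B * Y"
    and ns: "\<nexists>\<zeta>. Y = \<zeta> \<cdot>\<^sub>m 1\<^sub>m n" unfolding irreducible_pair_def by blast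
  define Y' where "Y' = mat_adjoint Y"
  have Y'C: "Y' \<in> carrier_mat n n" using Y by (simp add: Y'_def)
  have Y': "Y' * M = M * Y'" if M: "M \<in> carrier_mat n n" "mat_adjoint M = M" "Y * M = M * Y" for M
  proof -
    have "mat_adjoint (Y * M) = mat_adjoint (M * Y)" using M by simp
    then show ?thesis using adjoint_mult[OF Y(1) M(1)] adjoint_mult[OF M(1) Y(1)] M by (simp add: Y'_def)
  qed
  define P where "P = Y + Y'"
  define Q where "Q = \<i> \<cdot>\<^sub>m (Y - Y')"
  have C: "P \<in> carrier_mat n n" "Q \<in> carrier_mat n n" using Y Y'C by (auto simp: P_def Q_def)
  have P: "mat_adjoint P = P"
    by (rule eq_matI) (use Y in \<open>auto simp: P_def Y'_def\<close>)
  have Q: "mat_adjoint Q = Q"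
    by (rule eq_matI) (use Y in \<open>auto simp: Q_def Y'_def algebra_simps\<close>)
  have YY: "Y - Y' \<in> carrier_mat n n" by (rule minus_carrier_mat[OF Y'C])
  have comm: "P * M = M * P" "Q * M = M * Q" if M: "M \<in> carrier_mat n n" "mat_adjoint M = M" "Y * M = M * Y" for M
    unfolding P_def Q_def using M Y(1) Y'C Y'[OF M] YY
    by (simp_all add: add_mult_distrib_mat[of _ n n _ _ n] mult_add_distrib_mat[of _ n n _ n]
        minus_mult_distrib_mat[of _ n n _ _ n] mult_minus_distrib_mat[of _ n n _ n]
        mult_smult_distrib[of _ n n _ n] mult_smult_assoc_mat[of _ n n _ n])
  show ?thesis
  proof (cases "\<exists>\<zeta>. P = \<zeta> \<cdot>\<^sub>m 1\<^sub>m n")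
    case False
    then show ?thesis using that[OF C(1) P comm(1)[OF A Y(2)] comm(1)[OF B Y(3)]] by blast
  next
    case True
    then obtain \<zeta> where \<zeta>: "P = \<zeta> \<cdot>\<^sub>m 1\<^sub>m n" ..
    have "\<nexists>\<xi>. Q = \<xi> \<cdot>\<^sub>m 1\<^sub>m n"
    proof
      assume "\<exists>\<xi>. Q = \<xi> \<cdot>\<^sub>m 1\<^sub>m n"
      then obtain \<xi> where \<xi>: "Q = \<xi> \<cdot>\<^sub>m 1\<^sub>m n" ..
      have "Y = ((\<zeta> - \<i> * \<xi>) / 2) \<cdot>\<^sub>m 1\<^sub>m n"
      proof (rule eq_matI)
        fix i j assume "i < dim_row (((\<zeta> - \<i> * \<xi>) / 2) \<cdot>\<^sub>m 1\<^sub>m n)" "j < dim_col (((\<zeta> - \<i> * \<xi>) / 2) \<cdot>\<^sub>m 1\<^sub>m n)"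
        then have ij: "i < n" "j < n" by auto
        have "Y $$ (i,j) = (P $$ (i,j) - \<i> * Q $$ (i,j)) / 2"
          using ij Y(1) Y'C by (simp add: P_def Q_def algebra_simps)
        then show "Y $$ (i,j) = (((\<zeta> - \<i> * \<xi>) / 2) \<cdot>\<^sub>m 1\<^sub>m n) $$ (i,j)"
          using ij by (simp add: \<zeta> \<xi>)
      qed (use Y in auto)
      then show False using ns by blast
    qed
    then show ?thesis using that[OF C(2) Q comm(2)[OF A Y(2)] comm(2)[OF B Y(3)]] by blast
  qed
qed

text \<open>In direction \<open>e\<close> the given determinant lies below that of the maximizing
  pair, which splits and is bounded by induction. Conjugating \<open>B\<close> preserves its
  spectrum, so both are compared with the same set of pairing products.\<close>

lemma sum_dominated_step:
  assumes IH: "\<And>m. m < n \<Longrightarrow> sum_dominated m c" and n: "n \<ge> 3" and c: "Im c \<noteq> 0"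
  shows "sum_dominated n c"
  unfolding sum_dominated_def
proof (intro allI impI)
  fix A B :: "complex mat" and as bs
  assume A: "A \<in> carrier_mat n n" and B: "B \<in> carrier_mat n n"
    and hA: "mat_adjoint A = A" and hB: "mat_adjoint B = B"
    and as: "char_poly A = (\<Prod>a\<leftarrow>as. [:- a, 1:])" and bs: "char_poly B = (\<Prod>b\<leftarrow>bs. [:- b, 1:])"
  let ?Q = "pairing_prods (map (\<lambda>a. a - c) as) bs"
  show "dominated (det (A + B - c \<cdot>\<^sub>m 1\<^sub>m n)) ?Q"
    unfolding dominated_def
  proof
    fix e :: complex
    show "\<exists>q\<in>?Q. Re (e * det (A + B - c \<cdot>\<^sub>m 1\<^sub>m n)) \<le> Re (e * q)"
    proof (cases "e = 0")
      case True
      then show ?thesis using pairing_prods_nonempty[of "map (\<lambda>a. a - c) as" bs] by auto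
    next
      case e: False
      obtain V where V: "unitary_mat n V"
        and max: "\<And>U. unitary_mat n U \<Longrightarrow>
          Re (e * det (A + U * B * mat_adjoint U - c \<cdot>\<^sub>m 1\<^sub>m n)) \<le>
          Re (e * det (A + V * B * mat_adjoint V - c \<cdot>\<^sub>m 1\<^sub>m n))"
        by (rule unitary_maximum_exists[OF A B]) (rule that)
      note VC = unitary_mat_carrier[OF V]
      define B' where "B' = V * B * mat_adjoint V"
      have B': "B' \<in> carrier_mat n n" using VC B by (simp add: B'_def mult_carrier_mat[of _ n n _ n])
      have hB': "mat_adjoint B' = B'" unfolding B'_def by (simp add: adjoint_conj[OF VC B] hB)
      have hS: "mat_adjoint (A + B') = A + B'" using adjoint_add[OF A B'] hA hB' by simp
      have SC: "A + B' \<in> carrier_mat n n" using A B' by simp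
      obtain es where es: "char_poly (A + B') = (\<Prod>a\<leftarrow>es. [:- a, 1:])"
        using char_poly_factorized[OF SC] by auto
      from hermitian_spectral[OF SC hS es] obtain W where les: "length es = n" and W: "unitary_mat n W"
        and real: "\<forall>e\<in>set es. Im e = 0"
        and SW: "A + B' = W * mat_diag n (\<lambda>i. es ! i) * mat_adjoint W" by auto
      note WC = unitary_mat_carrier[OF W]
      define lam where "lam i = Re (es ! i)" for i
      define S where "S = mat_diag n (\<lambda>i. complex_of_real (lam i))"
      have SC': "S \<in> carrier_mat n n" by (simp add: S_def)
      have "mat_diag n (\<lambda>i. es ! i) = S"
        unfolding S_def mat_diag_def lam_def using real les
        by (intro cong_mat) (auto simp: complex_eq_iff)
      then have S: "A + B' = W * S * mat_adjoint W" using SW by simp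
      define B1 where "B1 = mat_adjoint W * B' * W"
      have B1: "B1 \<in> carrier_mat n n" using WC B' by (simp add: B1_def mult_carrier_mat[of _ n n _ n])
      have hB1: "mat_adjoint B1 = B1" using adjoint_conj[of "mat_adjoint W" n B'] WC B' hB' by (simp add: B1_def)
      have WB1: "B' = W * B1 * mat_adjoint W" unfolding B1_def using unitary_conj_cancel(1)[OF W B'] by simp
      define A1 where "A1 = S - B1"
      have A1: "A1 \<in> carrier_mat n n" using B1 by (simp add: A1_def minus_carrier_mat)
      have hSd: "mat_adjoint S = S" by (simp add: S_def adjoint_mat_diag)
      have hA1: "mat_adjoint A1 = A1" unfolding A1_def using adjoint_minus[OF SC' B1] hSd hB1 by simp
      have A1B1: "A1 + B1 = S" using B1 SC' by (intro eq_matI) (auto simp: A1_def)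
      have WA1: "A = W * A1 * mat_adjoint W"
      proof -
        have "W * A1 * mat_adjoint W = (A + B') - B'"
          unfolding A1_def unitary_conj_minus[OF WC SC' B1] S[symmetric] WB1[symmetric] ..
        also have "\<dots> = A" using A B' by (intro eq_matI) auto
        finally show ?thesis ..
      qed
      have max1: "Re (e * det (S - B1 + U * B1 * mat_adjoint U - c \<cdot>\<^sub>m 1\<^sub>m n)) \<le> Re (e * det (S - c \<cdot>\<^sub>m 1\<^sub>m n))"
        if U: "unitary_mat n U" for U
      proof -
        note UC = unitary_mat_carrier[OF U]
        \<comment> \<open>Conjugating \<open>B1\<close> by \<open>U\<close> in the eigenbasis of the
          sum amounts to conjugating \<open>B\<close> by this unitary matrix, so that maximality
          carries over.\<close>
        let ?R = "W * U * mat_adjoint W * V"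
        have R: "unitary_mat n ?R" by (intro unitary_mat_mult unitary_mat_adjoint U V W)
        have UB: "U * B1 * mat_adjoint U \<in> carrier_mat n n" using UC B1 by (simp add: mult_carrier_mat[of _ n n _ n])
        have "?R * B * mat_adjoint ?R = W * (U * B1 * mat_adjoint U) * mat_adjoint W"
          unfolding B1_def B'_def using WC UC VC B
          by (simp add: adjoint_mult[of _ n n _ n] mult_carrier_mat[of _ n n _ n] assoc_mult_mat[of _ n n _ n _ n])
        then have "det (A + ?R * B * mat_adjoint ?R - c \<cdot>\<^sub>m 1\<^sub>m n) = det (A1 + U * B1 * mat_adjoint U - c \<cdot>\<^sub>m 1\<^sub>m n)"
          using det_sum_unitary_conj[OF W A1 UB, of c] WA1 by simp
        moreover have "det (A + V * B * mat_adjoint V - c \<cdot>\<^sub>m 1\<^sub>m n) = det (S - c \<cdot>\<^sub>m 1\<^sub>m n)"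
          using det_sum_unitary_conj[OF W A1 B1, of c] WA1 WB1 A1B1 by (simp add: B'_def)
        ultimately show ?thesis using max[OF R] by (simp add: A1_def)
      qed
      have "\<not> irreducible_pair n S B1"
        using no_irreducible_maximum[OF B1 hB1 c e n max1[unfolded S_def]] unfolding S_def by blast
      from nonscalar_commuting_hermitian[OF SC' hSd B1 hB1 this] obtain Z
        where Z: "Z \<in> carrier_mat n n" "mat_adjoint Z = Z" "Z * S = S * Z" "Z * B1 = B1 * Z"
        and ns: "\<nexists>\<zeta>. Z = \<zeta> \<cdot>\<^sub>m 1\<^sub>m n" .
      have ZA: "Z * A1 = A1 * Z" unfolding A1_def using Z SC' B1
        by (simp add: minus_mult_distrib_mat[of _ n n _ _ n] mult_minus_distrib_mat[of _ n n _ n])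
      have as1: "char_poly A1 = (\<Prod>a\<leftarrow>as. [:- a, 1:])"
        using char_poly_unitary_conj[OF W A1] WA1 as by simp
      have bs1: "char_poly B1 = (\<Prod>b\<leftarrow>bs. [:- b, 1:])"
        using char_poly_unitary_conj[OF W B1] WB1 char_poly_unitary_conj[OF V B] bs by (simp add: B'_def)
      have "dominated (det (A1 + B1 - c \<cdot>\<^sub>m 1\<^sub>m n)) ?Q"
        by (rule sum_dominated_reducible[OF IH A1 hA1 as1 B1 hB1 bs1 Z(1,2) ZA Z(4) ns])
      then obtain q where q: "q \<in> ?Q" "Re (e * det (A1 + B1 - c \<cdot>\<^sub>m 1\<^sub>m n)) \<le> Re (e * q)"
        unfolding dominated_def by blast
      have "det (A1 + B1 - c \<cdot>\<^sub>m 1\<^sub>m n) = det (A + V * B * mat_adjoint V - c \<cdot>\<^sub>m 1\<^sub>m n)"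
        using det_sum_unitary_conj[OF W A1 B1, of c] WA1 WB1 by (simp add: B'_def)
      moreover have "Re (e * det (A + B - c \<cdot>\<^sub>m 1\<^sub>m n)) \<le> Re (e * det (A + V * B * mat_adjoint V - c \<cdot>\<^sub>m 1\<^sub>m n))"
        using max[OF unitary_mat_one] B by (simp add: right_mult_one_mat[of _ n n] left_mult_one_mat[of _ n n])
      ultimately have "Re (e * det (A + B - c \<cdot>\<^sub>m 1\<^sub>m n)) \<le> Re (e * q)"
        using q(2) by (metis order_trans)
      then show ?thesis using q(1) by blast
    qed
  qed
qed

lemma sum_dominated_nonreal: "Im c \<noteq> 0 \<Longrightarrow> sum_dominated n c"
proof (induction n rule: less_induct)
  case (less n)
  consider "n = 0" | "n = 1" | "n = 2" | "n \<ge> 3" by linarith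
  then show ?case
  proof cases
    case 4
    then show ?thesis using sum_dominated_step less by blast
  qed (use sum_dominated_0 sum_dominated_1 sum_dominated_2 in auto)
qed

section \<open>Passage from non-real to real shifts\<close>

lemma isCont_prod_list_pairing:
  "isCont (\<lambda>t::real. prod_list (map2 (+) (map (\<lambda>a. a - (c + \<i> * of_real t)) as) ys)) t0"
proof -
  have "map2 (+) (map (\<lambda>a. a - (c + \<i> * of_real t)) as) ys = map (\<lambda>(a,y). a - (c + \<i> * of_real t) + y) (zip as ys)" for t
    by (auto simp: zip_map1 split_def)
  moreover have "isCont (\<lambda>t::real. prod_list (map (\<lambda>(a,y). a - (c + \<i> * of_real t) + y) zs)) t0" for zs
    by (induction zs) (auto intro!: continuous_intros)
  ultimately show ?thesis by simp
qed

lemma isCont_det_shift: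
  fixes A :: "complex mat"
  assumes "A \<in> carrier_mat n n"
  shows "isCont (\<lambda>t::real. det (A - (c + \<i> * of_real t) \<cdot>\<^sub>m 1\<^sub>m n)) t0"
proof -
  have "det (A - (c + \<i> * of_real t) \<cdot>\<^sub>m 1\<^sub>m n) = (\<Sum>p | p permutes {0..<n}. signof p * (\<Prod>i = 0..<n.
      A $$ (i, p i) - (if i = p i then c + \<i> * of_real t else 0)))" for t :: real
  proof -
    have "p i < n" if "p permutes {0..<n}" "i < n" for p i
      using permutes_in_image[OF that(1), of i] that(2) by simp
    then show ?thesis
      using assms by (subst det_def'[of _ n]) (auto intro!: sum.cong prod.cong minus_carrier_mat)
  qed
  moreover have "isCont (\<lambda>t::real. \<Sum>p | p permutes {0..<n}. signof p * (\<Prod>i = 0..<n.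
      A $$ (i, p i) - (if i = p i then c + \<i> * of_real t else 0))) t0"
  proof (intro continuous_intros)
    fix p :: "nat \<Rightarrow> nat" and i
    show "isCont (\<lambda>t. if i = p i then c + \<i> * of_real t else 0) t0"
      by (cases "i = p i") (auto intro!: continuous_intros)
  qed
  ultimately show ?thesis by simp
qed

theorem sum_dominated_all: "sum_dominated n c"
proof (cases "Im c = 0")
  case real: True
  show ?thesis
    unfolding sum_dominated_def
  proof (intro allI impI)
    fix A B :: "complex mat" and as bs
    assume A: "A \<in> carrier_mat n n" and B: "B \<in> carrier_mat n n"
      and hA: "mat_adjoint A = A" and hB: "mat_adjoint B = B"
      and as: "char_poly A = (\<Prod>a\<leftarrow>as. [:- a, 1:])" and bs: "char_poly B = (\<Prod>b\<leftarrow>bs. [:- b, 1:])"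
    define D where "D t = det (A + B - (c + \<i> * of_real t) \<cdot>\<^sub>m 1\<^sub>m n)" for t :: real
    define P where "P ys t = prod_list (map2 (+) (map (\<lambda>a. a - (c + \<i> * of_real t)) as) ys)" for ys and t :: real
    define Y where "Y = {ys. mset ys = mset bs}"
    have pp: "pairing_prods (map (\<lambda>a. a - (c + \<i> * of_real t)) as) bs = {P ys t | ys. ys \<in> Y}" for t
      by (simp add: pairing_prods_def P_def Y_def)
    have "Y \<subseteq> {ys. set ys \<subseteq> set bs \<and> length ys = length bs}"
      unfolding Y_def by (auto dest: mset_eq_setD mset_eq_length)
    then have finY: "finite Y"
      by (rule finite_subset) (auto intro: finite_lists_length_eq)
    have AB: "A + B \<in> carrier_mat n n" using A B by simp
    have "dominated (D 0) {P ys 0 | ys. ys \<in> Y}"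
      unfolding dominated_def
    proof (rule allI, rule ccontr)
      \<comment> \<open>A strict violation at a real shift persists under all small imaginary
        perturbations \<open>t\<close>, uniformly because there are finitely many pairings; a
        nonzero such \<open>t\<close> contradicts the non-real case.\<close>
      fix e assume neg: "\<not> (\<exists>q\<in>{P ys 0 | ys. ys \<in> Y}. Re (e * D 0) \<le> Re (e * q))"
      have "\<forall>ys\<in>Y. eventually (\<lambda>t. 0 < Re (e * D t) - Re (e * P ys t)) (at 0)"
      proof
        fix ys assume "ys \<in> Y"
        then have pos: "0 < Re (e * D 0) - Re (e * P ys 0)" using neg by force
        have "isCont (\<lambda>t. Re (e * D t) - Re (e * P ys t)) 0"
          unfolding D_def[abs_def] P_def
          by (intro isCont_diff isCont_Re isCont_mult continuous_const isCont_det_shift[OF AB] isCont_prod_list_pairing)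
        then have "((\<lambda>t. Re (e * D t) - Re (e * P ys t)) \<longlongrightarrow> Re (e * D 0) - Re (e * P ys 0)) (at 0)"
          by (simp add: isCont_def)
        from order_tendstoD(1)[OF this pos]
        show "eventually (\<lambda>t. 0 < Re (e * D t) - Re (e * P ys t)) (at 0)" .
      qed
      then have "eventually (\<lambda>t. \<forall>ys\<in>Y. 0 < Re (e * D t) - Re (e * P ys t)) (at 0)"
        by (rule eventually_ball_finite[OF finY])
      then have "eventually (\<lambda>t. t \<noteq> 0 \<and> (\<forall>ys\<in>Y. 0 < Re (e * D t) - Re (e * P ys t))) (at 0)"
        by (intro eventually_conj eventually_neq_at_within)
      then obtain t :: real where t: "t \<noteq> 0" and less: "\<forall>ys\<in>Y. 0 < Re (e * D t) - Re (e * P ys t)"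
        using eventually_happens[of _ "at (0::real)"] by (auto simp: trivial_limit_at)
      have "sum_dominated n (c + \<i> * of_real t)"
        by (rule sum_dominated_nonreal) (simp add: real t)
      from sum_dominatedD[OF this A B hA hB as bs]
      have "dominated (D t) {P ys t | ys. ys \<in> Y}" unfolding pp D_def .
      then obtain ys where "ys \<in> Y" "Re (e * D t) \<le> Re (e * P ys t)" unfolding dominated_def by blast
      then show False using less by force
    qed
    then show "dominated (det (A + B - c \<cdot>\<^sub>m 1\<^sub>m n)) (pairing_prods (map (\<lambda>a. a - c) as) bs)"
      using pp[of 0] by (simp add: D_def)
  qed
qed (rule sum_dominated_nonreal)

section \<open>The matrices \<open>N(X, s)\<close>\<close>

lemma block_symmetric_similar:
  fixes P Q :: "complex mat"
  assumes P: "P \<in> carrier_mat n n" and Q: "Q \<in> carrier_mat n n"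
  shows "similar_mat (four_block_mat P Q Q P) (four_block_mat (P + Q) (0\<^sub>m n n) (0\<^sub>m n n) (P - Q))"
proof -
  define I where "I = (1\<^sub>m n :: complex mat)"
  define h where "h = (1/2 :: complex) \<cdot>\<^sub>m I"
  define h' where "h' = (- 1/2 :: complex) \<cdot>\<^sub>m I"
  have [simp]: "I \<in> carrier_mat n n" "h \<in> carrier_mat n n" "- I \<in> carrier_mat n n" "h' \<in> carrier_mat n n"
    by (auto simp: I_def h_def h'_def)
  have C: "P + Q \<in> carrier_mat n n" "P - Q \<in> carrier_mat n n" "- (P - Q) \<in> carrier_mat n n"
    using P Q by (auto intro: minus_carrier_mat)
  have Ih: "M * h = (1/2) \<cdot>\<^sub>m M" "M * h' = (- 1/2) \<cdot>\<^sub>m M" if "M \<in> carrier_mat n n" for M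
    using that by (auto simp: I_def h_def h'_def mult_smult_distrib[of _ n n _ n])
  \<comment> \<open>\<open>K\<close> is half of \<open>J\<close>, because the square of
    \<open>J\<close> is twice the identity.\<close>
  define J K where "J = four_block_mat I I I (- I)" and "K = four_block_mat h h h h'"
  let ?D = "four_block_mat (P + Q) (0\<^sub>m n n) (0\<^sub>m n n) (P - Q)"
  have JK: "J * K = 1\<^sub>m (n + n)" "K * J = 1\<^sub>m (n + n)"
  proof -
    have "J * K = four_block_mat (I * h + I * h) (I * h + I * h') (I * h + (- I) * h) (I * h + (- I) * h')"
      unfolding J_def K_def by (rule mult_four_block_mat[of _ n n _ n _ n _ _ n _ n]) auto
    also have "\<dots> = 1\<^sub>m (n + n)"
      by (subst four_block_one_mat[symmetric], rule cong_four_block_mat; rule eq_matI; simp add: I_def h_def h'_def)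
    finally show "J * K = 1\<^sub>m (n + n)" .
    then show "K * J = 1\<^sub>m (n + n)"
      by (rule mat_mult_left_right_inverse[rotated 2]) (auto simp: J_def K_def)
  qed
  have "J * ?D = four_block_mat (I * (P + Q) + I * 0\<^sub>m n n) (I * 0\<^sub>m n n + I * (P - Q))
      (I * (P + Q) + (- I) * 0\<^sub>m n n) (I * 0\<^sub>m n n + (- I) * (P - Q))"
    unfolding J_def by (rule mult_four_block_mat[of _ n n _ n _ n _ _ n _ n]) (use C in auto)
  also have "\<dots> = four_block_mat (P + Q) (P - Q) (P + Q) (- (P - Q))"
    using C by (intro cong_four_block_mat) (auto simp: I_def)
  finally have "J * ?D * K = four_block_mat (P + Q) (P - Q) (P + Q) (- (P - Q)) * K" by simp
  also have "\<dots> = four_block_mat ((P + Q) * h + (P - Q) * h) ((P + Q) * h + (P - Q) * h')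
      ((P + Q) * h + (- (P - Q)) * h) ((P + Q) * h + (- (P - Q)) * h')"
    unfolding K_def by (rule mult_four_block_mat[of _ n n _ n _ n _ _ n _ n]) (use C in auto)
  also have "\<dots> = four_block_mat P Q Q P"
    unfolding Ih[OF C(1)] Ih[OF C(2)] Ih[OF C(3)]
    using P Q by (intro cong_four_block_mat; intro eq_matI) (simp_all add: diff_divide_distrib add_divide_distrib)
  finally have eq: "four_block_mat P Q Q P = J * ?D * K" ..
  have JKC: "J \<in> carrier_mat (n + n) (n + n)" "K \<in> carrier_mat (n + n) (n + n)"
    by (simp_all add: J_def K_def)
  have "similar_mat_wit (four_block_mat P Q Q P) ?D J K"
    by (rule similar_mat_witI[OF JK eq]) (simp_all add: JKC P C)
  then show ?thesis unfolding similar_mat_def by blast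
qed

section \<open>Spectra and determinants of the two diagonal blocks\<close>

lemma char_poly_mat_diag: "char_poly (mat_diag n f) = (\<Prod>a\<leftarrow>map f [0..<n]. [:- a, 1 :: complex:])"
proof -
  have "char_poly (mat_diag n f) = (\<Prod>a\<leftarrow>diag_mat (mat_diag n f). [:- a, 1:])"
    by (rule char_poly_upper_triangular[OF mat_diag_dim]) (auto simp: mat_diag_def)
  moreover have "diag_mat (mat_diag n f) = map f [0..<n]"
    by (auto simp: diag_mat_def mat_diag_def)
  ultimately show ?thesis by simp
qed

lemma char_poly_affine:
  fixes A :: "complex mat"
  assumes A: "A \<in> carrier_mat n n" "mat_adjoint A = A" "char_poly A = (\<Prod>a\<leftarrow>as. [:- a, 1:])"
  shows "char_poly (k \<cdot>\<^sub>m A + d \<cdot>\<^sub>m 1\<^sub>m n) = (\<Prod>a\<leftarrow>map (\<lambda>a. k * a + d) as. [:- a, 1:])"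
proof -
  from hermitian_spectral[OF A] obtain U where U: "unitary_mat n U" and len: "length as = n"
    and AU: "A = U * mat_diag n (\<lambda>i. as ! i) * mat_adjoint U" by auto
  note UC = unitary_mat_carrier[OF U]
  let ?D = "mat_diag n (\<lambda>i. as ! i)" and ?E = "mat_diag n (\<lambda>i. k * as ! i + d)"
  have E: "?E = k \<cdot>\<^sub>m ?D + d \<cdot>\<^sub>m 1\<^sub>m n" by (rule eq_matI) (auto simp: mat_diag_def)
  have "U * (k \<cdot>\<^sub>m ?D) * mat_adjoint U = k \<cdot>\<^sub>m A"
    unfolding AU using UC by (simp add: mult_smult_distrib[of _ n n _ n] mult_smult_assoc_mat[of _ n n _ n] mult_carrier_mat[of _ n n _ n])
  then have "k \<cdot>\<^sub>m A + d \<cdot>\<^sub>m 1\<^sub>m n = U * ?E * mat_adjoint U"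
    unfolding E using UC by (simp add: unitary_conj_add unitary_conj_smult_one[OF U])
  then have "char_poly (k \<cdot>\<^sub>m A + d \<cdot>\<^sub>m 1\<^sub>m n) = char_poly ?E"
    using char_poly_unitary_conj[OF U mat_diag_dim] by simp
  also have "\<dots> = (\<Prod>a\<leftarrow>map (\<lambda>i. k * as ! i + d) [0..<n]. [:- a, 1:])" by (rule char_poly_mat_diag)
  also have "map (\<lambda>i. k * as ! i + d) [0..<n] = map (\<lambda>a. k * a + d) as"
    using len by (intro nth_equalityI) auto
  finally show ?thesis .
qed

definition herm_part :: "complex mat \<Rightarrow> complex mat" where
  "herm_part X = X + mat_adjoint X"

text \<open>The factor \<open>- \<i>\<close> makes the skew-Hermitian difference Hermitian, so that
  the result on Hermitian sums covers both diagonal blocks; it is compensated by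
  \<open>\<i> ^ n\<close> in the determinant.\<close>

definition skew_part :: "complex mat \<Rightarrow> complex mat" where
  "skew_part X = (- \<i>) \<cdot>\<^sub>m (X - mat_adjoint X)"

lemma herm_part:
  assumes "X \<in> carrier_mat n n"
  shows "herm_part X \<in> carrier_mat n n" "mat_adjoint (herm_part X) = herm_part X"
  using assms by (auto simp: herm_part_def intro!: eq_matI)

lemma skew_part:
  assumes "X \<in> carrier_mat n n"
  shows "skew_part X \<in> carrier_mat n n" "mat_adjoint (skew_part X) = skew_part X"
  using assms by (auto simp: skew_part_def algebra_simps intro!: eq_matI)

definition offdiag :: "complex mat \<Rightarrow> complex \<Rightarrow> complex mat" where
  "offdiag X s = mat_adjoint (X - s \<cdot>\<^sub>m 1\<^sub>m (dim_row X))"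

lemma N_eq: "N X s = four_block_mat X (offdiag X s) (offdiag X s) X"
  by (simp add: N_def offdiag_def Let_def)

lemma offdiag:
  assumes X: "X \<in> carrier_mat n n"
  shows "offdiag X s \<in> carrier_mat n n"
    and "X + offdiag X s = 1 \<cdot>\<^sub>m herm_part X + (- cnj s) \<cdot>\<^sub>m 1\<^sub>m n"
    and "X - offdiag X s = \<i> \<cdot>\<^sub>m skew_part X + cnj s \<cdot>\<^sub>m 1\<^sub>m n"
  using X by (auto simp: offdiag_def herm_part_def skew_part_def algebra_simps intro!: eq_matI)

lemma N_carrier: "X \<in> carrier_mat n n \<Longrightarrow> N X s \<in> carrier_mat (n + n) (n + n)"
  unfolding N_eq by auto

lemma mult_shift_mat:
  fixes P Q :: "complex mat"
  assumes "P \<in> carrier_mat n n" "Q \<in> carrier_mat n n"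
  shows "(P - p \<cdot>\<^sub>m 1\<^sub>m n) * (Q - q \<cdot>\<^sub>m 1\<^sub>m n) = P * Q - q \<cdot>\<^sub>m P - p \<cdot>\<^sub>m Q + (p * q) \<cdot>\<^sub>m 1\<^sub>m n"
proof -
  have "(P - p \<cdot>\<^sub>m 1\<^sub>m n) * (Q - q \<cdot>\<^sub>m 1\<^sub>m n) = P * Q - p \<cdot>\<^sub>m Q - q \<cdot>\<^sub>m (P - p \<cdot>\<^sub>m 1\<^sub>m n)"
    using assms
    by (simp add: minus_mult_distrib_mat[of _ n n _ _ n] mult_minus_distrib_mat[of _ n n _ n] minus_carrier_mat
        mult_smult_distrib[of _ n n _ n] mult_smult_assoc_mat[of _ n n _ n])
  also have "\<dots> = P * Q - q \<cdot>\<^sub>m P - p \<cdot>\<^sub>m Q + (p * q) \<cdot>\<^sub>m 1\<^sub>m n"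
    using assms by (intro eq_matI) (auto simp: right_diff_distrib simp del: index_mult_mat(1))
  finally show ?thesis .
qed

text \<open>The blocks are \<open>X\<close> and \<open>Z = Y - cnj s\<close>, with adjoints
  \<open>Y\<close> and \<open>W = X - s\<close>. On the diagonal, \<open>Z * W\<close> and
  \<open>W * Z\<close> have the same shift terms, and their quadratic terms \<open>Y * X\<close> and
  \<open>X * Y\<close> make up for the exchange of \<open>X * Y\<close> and \<open>Y * X\<close>.
  Off the diagonal, \<open>X\<close> commutes with \<open>W\<close> and \<open>Y\<close> with
  \<open>Z\<close>.\<close>

lemma normal_N:
  assumes X: "X \<in> carrier_mat n n"
  shows "normal_mat (N X s)"
proof -
  define Y where "Y = mat_adjoint X"
  have Y: "Y \<in> carrier_mat n n" using X by (simp add: Y_def)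
  define Z where "Z = Y - cnj s \<cdot>\<^sub>m 1\<^sub>m n"
  define W where "W = X - s \<cdot>\<^sub>m 1\<^sub>m n"
  have Z: "Z \<in> carrier_mat n n" and W: "W \<in> carrier_mat n n" by (auto simp: Z_def W_def minus_carrier_mat)
  have ZW: "offdiag X s = Z" "mat_adjoint Z = W"
    using X by (auto simp: offdiag_def Z_def Y_def W_def intro!: eq_matI)
  have "X = X - 0 \<cdot>\<^sub>m 1\<^sub>m n" "Y = Y - 0 \<cdot>\<^sub>m 1\<^sub>m n" using X Y by (auto intro!: eq_matI)
  note shift = mult_shift_mat[OF X Y, of s "cnj s"] mult_shift_mat[OF Y X, of "cnj s" s]
    mult_shift_mat[OF X X, of 0 s] mult_shift_mat[OF X X, of s 0]
    mult_shift_mat[OF Y Y, of 0 "cnj s"] mult_shift_mat[OF Y Y, of "cnj s" 0]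
  have e1: "X * Y + Z * W = Y * X + W * Z"
    unfolding Z_def W_def shift using X Y by (intro eq_matI) (auto simp del: index_mult_mat(1))
  have e2: "X * W + Z * Y = Y * Z + W * X"
  proof -
    have "X * W = X * X - s \<cdot>\<^sub>m X" "W * X = X * X - s \<cdot>\<^sub>m X" "Z * Y = Y * Y - cnj s \<cdot>\<^sub>m Y" "Y * Z = Y * Y - cnj s \<cdot>\<^sub>m Y"
      unfolding Z_def W_def using X Y
      by (simp_all add: minus_mult_distrib_mat[of _ n n _ _ n] mult_minus_distrib_mat[of _ n n _ n]
        mult_smult_distrib[of _ n n _ n] mult_smult_assoc_mat[of _ n n _ n])
    then show ?thesis using X Y by (simp add: comm_add_mat[of _ n n] minus_carrier_mat)
  qed
  have adjN: "mat_adjoint (N X s) = four_block_mat Y W W Y"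
    unfolding N_eq ZW using X Z by (simp add: adjoint_four_block[of _ n n _ n _ n] ZW Y_def)
  have "N X s * mat_adjoint (N X s) = four_block_mat (X * Y + Z * W) (X * W + Z * Y) (Z * Y + X * W) (Z * W + X * Y)"
    unfolding adjN unfolding N_eq ZW by (rule mult_four_block_mat[of _ n n _ n _ n _ _ n _ n]) (use X Y Z W in auto)
  moreover have "mat_adjoint (N X s) * N X s = four_block_mat (Y * X + W * Z) (Y * Z + W * X) (W * X + Y * Z) (W * Z + Y * X)"
    unfolding adjN unfolding N_eq ZW by (rule mult_four_block_mat[of _ n n _ n _ n _ _ n _ n]) (use X Y Z W in auto)
  moreover have "Z * Y + X * W = X * W + Z * Y" "Z * W + X * Y = X * Y + Z * W"
    "W * X + Y * Z = Y * Z + W * X" "W * Z + Y * X = Y * X + W * Z"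
    using X Y Z W by (auto intro!: comm_add_mat[of _ n n] mult_carrier_mat[of _ n n])
  ultimately show ?thesis
    using carrier_matD[OF N_carrier[OF X, of s]] by (simp add: normal_mat_def e1 e2)
qed

lemma char_poly_block_diag:
  fixes P Q :: "complex mat"
  assumes "P \<in> carrier_mat n n" "Q \<in> carrier_mat n n"
  shows "char_poly (four_block_mat P (0\<^sub>m n n) (0\<^sub>m n n) Q) = char_poly P * char_poly Q"
  using char_poly_factorized[OF assms(1)] char_poly_factorized[OF assms(2)] assms
  by (intro char_poly_0_block[OF refl]) auto

lemma char_poly_N:
  assumes X: "X \<in> carrier_mat n n"
    and "char_poly (herm_part X) = (\<Prod>a\<leftarrow>hs. [:- a, 1:])" "char_poly (skew_part X) = (\<Prod>a\<leftarrow>ks. [:- a, 1:])"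
  shows "char_poly (N X s) = (\<Prod>a\<leftarrow>map (\<lambda>h. h - cnj s) hs @ map (\<lambda>k. \<i> * k + cnj s) ks. [:- a, 1:])"
proof -
  have "char_poly (N X s) = char_poly (X + offdiag X s) * char_poly (X - offdiag X s)"
    unfolding N_eq char_poly_similar[OF block_symmetric_similar[OF X offdiag(1)[OF X]]]
    using X offdiag(1)[OF X] by (intro char_poly_block_diag minus_carrier_mat) auto
  then show ?thesis
    unfolding offdiag(2,3)[OF X] char_poly_affine[OF herm_part[OF X] assms(2)] char_poly_affine[OF skew_part[OF X] assms(3)]
    by simp
qed

text \<open>The sum has the same symmetric block form, so it splits into \<open>?P + ?Q\<close> and
  \<open>?P - ?Q\<close>. Pulling \<open>\<i>\<close> out of the second block turns the added scalar
  \<open>cnj s + cnj t\<close> into a subtracted \<open>\<i> * (cnj s + cnj t)\<close>.\<close>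

lemma det_N_add:
  assumes X: "X \<in> carrier_mat n n" and Y: "Y \<in> carrier_mat n n"
  shows "det (N X s + N Y t) =
    det (herm_part X + herm_part Y - (cnj s + cnj t) \<cdot>\<^sub>m 1\<^sub>m n) *
    (\<i> ^ n * det (skew_part X + skew_part Y - (\<i> * (cnj s + cnj t)) \<cdot>\<^sub>m 1\<^sub>m n))"
proof -
  let ?P = "X + Y" and ?Q = "offdiag X s + offdiag Y t"
  note C = X Y offdiag(1)[OF X, of s] offdiag(1)[OF Y, of t] herm_part(1)[OF X] herm_part(1)[OF Y] skew_part(1)[OF X] skew_part(1)[OF Y]
  have PQ: "?P \<in> carrier_mat n n" "?Q \<in> carrier_mat n n" using C by auto
  have "N X s + N Y t = four_block_mat ?P ?Q ?Q ?P"
    unfolding N_eq by (rule add_four_block_mat) (use C in auto)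
  then have "det (N X s + N Y t) = det (four_block_mat (?P + ?Q) (0\<^sub>m n n) (0\<^sub>m n n) (?P - ?Q))"
    using det_similar[OF block_symmetric_similar[OF PQ]] by simp
  also have "\<dots> = det (?P + ?Q) * det (?P - ?Q)"
    by (rule det_four_block_mat_lower_left_zero) (use PQ in \<open>auto intro: minus_carrier_mat\<close>)
  also have "?P + ?Q = herm_part X + herm_part Y - (cnj s + cnj t) \<cdot>\<^sub>m 1\<^sub>m n"
    using X Y by (intro eq_matI) (auto simp: offdiag_def herm_part_def algebra_simps)
  also have "?P - ?Q = \<i> \<cdot>\<^sub>m (skew_part X + skew_part Y - (\<i> * (cnj s + cnj t)) \<cdot>\<^sub>m 1\<^sub>m n)"
    using X Y by (intro eq_matI) (auto simp: offdiag_def skew_part_def algebra_simps)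
  also have "det \<dots> = \<i> ^ n * det (skew_part X + skew_part Y - (\<i> * (cnj s + cnj t)) \<cdot>\<^sub>m 1\<^sub>m n)"
    using C by (simp add: det_smult)
  finally show ?thesis .
qed

lemma eigenvalue_listing_mset:
  assumes "eigenvalue_listing m A a" "char_poly A = (\<Prod>a\<leftarrow>as. [:- a, 1:])"
  shows "mset (map a [1..<Suc m]) = mset as"
proof (rule mset_eq_of_linear_factors)
  have "(\<Prod>i\<in>{1..m}. [:- a i, 1:]) = (\<Prod>i\<leftarrow>[1..<Suc m]. [:- a i, 1:])"
    by (subst prod.distinct_set_conv_list[symmetric]) (auto simp: atLeastLessThanSuc_atLeastAtMost simp del: upt_Suc)
  then show "(\<Prod>a\<leftarrow>map a [1..<Suc m]. [:- a, 1:]) = (\<Prod>a\<leftarrow>as. [:- a, 1:])"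
    using assms by (simp add: eigenvalue_listing_def o_def del: upt_Suc)
qed

theorem theorem0p1:
  fixes n :: nat and X Y :: "complex mat" and s t :: complex
  assumes "n > 0"
    and "X \<in> carrier_mat n n" and "Y \<in> carrier_mat n n"
  shows "(N X s, N Y t) \<in> MOC"
proof -
  note X = assms(2) and Y = assms(3)
  note HX = herm_part[OF X] and HY = herm_part[OF Y] and KX = skew_part[OF X] and KY = skew_part[OF Y]
  obtain hx where hx: "char_poly (herm_part X) = (\<Prod>a\<leftarrow>hx. [:- a, 1:])" "length hx = n"
    using char_poly_factorized[OF HX(1)] by auto
  obtain hy where hy: "char_poly (herm_part Y) = (\<Prod>a\<leftarrow>hy. [:- a, 1:])" "length hy = n"
    using char_poly_factorized[OF HY(1)] by auto
  obtain kx where kx: "char_poly (skew_part X) = (\<Prod>a\<leftarrow>kx. [:- a, 1:])" "length kx = n"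
    using char_poly_factorized[OF KX(1)] by auto
  obtain ky where ky: "char_poly (skew_part Y) = (\<Prod>a\<leftarrow>ky. [:- a, 1:])" "length ky = n"
    using char_poly_factorized[OF KY(1)] by auto
  define c where "c = cnj s + cnj t"
  define ax where "ax = map (\<lambda>h. h - cnj s) hx @ map (\<lambda>k. \<i> * k + cnj s) kx"
  define by' where "by' = map (\<lambda>h. h - cnj t) hy @ map (\<lambda>k. \<i> * k + cnj t) ky"
  have h: "dominated (det (herm_part X + herm_part Y - c \<cdot>\<^sub>m 1\<^sub>m n))
      (pairing_prods (map (\<lambda>h. h - cnj s) hx) (map (\<lambda>h. h - cnj t) hy))"
  proof (rule dominated_mono[OF sum_dominatedD[OF sum_dominated_all HX(1) HY(1) HX(2) HY(2) hx(1) hy(1)]], rule subsetI)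
    fix q assume "q \<in> pairing_prods (map (\<lambda>a. a - c) hx) hy"
    \<comment> \<open>The common shift is distributed: \<open>a - c + cnj t = a - cnj s\<close> on
      the first list, \<open>b - cnj t\<close> on the second.\<close>
    from pairing_prods_smult[OF this, of 1 "cnj t"]
    show "q \<in> pairing_prods (map (\<lambda>h. h - cnj s) hx) (map (\<lambda>h. h - cnj t) hy)"
      using hx hy by (simp add: c_def o_def algebra_simps)
  qed
  have k: "dominated (\<i> ^ n * det (skew_part X + skew_part Y - (\<i> * c) \<cdot>\<^sub>m 1\<^sub>m n))
      (pairing_prods (map (\<lambda>k. \<i> * k + cnj s) kx) (map (\<lambda>k. \<i> * k + cnj t) ky))"
  proof (rule dominated_image_mult[OF sum_dominatedD[OF sum_dominated_all KX(1) KY(1) KX(2) KY(2) kx(1) ky(1)]])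
    fix q assume "q \<in> pairing_prods (map (\<lambda>a. a - \<i> * c) kx) ky"
    \<comment> \<open>Multiplication by \<open>\<i>\<close> turns the shift
      \<open>- \<i> * c\<close> into \<open>c\<close>; subtracting \<open>cnj t\<close> leaves
      \<open>\<i> * a + cnj s\<close>, and the second list becomes
      \<open>\<i> * b + cnj t\<close>.\<close>
    from pairing_prods_smult[OF this, of \<i> "- cnj t"]
    show "\<i> ^ n * q \<in> pairing_prods (map (\<lambda>k. \<i> * k + cnj s) kx) (map (\<lambda>k. \<i> * k + cnj t) ky)"
      using kx ky by (simp add: c_def o_def algebra_simps)
  qed
  \<comment> \<open>Only pairings that match eigenvalues of corresponding diagonal blocks arise;
    they are among the pairings of the full lists.\<close>
  have dom: "dominated (det (N X s + N Y t)) (pairing_prods ax by')"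
    unfolding det_N_add[OF X Y] c_def[symmetric] ax_def by'_def
    by (rule dominated_mult[OF h k], rule pairing_prods_append) (simp_all add: hx hy kx ky)
  have "det (N X s + N Y t) \<in> convex hull {\<Prod>i\<in>{1..n + n}. a i + b (\<sigma> i) | \<sigma>. \<sigma> permutes {1..n + n}}"
    if a: "eigenvalue_listing (n + n) (N X s) a" and b: "eigenvalue_listing (n + n) (N Y t) b" for a b
  proof -
    have "pairing_prods ax by' = pairing_prods (map a [1..<Suc (n + n)]) (map b [1..<Suc (n + n)])"
    proof (rule pairing_prods_mset)
      show "mset ax = mset (map a [1..<Suc (n + n)])"
        unfolding ax_def by (rule eigenvalue_listing_mset[OF a char_poly_N[OF X hx(1) kx(1)], symmetric])
      show "mset by' = mset (map b [1..<Suc (n + n)])"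
        unfolding by'_def by (rule eigenvalue_listing_mset[OF b char_poly_N[OF Y hy(1) ky(1)], symmetric])
    qed (simp add: ax_def by'_def hx hy kx ky)
    then have "det (N X s + N Y t) \<in> convex hull pairing_prods (map a [1..<Suc (n + n)]) (map b [1..<Suc (n + n)])"
      using dominated_imp_convex_hull[OF finite_pairing_prods dom] by (simp only:)
    then show ?thesis by (rule subsetD[OF hull_mono[OF pairing_prods_permutes]])
  qed
  then show ?thesis
    unfolding MOC_def using N_carrier[OF X] N_carrier[OF Y] normal_N[OF X] normal_N[OF Y] by blast
qed

end
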